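(* Let $d\ge 2$, let $\Omega=\{\xi=(\xi_1,\xi')\in\mathbb{R}\times\mathbb{R}^d : \xi_1>|\xi'|\}$ be the forward light-cone in $\mathbb{R}^{d+1}$, and let $S$ be the cone multiplier operator $$Sf(x)=\int_\Omega \widehat f(\xi)\,e^{2\pi i\langle x,\xi\rangle}\,d\xi,\qquad x\in\mathbb{R}^{d+1}.$$ Fix $r_0>0$ and let $\mathbb{B}=\{x\in\mathbb{R}^{d+1}: |x|<r_0\}$. Let $1\le p,q\le\infty$. Then there exists a constant $C>0$ such that $$\|Sf\|_{L^q(\mathbb{B})}\le C\,\|f\|_{L^p(\mathbb{B})}\qquad\text{for all } f\in C_c^\infty(\mathbb{B})$$ if and only if $1\le q\le 2\le p\le\infty$.
   Context: The Fourier transform is $\widehat f(\xi)=\int_{\mathbb{R}^{d+1}} f(y)\,e^{-2\pi i\langle y,\xi\rangle}\,dy$. $C_c^\infty(\mathbb{B})$ denotes the smooth (complex-valued) functions with compact support in $\mathbb{B}$. *)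

theory Defs
  imports "HOL-Analysis.Analysis" "HOL-Probability.Essential_Supremum"
begin

definition fourier :: "('a::euclidean_space \<Rightarrow> complex) \<Rightarrow> 'a \<Rightarrow> complex" where
  "fourier f \<xi> = (LINT y|lborel. f y * exp (- 2 * pi * \<i> * complex_of_real (y \<bullet> \<xi>)))"

text \<open>
  Points of the space are pairs \<open>(\<xi>\<^sub>1, \<xi>')\<close>; the norm and inner product of the product type
  are the Euclidean ones, and \<^const>\<open>lborel\<close> is Lebesgue measure on all \<open>d + 1\<close> coordinates.
\<close>

definition forward_cone :: "(real \<times> (real ^ 'n)) set" where
  "forward_cone = {(\<xi>\<^sub>1, \<xi>'). \<xi>\<^sub>1 > norm \<xi>'}"

definition cone_multiplier ::
    "(real \<times> (real ^ 'n) \<Rightarrow> complex) \<Rightarrow> real \<times> (real ^ 'n) \<Rightarrow> complex" where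
  "cone_multiplier f x =
     (LINT \<xi>:forward_cone|lborel. fourier f \<xi> * exp (2 * pi * \<i> * complex_of_real (x \<bullet> \<xi>)))"

text \<open>
  \<open>C\<^sup>k\<close> on the whole space: the derivative is taken along arbitrary fixed directions \<open>v\<close>, which in
  finite dimension amounts to \<open>x \<mapsto> Df(x)\<close> being \<open>C\<^sup>k\<close>.
\<close>

primrec C_k :: "nat \<Rightarrow> ('a::euclidean_space \<Rightarrow> 'b::real_normed_vector) \<Rightarrow> bool" where
  "C_k 0 f \<longleftrightarrow> continuous_on UNIV f"
| "C_k (Suc k) f \<longleftrightarrow>
     (\<forall>x. f differentiable (at x)) \<and> (\<forall>v. C_k k (\<lambda>x. frechet_derivative f (at x) v))"

text \<open>Elements of \<open>C\<^sub>c\<^sup>\<infinity>(B)\<close> are identified with their extensions by zero to the whole space.\<close>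

definition smooth_compact_support :: "'a::euclidean_space set \<Rightarrow> ('a \<Rightarrow> complex) set" where
  "smooth_compact_support B =
     {f. (\<forall>k. C_k k f) \<and> compact (closure {x. f x \<noteq> 0}) \<and> closure {x. f x \<noteq> 0} \<subseteq> B}"

text \<open>
  The extended-valued \<open>L\<^sup>p\<close> norm over a set, intended for \<open>1 \<le> p \<le> \<infinity>\<close>. The inner case
  distinction is needed because \<^const>\<open>enn2real\<close> sends \<open>\<infinity>\<close> to \<open>0\<close>.
\<close>

definition Lp_norm :: "ennreal \<Rightarrow> 'a::euclidean_space set \<Rightarrow> ('a \<Rightarrow> complex) \<Rightarrow> ennreal" where
  "Lp_norm p B f =
     (if p = \<infinity> then esssup (restrict_space lborel B) (\<lambda>x. ennreal (norm (f x)))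
      else let I = (\<integral>\<^sup>+ x\<in>B. ennreal (norm (f x) powr enn2real p) \<partial>lborel) in
        if I = \<infinity> then \<infinity> else ennreal (enn2real I powr (1 / enn2real p)))"

end

theory Submission
  imports Defs "HOL-Probability.Characteristic_Functions" "HOL-Probability.Sinc_Integral"
begin

text \<open>
  For \<open>q \<le> 2 \<le> p\<close> the bound is Plancherel's inequality together with Hoelder's inequality on the
  bounded set \<open>B\<close>.

  Conversely, modulating a function by a large multiple of a boundary point \<open>(1, \<omega>)\<close> of the cone
  turns \<open>S\<close>, in the limit, into the multiplier of the half-space \<open>\<xi>\<^sub>1 > \<omega> \<bullet> \<xi>'\<close>, that is, into a
  Hilbert transform along the light ray \<open>(1, - \<omega>)\<close>. It carries a bump on a thin plank along
  this ray to a function which is large on an earlier translate of the plank. A Kakeya compression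
  provides planks along light rays which are disjoint at late times while their early translates
  lie in a set \<open>E\<close> of arbitrarily small measure. Let \<open>f\<close> and \<open>g\<close> be sums, with suitable signs, of
  modulated bumps on the late planks and on the early ones. Then \<open>\<bar>f\<bar> \<le> 1\<close>, \<open>g\<close> lives on \<open>E\<close>, and the
  pairing of \<open>S f\<close> with \<open>g\<close> is at least a constant times the \<open>L\<^sup>2\<close> norm of \<open>g\<close>. If \<open>q > 2\<close>, or,
  moving the self-adjoint operator \<open>S\<close> to \<open>g\<close>, if \<open>p < 2\<close>, then a bound would let Hoelder's
  inequality on \<open>E\<close> force this pairing to be small.
\<close>

subsection \<open>Smooth functions\<close>

lemma C_k_SucI:
  assumes "\<And>x. (f has_derivative f' x) (at x)" "\<And>v. C_k k (\<lambda>x. f' x v)"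
  shows "C_k (Suc k) f"
proof -
  have "frechet_derivative f (at x) = f' x" for x
    using frechet_derivative_at[OF assms(1)] by simp
  then show ?thesis using assms by (auto simp: differentiable_def)
qed

lemma C_k_SucD: "C_k (Suc k) f \<Longrightarrow> C_k k f"
proof (induction k arbitrary: f)
  case 0
  then show ?case
    by (auto intro!: continuous_at_imp_continuous_on differentiable_imp_continuous_within)
next
  case (Suc k)
  then show ?case by (metis C_k.simps(2))
qed

lemma C_k_has_derivative:
  "C_k (Suc k) f \<Longrightarrow> (f has_derivative frechet_derivative f (at x)) (at x)"
  by (simp add: frechet_derivative_works)

lemma C_k_const [simp]: "C_k k (\<lambda>x. c)"
proof (induction k arbitrary: c)
  case (Suc k)
  show ?case by (rule C_k_SucI[where f' = "\<lambda>x v. 0"]) (auto intro: Suc)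
qed auto

lemma C_k_bounded_linear_comp:
  assumes "bounded_linear L"
  shows "C_k k f \<Longrightarrow> C_k k (\<lambda>x. L (f x))"
proof (induction k arbitrary: f)
  case 0
  then show ?case using bounded_linear.continuous_on[OF assms] by simp
next
  case (Suc k)
  show ?case
  proof (rule C_k_SucI[where f' = "\<lambda>x v. L (frechet_derivative f (at x) v)"])
    show "((\<lambda>x. L (f x)) has_derivative (\<lambda>v. L (frechet_derivative f (at x) v))) (at x)" for x
      using bounded_linear.has_derivative[OF assms C_k_has_derivative[OF Suc.prems]] .
    show "C_k k (\<lambda>x. L (frechet_derivative f (at x) v))" for v
      using Suc by simp
  qed
qed

lemma C_k_add: "C_k k f \<Longrightarrow> C_k k g \<Longrightarrow> C_k k (\<lambda>x. f x + g x)"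
proof (induction k arbitrary: f g)
  case 0
  then show ?case by (simp add: continuous_on_add)
next
  case (Suc k)
  show ?case
    by (rule C_k_SucI[OF has_derivative_add[OF C_k_has_derivative[OF Suc.prems(1)] C_k_has_derivative[OF Suc.prems(2)]]])
       (use Suc in simp)
qed

lemma C_k_mult:
  fixes f g :: "'a::euclidean_space \<Rightarrow> 'b::real_normed_algebra"
  shows "C_k k f \<Longrightarrow> C_k k g \<Longrightarrow> C_k k (\<lambda>x. f x * g x)"
proof (induction k arbitrary: f g)
  case 0
  then show ?case by (simp add: continuous_on_mult)
next
  case (Suc k)
  show ?case
    by (rule C_k_SucI[OF has_derivative_mult[OF C_k_has_derivative[OF Suc.prems(1)] C_k_has_derivative[OF Suc.prems(2)]]])
       (intro C_k_add Suc.IH, use Suc.prems C_k_SucD in auto)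
qed

definition smooth :: "('a::euclidean_space \<Rightarrow> 'b::real_normed_vector) \<Rightarrow> bool" where
  "smooth f \<longleftrightarrow> (\<forall>k. C_k k f)"

named_theorems smooth_intros

lemma smooth_const [smooth_intros]: "smooth (\<lambda>x. c)"
  by (simp add: smooth_def)

lemma smooth_bounded_linear_comp:
  "bounded_linear L \<Longrightarrow> smooth f \<Longrightarrow> smooth (\<lambda>x. L (f x))"
  by (simp add: smooth_def C_k_bounded_linear_comp)

lemma smooth_add [smooth_intros]: "smooth f \<Longrightarrow> smooth g \<Longrightarrow> smooth (\<lambda>x. f x + g x)"
  by (simp add: smooth_def C_k_add)

lemma smooth_mult [smooth_intros]:
  fixes f g :: "'a::euclidean_space \<Rightarrow> 'b::real_normed_algebra"
  shows "smooth f \<Longrightarrow> smooth g \<Longrightarrow> smooth (\<lambda>x. f x * g x)"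
  by (simp add: smooth_def C_k_mult)

lemma smooth_minus [smooth_intros]: "smooth f \<Longrightarrow> smooth (\<lambda>x. - f x)"
  by (rule smooth_bounded_linear_comp[OF bounded_linear_minus[OF bounded_linear_ident]])

lemma smooth_diff [smooth_intros]: "smooth f \<Longrightarrow> smooth g \<Longrightarrow> smooth (\<lambda>x. f x - g x)"
  using smooth_add[OF _ smooth_minus, of f g] by simp

lemma smooth_of_real [smooth_intros]:
  "smooth f \<Longrightarrow> smooth (\<lambda>x. complex_of_real (f x))"
  by (rule smooth_bounded_linear_comp[OF bounded_linear_of_real])

lemma smooth_sum [smooth_intros]:
  "(\<And>i. i \<in> I \<Longrightarrow> smooth (f i)) \<Longrightarrow> smooth (\<lambda>x. \<Sum>i\<in>I. f i x)"
  by (induction I rule: infinite_finite_induct) (auto intro: smooth_intros)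

lemma smooth_bounded_linear:
  assumes "bounded_linear L" shows "smooth L"
  unfolding smooth_def
proof
  fix k show "C_k k L"
    by (cases k) (auto intro: C_k_SucI[OF bounded_linear_imp_has_derivative[OF assms]] 
       simp del: C_k.simps(2) simp: linear_continuous_on[OF assms])
qed

lemma smooth_ident [smooth_intros]: "smooth (\<lambda>x. x)"
  by (rule smooth_bounded_linear[OF bounded_linear_ident])

lemma smooth_derivative [smooth_intros]: "smooth f \<Longrightarrow> smooth (\<lambda>x. frechet_derivative f (at x) v)"
  unfolding smooth_def by (metis C_k.simps(2))

lemma smooth_has_derivative:
  "smooth f \<Longrightarrow> (f has_derivative frechet_derivative f (at x)) (at x)"
  unfolding smooth_def using C_k_has_derivative by blast

lemma smooth_continuous_on: "smooth f \<Longrightarrow> continuous_on S f"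
  unfolding smooth_def by (metis C_k.simps(1) continuous_on_subset subset_UNIV)

lemma smooth_inner_left [smooth_intros]: "smooth f \<Longrightarrow> smooth (\<lambda>x. f x \<bullet> c)"
  by (rule smooth_bounded_linear_comp[OF bounded_linear_inner_left])

lemma smooth_inner_const [smooth_intros]: "smooth (\<lambda>x. x \<bullet> c)"
  by (rule smooth_inner_left[OF smooth_ident])

lemma smooth_norm_power2 [smooth_intros]: 
  fixes f :: "'a::euclidean_space \<Rightarrow> 'b::euclidean_space"
  assumes "smooth f" shows "smooth (\<lambda>x. (norm (f x))\<^sup>2)"
proof -
  have "(norm (f x))\<^sup>2 = (\<Sum>b\<in>Basis. (f x \<bullet> b) * (f x \<bullet> b))" for x
    by (simp add: power2_norm_eq_inner euclidean_inner[of "f x" "f x"])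
  then show ?thesis using assms by (simp add: smooth_intros)
qed

lemma has_derivative_exp_complex:
  fixes f :: "'a::real_normed_vector \<Rightarrow> complex"
  assumes "(f has_derivative f') (at x)"
  shows "((\<lambda>x. exp (f x)) has_derivative (\<lambda>v. exp (f x) * f' v)) (at x)"
  using has_derivative_compose[OF assms, of exp "\<lambda>v. exp (f x) * v"] DERIV_exp[of "f x"]
  by (simp add: has_field_derivative_def)

lemma smooth_exp [smooth_intros]:
  fixes f :: "'a::euclidean_space \<Rightarrow> complex"
  assumes "smooth f" shows "smooth (\<lambda>x. exp (f x))"
  unfolding smooth_def
proof
  fix k show "C_k k (\<lambda>x. exp (f x))"
  proof (induction k)
    case 0
    then show ?case using smooth_continuous_on[OF assms] by (auto intro: continuous_intros)
  next
    case (Suc k)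
    show ?case
    proof (rule C_k_SucI[where f' = "\<lambda>x v. exp (f x) * frechet_derivative f (at x) v"])
      show "((\<lambda>x. exp (f x)) has_derivative (\<lambda>v. exp (f x) * frechet_derivative f (at x) v)) (at x)" for x
        by (rule has_derivative_exp_complex[OF smooth_has_derivative[OF assms]])
      show "C_k k (\<lambda>x. exp (f x) * frechet_derivative f (at x) v)" for v
        using Suc smooth_derivative[OF assms] by (auto intro!: C_k_mult simp: smooth_def)
    qed
  qed
qed

text \<open>Closed under differentiation up to linear combinations, which makes smoothness inductive.\<close>
definition flat_exp :: "nat \<Rightarrow> real \<Rightarrow> real" where
  "flat_exp n x = (if x > 0 then exp (- (1 / x)) / x ^ n else 0)"

lemma flat_exp_tendsto_0: "(flat_exp n \<longlongrightarrow> 0) (at 0)"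
proof -
  have "((\<lambda>x::real. exp (- (1 / x)) / x ^ n) \<longlongrightarrow> 0) (at_right 0)"
  proof -
    have "((\<lambda>y::real. y ^ n / exp y) \<longlongrightarrow> 0) at_top" by (rule tendsto_power_div_exp_0)
    then have "((\<lambda>x::real. inverse x ^ n / exp (inverse x)) \<longlongrightarrow> 0) (at_right 0)"
      using filterlim_compose filterlim_inverse_at_top_right by blast
    then show ?thesis by (simp add: exp_minus field_simps)
  qed
  then have r: "(flat_exp n \<longlongrightarrow> 0) (at_right 0)"
    by (rule Lim_transform_eventually) (auto simp: flat_exp_def eventually_at_filter)
  have l: "(flat_exp n \<longlongrightarrow> 0) (at_left 0)"
    by (rule tendsto_eventually) (auto simp: flat_exp_def eventually_at_filter)
  show ?thesis using filterlim_split_at[OF l r] .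
qed

lemma flat_exp_has_derivative: "(flat_exp n has_real_derivative flat_exp (n + 2) x - real n * flat_exp (n + 1) x) (at x)"
proof -
  consider "x > 0" | "x < 0" | "x = 0" by linarith
  then show ?thesis
  proof cases
    case 1
    have p: "real n * x ^ (n - Suc 0) = real n * (x ^ n / x)"
      using 1 by (cases n) auto
    have "((\<lambda>x. exp (- (1 / x)) / x ^ n) has_real_derivative
        (exp (- (1 / x)) * (1 / x\<^sup>2) * x ^ n - exp (- (1 / x)) * (real n * x ^ (n - Suc 0))) / (x ^ n * x ^ n)) (at x)"
      using 1 by (auto intro!: derivative_eq_intros simp: power2_eq_square)
    also have "(exp (- (1 / x)) * (1 / x\<^sup>2) * x ^ n - exp (- (1 / x)) * (real n * x ^ (n - Suc 0))) / (x ^ n * x ^ n) =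
        flat_exp (n + 2) x - real n * flat_exp (n + 1) x"
      unfolding p using 1 by (simp add: flat_exp_def field_simps power2_eq_square)
    finally show ?thesis
      by (rule has_field_derivative_transform_within_open[where S = "{0<..}"]) (use 1 in \<open>auto simp: flat_exp_def\<close>)
  next
    case 2
    have "((\<lambda>x. 0) has_real_derivative flat_exp (n + 2) x - real n * flat_exp (n + 1) x) (at x)"
      using 2 by (auto simp: flat_exp_def)
    then show ?thesis
      by (rule has_field_derivative_transform_within_open[where S = "{..<0}"]) (use 2 in \<open>auto simp: flat_exp_def\<close>)
  next
    case 3
    have "((\<lambda>h. (flat_exp n (0 + h) - flat_exp n 0) / h) \<longlongrightarrow> 0) (at 0)"
      by (rule Lim_transform_eventually[OF flat_exp_tendsto_0[of "n+1"]])
         (auto simp: flat_exp_def eventually_at_filter)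
    then show ?thesis using 3 by (simp add: DERIV_def flat_exp_def)
  qed
qed

lemma smooth_flat_exp [smooth_intros]:
  fixes q :: "'a::euclidean_space \<Rightarrow> real"
  assumes "smooth q" shows "smooth (\<lambda>x. flat_exp n (q x))"
  unfolding smooth_def
proof
  fix k show "C_k k (\<lambda>x. flat_exp n (q x))"
  proof (induction k arbitrary: n)
    case 0
    have "continuous_on UNIV (flat_exp n)"
      using flat_exp_has_derivative by (intro continuous_at_imp_continuous_on) (auto intro: DERIV_isCont)
    then show ?case using smooth_continuous_on[OF assms]
      by (auto intro: continuous_on_compose2)
  next
    case (Suc k)
    let ?d = "\<lambda>x. flat_exp (n + 2) x - real n * flat_exp (n + 1) x"
    show ?case
    proof (rule C_k_SucI[where f' = "\<lambda>x v. ?d (q x) * frechet_derivative q (at x) v"])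
      show "((\<lambda>x. flat_exp n (q x)) has_derivative (\<lambda>v. ?d (q x) * frechet_derivative q (at x) v)) (at x)" for x
        using has_derivative_compose[OF smooth_has_derivative[OF assms, of x], of "flat_exp n" "\<lambda>v. ?d (q x) * v"] flat_exp_has_derivative[of n "q x"]
        by (simp add: has_field_derivative_def)
      have "C_k k (\<lambda>x. flat_exp (n + 2) (q x) + (- real n) * flat_exp (n + 1) (q x))"
        by (intro C_k_add C_k_mult Suc C_k_const)
      then show "C_k k (\<lambda>x. ?d (q x) * frechet_derivative q (at x) v)" for v
        using smooth_derivative[OF assms] by (auto intro!: C_k_mult simp: smooth_def)
    qed
  qed
qed

lemma flat_exp_nonneg: "0 \<le> flat_exp n x" by (simp add: flat_exp_def)
lemma flat_exp_0_le_1: "flat_exp 0 x \<le> 1" by (simp add: flat_exp_def)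
lemma flat_exp_pos_iff: "0 < flat_exp n x \<longleftrightarrow> 0 < x" by (simp add: flat_exp_def)

lemma lborel_integral_affine:
  fixes f :: "'a::euclidean_space \<Rightarrow> 'b::{banach, second_countable_topology}"
  assumes c: "\<And>j. j \<in> Basis \<Longrightarrow> c j \<noteq> (0::real)"
    and T: "T = (\<lambda>x. t + (\<Sum>j\<in>Basis. (c j * (x \<bullet> j)) *\<^sub>R j))"
    and f: "f \<in> borel_measurable borel"
  shows "(LINT x|lborel. f x) = (\<Prod>j\<in>Basis. \<bar>c j\<bar>) *\<^sub>R (LINT x|lborel. f (T x))"
    and "integrable lborel (\<lambda>x. f (T x)) \<longleftrightarrow> integrable lborel f"
proof -
  let ?d = "\<Prod>j\<in>Basis. \<bar>c j\<bar>"
  have d: "?d > 0" using c by (auto intro: prod_pos)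
  have [measurable]: "T \<in> borel_measurable borel" unfolding T by measurable
  note [measurable] = f
  have eq: "lborel = density (distr lborel borel T) (\<lambda>_. ennreal ?d)"
    using lborel_affine_euclidean[of c t] c unfolding T by (simp add: prod_ennreal)
  show "(LINT x|lborel. f x) = ?d *\<^sub>R (LINT x|lborel. f (T x))"
    using d by (subst eq) (simp add: integral_density integral_distr)
  have "integrable lborel f \<longleftrightarrow> integrable lborel (\<lambda>x. ?d *\<^sub>R f (T x))"
    using d by (subst eq) (simp add: integrable_density integrable_distr_eq)
  moreover have "integrable lborel (\<lambda>x. f (T x))" if "integrable lborel (\<lambda>x. ?d *\<^sub>R f (T x))"
  proof -
    define D where "D = ?d"
    have "D > 0" using d by (simp add: D_def)
    with integrable_scaleR_right[OF that, of "inverse D"] show ?thesis by (simp add: D_def[symmetric])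
  qed
  ultimately show "integrable lborel (\<lambda>x. f (T x)) \<longleftrightarrow> integrable lborel f"
    using integrable_scaleR_right[of ?d lborel "\<lambda>x. f (T x)"] by blast
qed

lemma lborel_integral_translate:
  fixes f :: "'a::euclidean_space \<Rightarrow> 'b::{banach, second_countable_topology}"
  assumes [measurable]: "f \<in> borel_measurable borel"
  shows "(LINT x|lborel. f (t + x)) = (LINT x|lborel. f x)"
    and "integrable lborel (\<lambda>x. f (t + x)) \<longleftrightarrow> integrable lborel f"
  using lborel_integral_affine[where c = "\<lambda>_. 1" and t = t and f = f, OF _ refl]
  by (simp_all add: euclidean_representation)

lemma nn_integral_lborel_translate:
  fixes f :: "'a::euclidean_space \<Rightarrow> ennreal"
  assumes [measurable]: "f \<in> borel_measurable borel"
  shows "(\<integral>\<^sup>+x. f (t + x) \<partial>lborel) = (\<integral>\<^sup>+x. f x \<partial>lborel)"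
  by (subst (2) lborel_distr_plus[of t, symmetric]) (simp add: nn_integral_distr)

lemma nn_integral_lborel_uminus:
  fixes f :: "'a::euclidean_space \<Rightarrow> ennreal"
  assumes [measurable]: "f \<in> borel_measurable borel"
  shows "(\<integral>\<^sup>+x. f (- x) \<partial>lborel) = (\<integral>\<^sup>+x. f x \<partial>lborel)"
  by (subst (2) lborel_affine[of "-1::real" 0]) (simp_all add: nn_integral_density nn_integral_distr)

lemma lborel_integral_prod_Basis:
  fixes f :: "'a::euclidean_space \<Rightarrow> real \<Rightarrow> complex"
  assumes "\<And>b. b \<in> Basis \<Longrightarrow> integrable lborel (f b)"
  shows "(LINT x|lborel. (\<Prod>b\<in>Basis. f b (x \<bullet> b))) = (\<Prod>b\<in>(Basis::'a set). (LINT x|lborel. f b x))"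
    and "integrable lborel (\<lambda>x::'a. \<Prod>b\<in>Basis. f b (x \<bullet> b))"
proof -
  interpret product_sigma_finite "\<lambda>_::'a. lborel :: real measure" ..
  have meas: "f b \<in> borel_measurable borel" if "b \<in> Basis" for b
    using assms[OF that] by auto
  have m: "(\<lambda>x::'a. \<Prod>b\<in>Basis. f b (x \<bullet> b)) \<in> borel_measurable borel"
    by (rule borel_measurable_prod, rule measurable_compose[OF _ meas]) auto
  have [simp]: "(\<Prod>b\<in>(Basis::'a set). f b ((\<Sum>b\<in>Basis. x b *\<^sub>R b) \<bullet> b)) = (\<Prod>b\<in>Basis. f b (x b))" for x
    by (rule prod.cong) auto
  show "(LINT x|lborel. (\<Prod>b\<in>Basis. f b (x \<bullet> b))) = (\<Prod>b\<in>(Basis::'a set). (LINT x|lborel. f b x))"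
    unfolding lborel_eq[where 'a = 'a]
    by (subst integral_distr) (use m assms in \<open>auto intro!: product_integral_prod\<close>)
  show "integrable lborel (\<lambda>x::'a. \<Prod>b\<in>Basis. f b (x \<bullet> b))"
    unfolding lborel_eq[where 'a = 'a]
    by (subst integrable_distr_eq) (use m assms in \<open>auto intro!: product_integrable_prod\<close>)
qed

lemma integrable_tensor:
  fixes f :: "'a::euclidean_space \<Rightarrow> 'c::{banach, second_countable_topology, real_normed_field}"
    and g :: "'b::euclidean_space \<Rightarrow> 'c"
  assumes f: "integrable lborel f" and g: "integrable lborel g"
  shows "integrable lborel (\<lambda>(x, y). f x * g y)"
    and "(LINT (x, y)|lborel. f x * g y) = (LINT x|lborel. f x) * (LINT y|lborel. g y)"
proof -
  have [measurable]: "f \<in> borel_measurable borel" "g \<in> borel_measurable borel"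
    using f g by auto
  have "integrable (lborel \<Otimes>\<^sub>M lborel) (\<lambda>(x, y). f x * g y)"
    by (rule lborel_pair.Fubini_integrable) (use f g in \<open>auto simp: norm_mult\<close>)
  note int = this
  then show "integrable lborel (\<lambda>(x, y). f x * g y)" by (simp add: lborel_prod)
  show "(LINT (x, y)|lborel. f x * g y) = (LINT x|lborel. f x) * (LINT y|lborel. g y)"
    using lborel_pair.integral_fst'[OF int] by (simp add: lborel_prod)
qed

subsection \<open>Gaussians\<close>

lemma gauss_fourier_real:
  assumes "\<epsilon> > 0"
  shows "integrable lborel (\<lambda>s::real. exp (- pi * \<epsilon>\<^sup>2 * s\<^sup>2))"
    and "(LINT s|lborel. exp (- pi * \<epsilon>\<^sup>2 * s\<^sup>2) * exp (2 * pi * \<i> * complex_of_real (t * s)))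
       = complex_of_real (exp (- pi * t\<^sup>2 / \<epsilon>\<^sup>2) / \<epsilon>)"
    and "(\<integral>\<^sup>+s. ennreal (exp (- pi * s\<^sup>2 / \<epsilon>\<^sup>2) / \<epsilon>) \<partial>lborel) = 1"
proof -
  define a where "a = sqrt (2 * pi) * \<epsilon>"
  have a: "a > 0" using assms by (simp add: a_def)
  have a2: "a\<^sup>2 = 2 * pi * \<epsilon>\<^sup>2" by (simp add: a_def power_mult_distrib)
  have dens: "std_normal_density (0 + a * s) = exp (- pi * \<epsilon>\<^sup>2 * s\<^sup>2) / sqrt (2 * pi)" for s
    by (simp add: normal_density_def power_mult_distrib a2)
  have "integrable lborel (\<lambda>s. std_normal_density (0 + a * s))"
    using a by (intro lborel_integrable_real_affine) auto
  then have "integrable lborel (\<lambda>s. sqrt (2 * pi) * (exp (- pi * \<epsilon>\<^sup>2 * s\<^sup>2) / sqrt (2 * pi)))"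
    unfolding dens by (rule integrable_mult_right)
  then show "integrable lborel (\<lambda>s::real. exp (- pi * \<epsilon>\<^sup>2 * s\<^sup>2))" by simp
  define u where "u = sqrt (2 * pi) * t / \<epsilon>"
  have ua: "u * a = 2 * pi * t"
    using assms by (simp add: u_def a_def field_simps real_sqrt_mult_self flip: power2_eq_square)
  have u2: "u\<^sup>2 / 2 = pi * t\<^sup>2 / \<epsilon>\<^sup>2" by (simp add: u_def power_mult_distrib power_divide)
  have "complex_of_real (exp (- (u\<^sup>2) / 2)) = char std_normal_distribution u"
    by (simp add: char_std_normal_distribution)
  also have "\<dots> = (LINT x|lborel. std_normal_density x *\<^sub>R iexp (u * x))"
    unfolding char_def by (subst integral_density) auto
  also have "\<dots> = a *\<^sub>R (LINT s|lborel. std_normal_density (0 + a * s) *\<^sub>R iexp (u * (0 + a * s)))"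
    using a by (subst lborel_integral_real_affine[of a _ 0]) auto
  also have "\<dots> = a *\<^sub>R (LINT s|lborel. (1 / sqrt (2 * pi)) *\<^sub>R (exp (- pi * \<epsilon>\<^sup>2 * s\<^sup>2) * exp (2 * pi * \<i> * complex_of_real (t * s))))"
    unfolding dens by (simp add: scaleR_conv_of_real mult.assoc[symmetric] ua flip: of_real_mult) (simp add: mult_ac)
  also have "\<dots> = (a / sqrt (2 * pi)) *\<^sub>R (LINT s|lborel. (exp (- pi * \<epsilon>\<^sup>2 * s\<^sup>2) * exp (2 * pi * \<i> * complex_of_real (t * s))))"
    by (subst integral_scaleR_right) simp
  also have "a / sqrt (2 * pi) = \<epsilon>" by (simp add: a_def)
  finally show "(LINT s|lborel. exp (- pi * \<epsilon>\<^sup>2 * s\<^sup>2) * exp (2 * pi * \<i> * complex_of_real (t * s)))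
       = complex_of_real (exp (- pi * t\<^sup>2 / \<epsilon>\<^sup>2) / \<epsilon>)"
    using assms u2 by (simp add: field_simps scaleR_conv_of_real)
  define \<sigma> where "\<sigma> = \<epsilon> / sqrt (2 * pi)"
  have \<sigma>: "\<sigma> > 0" "\<sigma>\<^sup>2 = \<epsilon>\<^sup>2 / (2 * pi)" "sqrt (2 * pi * \<sigma>\<^sup>2) = \<epsilon>" using assms by (simp_all add: \<sigma>_def power_divide)
  have nd: "normal_density 0 \<sigma> s = exp (- pi * s\<^sup>2 / \<epsilon>\<^sup>2) / \<epsilon>" for s
    unfolding normal_density_def \<sigma>(3) unfolding \<sigma>(2) using assms by (simp add: field_simps)
  have "(\<integral>\<^sup>+s. ennreal (normal_density 0 \<sigma> s) \<partial>lborel) = 1"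
    using \<sigma> by (subst nn_integral_eq_integral) auto
  then show "(\<integral>\<^sup>+s. ennreal (exp (- pi * s\<^sup>2 / \<epsilon>\<^sup>2) / \<epsilon>) \<partial>lborel) = 1"
    unfolding nd .
qed

lemma prod_exp_norm:
  fixes x :: "'a::euclidean_space"
  shows "(\<Prod>b\<in>Basis. exp (c * (x \<bullet> b)\<^sup>2)) = exp (c * (norm x)\<^sup>2)"
proof -
  have "(norm x)\<^sup>2 = (\<Sum>b\<in>Basis. (x \<bullet> b)\<^sup>2)"
    unfolding power2_norm_eq_inner euclidean_inner[of x x] by (simp add: power2_eq_square)
  then show ?thesis by (simp add: exp_sum sum_distrib_left)
qed

lemma gauss_fourier:
  fixes x :: "'a::euclidean_space"
  assumes "\<epsilon> > 0"
  shows "integrable lborel (\<lambda>\<xi>::'a. exp (- pi * \<epsilon>\<^sup>2 * (norm \<xi>)\<^sup>2))"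
    and "(LINT \<xi>|lborel. exp (- pi * \<epsilon>\<^sup>2 * (norm \<xi>)\<^sup>2) * exp (2 * pi * \<i> * complex_of_real (x \<bullet> \<xi>)))
       = complex_of_real (exp (- pi / \<epsilon>\<^sup>2 * (norm x)\<^sup>2) / \<epsilon> ^ DIM('a))"
    and "(\<integral>\<^sup>+x. ennreal (exp (- pi / \<epsilon>\<^sup>2 * (norm (x::'a))\<^sup>2) / \<epsilon> ^ DIM('a)) \<partial>lborel) = 1"
proof -
  let ?g = "\<lambda>s::real. exp (- pi * \<epsilon>\<^sup>2 * s\<^sup>2)"
  have "integrable lborel (\<lambda>\<xi>::'a. \<Prod>b\<in>Basis. complex_of_real (?g (\<xi> \<bullet> b)))"
    by (rule lborel_integral_prod_Basis) (use gauss_fourier_real(1)[OF assms] in simp)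
  then have "integrable lborel (\<lambda>\<xi>::'a. complex_of_real (exp (- pi * \<epsilon>\<^sup>2 * (norm \<xi>)\<^sup>2)))"
    by (simp only: of_real_prod[symmetric] prod_exp_norm)
  then show "integrable lborel (\<lambda>\<xi>::'a. exp (- pi * \<epsilon>\<^sup>2 * (norm \<xi>)\<^sup>2))"
    using integrable_Re by fastforce
  let ?f = "\<lambda>b s. complex_of_real (?g s) * exp (2 * pi * \<i> * complex_of_real ((x \<bullet> b) * s))"
  have int: "integrable lborel (?f b)" for b :: 'a
    by (rule Bochner_Integration.integrable_bound[OF gauss_fourier_real(1)[OF assms]])
       (auto simp: norm_mult)
  have "(\<Prod>b\<in>Basis. ?f b (\<xi> \<bullet> b)) = exp (- pi * \<epsilon>\<^sup>2 * (norm \<xi>)\<^sup>2) * exp (2 * pi * \<i> * complex_of_real (x \<bullet> \<xi>))" for \<xi>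
    by (subst prod.distrib, subst of_real_prod[symmetric], subst prod_exp_norm)
       (simp add: euclidean_inner[of x \<xi>] exp_sum sum_distrib_left)
  then have "(LINT \<xi>|lborel. exp (- pi * \<epsilon>\<^sup>2 * (norm \<xi>)\<^sup>2) * exp (2 * pi * \<i> * complex_of_real (x \<bullet> \<xi>)))
      = (\<Prod>b\<in>Basis. LINT s|lborel. ?f b s)"
    using lborel_integral_prod_Basis(1)[of ?f, OF int] by simp
  also have "\<dots> = complex_of_real (\<Prod>b\<in>Basis. exp (- pi / \<epsilon>\<^sup>2 * (x \<bullet> b)\<^sup>2) / \<epsilon>)"
    unfolding of_real_prod by (intro prod.cong refl, subst gauss_fourier_real(2)[OF assms]) simp
  also have "(\<Prod>b\<in>Basis. exp (- pi / \<epsilon>\<^sup>2 * (x \<bullet> b)\<^sup>2) / \<epsilon>) = exp (- pi / \<epsilon>\<^sup>2 * (norm x)\<^sup>2) / \<epsilon> ^ DIM('a)"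
    by (subst prod_dividef, subst prod_exp_norm) simp
  finally show "(LINT \<xi>|lborel. exp (- pi * \<epsilon>\<^sup>2 * (norm \<xi>)\<^sup>2) * exp (2 * pi * \<i> * complex_of_real (x \<bullet> \<xi>)))
       = complex_of_real (exp (- pi / \<epsilon>\<^sup>2 * (norm x)\<^sup>2) / \<epsilon> ^ DIM('a))" .
  have "(\<integral>\<^sup>+x. ennreal (exp (- pi / \<epsilon>\<^sup>2 * (norm (x::'a))\<^sup>2) / \<epsilon> ^ DIM('a)) \<partial>lborel)
      = (\<integral>\<^sup>+x. (\<Prod>b\<in>Basis. ennreal (exp (- pi / \<epsilon>\<^sup>2 * ((x::'a) \<bullet> b)\<^sup>2) / \<epsilon>)) \<partial>lborel)"
    using assms by (subst prod_ennreal, simp, subst prod_dividef, subst prod_exp_norm) simp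
  also have "\<dots> = (\<Prod>b\<in>(Basis::'a set). (\<integral>\<^sup>+s. ennreal (exp (- pi / \<epsilon>\<^sup>2 * s\<^sup>2) / \<epsilon>) \<partial>lborel))"
    by (rule nn_integral_lborel_prod) auto
  also have "\<dots> = 1"
    using gauss_fourier_real(3)[OF assms] by simp
  finally show "(\<integral>\<^sup>+x. ennreal (exp (- pi / \<epsilon>\<^sup>2 * (norm (x::'a))\<^sup>2) / \<epsilon> ^ DIM('a)) \<partial>lborel) = 1" .
qed

subsection \<open>The Fourier transform of integrable functions\<close>

definition wave :: "real \<Rightarrow> complex" where
  "wave t = exp (- 2 * pi * \<i> * complex_of_real t)"

lemma wave_measurable [measurable]: "wave \<in> borel_measurable borel"
  unfolding wave_def[abs_def] by (intro borel_measurable_continuous_onI continuous_intros)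

lemma norm_wave: "norm (wave t) = 1"
  and wave_add: "wave (s + t) = wave s * wave t"
  and cnj_wave: "cnj (wave t) = wave (- t)"
  by (auto simp: wave_def exp_cnj exp_add[symmetric] ring_distribs)

lemma fourier_wave: "fourier f \<xi> = (LINT y|lborel. f y * wave (y \<bullet> \<xi>))"
  by (simp only: fourier_def wave_def)

lemma fourier_measurable [measurable]:
  assumes [measurable]: "f \<in> borel_measurable borel"
  shows "fourier f \<in> borel_measurable borel"
proof -
  have "(\<lambda>\<xi>. LINT y|lborel. f y * exp (- 2 * pi * \<i> * complex_of_real (y \<bullet> \<xi>))) \<in> borel_measurable borel"
    by measurable
  then show ?thesis by (simp add: fourier_def[abs_def])
qed

lemma integrable_mult_unimodular:
  fixes f u :: "'a \<Rightarrow> complex"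
  assumes "integrable M f" "u \<in> borel_measurable M" "\<And>x. norm (u x) = 1"
  shows "integrable M (\<lambda>x. f x * u x)"
  by (rule Bochner_Integration.integrable_bound[OF assms(1)])
     (use assms in \<open>auto simp: norm_mult\<close>)

lemma norm_fourier_le: "norm (fourier f \<xi>) \<le> (LINT y|lborel. norm (f y))"
proof -
  have "norm (fourier f \<xi>) \<le> (LINT y|lborel. norm (f y * exp (- 2 * pi * \<i> * complex_of_real (y \<bullet> \<xi>))))"
    unfolding fourier_def by (rule integral_norm_bound)
  then show ?thesis by (simp add: norm_mult)
qed

lemma continuous_on_fourier:
  fixes f :: "'a::euclidean_space \<Rightarrow> complex"
  assumes f: "integrable lborel f"
  shows "continuous_on UNIV (fourier f)"
  unfolding continuous_on_sequentially comp_def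
proof safe
  fix u :: "nat \<Rightarrow> 'a" and l assume u: "u \<longlonglongrightarrow> l"
  have [measurable]: "f \<in> borel_measurable borel" using f by auto
  show "(\<lambda>n. fourier f (u n)) \<longlonglongrightarrow> fourier f l"
    unfolding fourier_def
  proof (rule integral_dominated_convergence[where w = "\<lambda>y. norm (f y)"])
    show "AE y in lborel. (\<lambda>n. f y * exp (- 2 * pi * \<i> * complex_of_real (y \<bullet> u n)))
        \<longlonglongrightarrow> f y * exp (- 2 * pi * \<i> * complex_of_real (y \<bullet> l))"
      by (intro AE_I2 tendsto_intros u)
  qed (use f in \<open>auto simp: norm_mult\<close>)
qed

abbreviation (input) energy :: "('a::euclidean_space \<Rightarrow> complex) \<Rightarrow> ennreal" where
  "energy f \<equiv> (\<integral>\<^sup>+x. ennreal ((norm (f x))\<^sup>2) \<partial>lborel)"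

lemma ennreal_lincomb:
  "\<lbrakk>0 \<le> a; 0 \<le> x; 0 \<le> b; 0 \<le> y\<rbrakk> \<Longrightarrow> ennreal (a * x + b * y) = ennreal a * ennreal x + ennreal b * ennreal y"
  by (simp add: ennreal_mult)

text \<open>Schur's test: the product \<open>\<bar>g x\<bar> \<bar>g y\<bar>\<close> is replaced by the average of the squares.\<close>
lemma convolution_form_le:
  fixes g :: "'a::euclidean_space \<Rightarrow> complex" and K :: "'a \<Rightarrow> real"
  assumes [measurable]: "g \<in> borel_measurable borel" "K \<in> borel_measurable borel"
    and K: "\<And>x. K x \<ge> 0" "\<And>x. K (- x) = K x" "(\<integral>\<^sup>+x. ennreal (K x) \<partial>lborel) = 1"
  shows "(\<integral>\<^sup>+x. \<integral>\<^sup>+y. ennreal (norm (g x) * norm (g y) * K (y - x)) \<partial>lborel \<partial>lborel)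
    \<le> energy g"
proof -
  let ?h = "\<lambda>x. ennreal ((norm (g x))\<^sup>2 / 2)"
  have K1: "(\<integral>\<^sup>+y. ennreal (K (y - x)) \<partial>lborel) = 1" for x
    using nn_integral_lborel_translate[of "\<lambda>y. ennreal (K y)" "- x"] K(3) by simp
  have "K (y - x) = K (x - y)" for x y using K(2)[of "x - y"] by simp
  then have K2: "(\<integral>\<^sup>+x. ennreal (K (y - x)) \<partial>lborel) = 1" for y
    using K1[of y] by simp
  have "(\<integral>\<^sup>+x. \<integral>\<^sup>+y. ennreal (norm (g x) * norm (g y) * K (y - x)) \<partial>lborel \<partial>lborel)
     \<le> (\<integral>\<^sup>+x. \<integral>\<^sup>+y. ?h x * ennreal (K (y - x)) + ?h y * ennreal (K (y - x)) \<partial>lborel \<partial>lborel)"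
  proof (intro nn_integral_mono)
    fix x y
    have "norm (g x) * norm (g y) \<le> (norm (g x))\<^sup>2 / 2 + (norm (g y))\<^sup>2 / 2"
      using sum_squares_bound[of "norm (g x)" "norm (g y)"] by simp
    then have "norm (g x) * norm (g y) * K (y - x) \<le> ((norm (g x))\<^sup>2 / 2 + (norm (g y))\<^sup>2 / 2) * K (y - x)"
      using K(1) by (rule mult_right_mono)
    then have "ennreal (norm (g x) * norm (g y) * K (y - x)) \<le> ennreal ((norm (g x))\<^sup>2 / 2 * K (y - x) + (norm (g y))\<^sup>2 / 2 * K (y - x))"
      by (intro ennreal_leI) (simp only: distrib_right)
    also have "\<dots> = ?h x * ennreal (K (y - x)) + ?h y * ennreal (K (y - x))"
      by (rule ennreal_lincomb) (simp_all add: K(1))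
    finally show "ennreal (norm (g x) * norm (g y) * K (y - x)) \<le> ?h x * ennreal (K (y - x)) + ?h y * ennreal (K (y - x))" .
  qed
  also have "\<dots> = (\<integral>\<^sup>+x. \<integral>\<^sup>+y. ?h x * ennreal (K (y - x)) \<partial>lborel \<partial>lborel)
      + (\<integral>\<^sup>+x. \<integral>\<^sup>+y. ?h y * ennreal (K (y - x)) \<partial>lborel \<partial>lborel)"
    by (simp add: nn_integral_add)
  also have "(\<integral>\<^sup>+x. \<integral>\<^sup>+y. ?h x * ennreal (K (y - x)) \<partial>lborel \<partial>lborel) = (\<integral>\<^sup>+x. ?h x \<partial>lborel)"
    by (simp add: nn_integral_cmult K1)
  also have "(\<integral>\<^sup>+x. \<integral>\<^sup>+y. ?h y * ennreal (K (y - x)) \<partial>lborel \<partial>lborel)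
     = (\<integral>\<^sup>+y. \<integral>\<^sup>+x. ?h y * ennreal (K (y - x)) \<partial>lborel \<partial>lborel)"
    by (rule lborel_pair.Fubini'[symmetric]) measurable
  also have "\<dots> = (\<integral>\<^sup>+y. ?h y \<partial>lborel)"
    by (simp add: nn_integral_cmult K2)
  also have "(\<integral>\<^sup>+x. ?h x \<partial>lborel) + (\<integral>\<^sup>+y. ?h y \<partial>lborel) = energy g"
    by (subst nn_integral_add[symmetric]) (auto simp: ennreal_plus[symmetric] simp del: ennreal_plus)
  finally show ?thesis .
qed

lemma fourier_weighted_form:
  fixes f g k :: "'a::euclidean_space \<Rightarrow> complex"
  assumes f: "integrable lborel f" and g: "integrable lborel g" and k: "integrable lborel k"
  shows "integrable lborel (\<lambda>\<xi>. k \<xi> * (fourier f \<xi> * cnj (fourier g \<xi>)))"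
    and "integrable lborel (\<lambda>z. f (fst z) * cnj (g (snd z)) * fourier k (fst z - snd z))"
    and "(LINT \<xi>|lborel. k \<xi> * (fourier f \<xi> * cnj (fourier g \<xi>)))
      = (LINT z|lborel. f (fst z) * cnj (g (snd z)) * fourier k (fst z - snd z))"
proof -
  note e = norm_wave wave_add cnj_wave and F = fourier_wave
  have "integrable lborel (\<lambda>(x, y). f x * cnj (g y))"
    by (rule integrable_tensor(1)) (use f g in auto)
  from integrable_tensor(1)[OF k this]
  have "integrable lborel (\<lambda>p. (case p of (\<xi>, z) \<Rightarrow> k \<xi> * (case z of (x, y) \<Rightarrow> f x * cnj (g y))) * wave ((fst (snd p) - snd (snd p)) \<bullet> fst p))"
    by (rule integrable_mult_unimodular)
       (auto simp: e(1) wave_def intro!: borel_measurable_continuous_onI continuous_intros)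
  then have H: "integrable (lborel \<Otimes>\<^sub>M lborel) (\<lambda>(\<xi>, z). k \<xi> * (f (fst z) * cnj (g (snd z))) * wave ((fst z - snd z) \<bullet> \<xi>))"
    by (simp add: lborel_prod case_prod_beta')
  have L: "(LINT z|lborel. k \<xi> * (f (fst z) * cnj (g (snd z))) * wave ((fst z - snd z) \<bullet> \<xi>)) = k \<xi> * (fourier f \<xi> * cnj (fourier g \<xi>))" for \<xi>
  proof -
    have fe: "integrable lborel (\<lambda>x. f x * wave (x \<bullet> \<xi>))" "integrable lborel (\<lambda>x. g x * wave (x \<bullet> \<xi>))"
      by (rule integrable_mult_unimodular[OF f] integrable_mult_unimodular[OF g]; auto simp: e)+
    have "wave ((a - b) \<bullet> \<xi>) = wave (a \<bullet> \<xi>) * cnj (wave (b \<bullet> \<xi>))" for a b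
      by (simp add: e(2)[symmetric] e(3) inner_diff_left)
    then have "(LINT z|lborel. k \<xi> * (f (fst z) * cnj (g (snd z))) * wave ((fst z - snd z) \<bullet> \<xi>))
      = (LINT z|lborel. k \<xi> * (case z of (x, y) \<Rightarrow> (f x * wave (x \<bullet> \<xi>)) * cnj (g y * wave (y \<bullet> \<xi>))))"
      by (intro Bochner_Integration.integral_cong refl) (auto split: prod.split)
    also have "\<dots> = k \<xi> * (LINT (x, y)|lborel. (f x * wave (x \<bullet> \<xi>)) * cnj (g y * wave (y \<bullet> \<xi>)))"
      by (rule integral_mult_right_zero)
    also have "\<dots> = k \<xi> * (fourier f \<xi> * (LINT y|lborel. cnj (g y * wave (y \<bullet> \<xi>))))"
      by (subst integrable_tensor(2)[OF fe(1) integrable_cnj[OF fe(2)]]) (simp only: F)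
    also have "(LINT y|lborel. cnj (g y * wave (y \<bullet> \<xi>))) = cnj (fourier g \<xi>)"
      unfolding F by (rule Bochner_Integration.integral_cnj)
    finally show ?thesis .
  qed
  have R: "(LINT \<xi>|lborel. k \<xi> * (f (fst z) * cnj (g (snd z))) * wave ((fst z - snd z) \<bullet> \<xi>)) = f (fst z) * cnj (g (snd z)) * fourier k (fst z - snd z)" for z
  proof -
    have "(LINT \<xi>|lborel. k \<xi> * (f (fst z) * cnj (g (snd z))) * wave ((fst z - snd z) \<bullet> \<xi>)) = (LINT \<xi>|lborel. f (fst z) * cnj (g (snd z)) * (k \<xi> * wave (\<xi> \<bullet> (fst z - snd z))))"
      by (intro Bochner_Integration.integral_cong refl) (simp add: inner_commute)
    then show ?thesis by (simp only: integral_mult_right_zero F)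
  qed
  show "integrable lborel (\<lambda>\<xi>. k \<xi> * (fourier f \<xi> * cnj (fourier g \<xi>)))"
    using lborel_pair.integrable_fst'[OF H] by (simp only: case_prod_conv L)
  show "integrable lborel (\<lambda>z. f (fst z) * cnj (g (snd z)) * fourier k (fst z - snd z))"
    using lborel_pair.integrable_snd[OF H] by (simp only: case_prod_conv R)
  show "(LINT \<xi>|lborel. k \<xi> * (fourier f \<xi> * cnj (fourier g \<xi>)))
      = (LINT z|lborel. f (fst z) * cnj (g (snd z)) * fourier k (fst z - snd z))"
    using lborel_pair.Fubini_integral[OF H] by (simp only: L R)
qed

lemma fourier_L2_weighted:
  fixes g :: "'a::euclidean_space \<Rightarrow> complex"
  assumes g: "integrable lborel g" and \<epsilon>: "\<epsilon> > 0"
  shows "(\<integral>\<^sup>+\<xi>. ennreal ((norm (fourier g \<xi>))\<^sup>2 * exp (- pi * \<epsilon>\<^sup>2 * (norm \<xi>)\<^sup>2)) \<partial>lborel)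
    \<le> energy g"
proof -
  have [measurable]: "g \<in> borel_measurable borel" using g by auto
  define k where "k = (\<lambda>\<xi>::'a. exp (- pi * \<epsilon>\<^sup>2 * (norm \<xi>)\<^sup>2))"
  define K where "K = (\<lambda>x::'a. exp (- pi / \<epsilon>\<^sup>2 * (norm x)\<^sup>2) / \<epsilon> ^ DIM('a))"
  have [measurable]: "K \<in> borel_measurable borel" unfolding K_def by measurable
  have k: "integrable lborel (\<lambda>\<xi>. complex_of_real (k \<xi>))" "\<And>\<xi>. k \<xi> \<ge> 0"
    using gauss_fourier(1)[OF \<epsilon>] by (auto simp: k_def)
  have kK: "fourier (\<lambda>\<xi>. complex_of_real (k \<xi>)) x = complex_of_real (K x)" for x
    using gauss_fourier(2)[OF \<epsilon>, of "- x"] by (simp add: fourier_def k_def K_def inner_commute)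
  have K0: "K x \<ge> 0" for x using \<epsilon> by (simp add: K_def)
  note form = fourier_weighted_form[OF g g k(1), unfolded kK complex_norm_square[symmetric] of_real_mult[symmetric]]
  have Fint: "integrable lborel (\<lambda>\<xi>. k \<xi> * (norm (fourier g \<xi>))\<^sup>2)"
    using integrable_Re[OF form(1)] by simp
  have "(\<integral>\<^sup>+\<xi>. ennreal (k \<xi> * (norm (fourier g \<xi>))\<^sup>2) \<partial>lborel) = ennreal (LINT \<xi>|lborel. k \<xi> * (norm (fourier g \<xi>))\<^sup>2)"
    by (rule nn_integral_eq_integral[OF Fint]) (use k in auto)
  also have "\<dots> \<le> ennreal (norm (LINT z|lborel. g (fst z) * cnj (g (snd z)) * K (fst z - snd z)))"
    unfolding form(3)[symmetric] integral_complex_of_real by (rule ennreal_leI) simp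
  also have "\<dots> \<le> (\<integral>\<^sup>+z. ennreal (norm (g (fst z) * cnj (g (snd z)) * K (fst z - snd z))) \<partial>lborel)"
    by (rule integral_norm_bound_ennreal[OF form(2)])
  also have "\<dots> = (\<integral>\<^sup>+z. (\<lambda>(x, y). ennreal (norm (g x) * norm (g y) * K (x - y))) z \<partial>(lborel \<Otimes>\<^sub>M lborel))"
    using K0 by (simp add: lborel_prod norm_mult case_prod_beta')
  also have "\<dots> = (\<integral>\<^sup>+x. \<integral>\<^sup>+y. ennreal (norm (g x) * norm (g y) * K (x - y)) \<partial>lborel \<partial>lborel)"
  proof -
    have "(\<lambda>(x, y). ennreal (norm (g x) * norm (g y) * K (x - y))) \<in> borel_measurable (lborel \<Otimes>\<^sub>M lborel)"
      by measurable
    from lborel.nn_integral_fst[OF this] show ?thesis by simp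
  qed
  also have "\<dots> = (\<integral>\<^sup>+x. \<integral>\<^sup>+y. ennreal (norm (g x) * norm (g y) * K (y - x)) \<partial>lborel \<partial>lborel)"
    by (simp add: K_def norm_minus_commute)
  also have "\<dots> \<le> energy g"
    by (rule convolution_form_le) (use gauss_fourier(3)[OF \<epsilon>, where 'a = 'a] \<epsilon> in \<open>auto simp: K_def\<close>)
  finally show ?thesis by (simp add: k_def mult.commute)
qed

theorem fourier_L2_le:
  fixes g :: "'a::euclidean_space \<Rightarrow> complex"
  assumes g: "integrable lborel g"
  shows "energy (fourier g) \<le> energy g"
proof -
  have [measurable]: "g \<in> borel_measurable borel" using g by auto
  define \<epsilon> where "\<epsilon> = (\<lambda>n. 1 / real (Suc n))"
  have \<epsilon>0: "\<epsilon> \<longlonglongrightarrow> 0" unfolding \<epsilon>_def by (rule LIMSEQ_Suc[OF lim_1_over_n])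
  let ?u = "\<lambda>n \<xi>. ennreal ((norm (fourier g \<xi>))\<^sup>2 * exp (- pi * (\<epsilon> n)\<^sup>2 * (norm \<xi>)\<^sup>2))"
  have "(\<lambda>n. ?u n \<xi>) \<longlonglongrightarrow> ennreal ((norm (fourier g \<xi>))\<^sup>2 * exp (- pi * 0\<^sup>2 * (norm \<xi>)\<^sup>2))" for \<xi>
    by (intro tendsto_intros \<epsilon>0)
  then have "ennreal ((norm (fourier g \<xi>))\<^sup>2) = liminf (\<lambda>n. ?u n \<xi>)" for \<xi>
    by (intro lim_imp_Liminf[symmetric]) auto
  then have "energy (fourier g) = (\<integral>\<^sup>+\<xi>. liminf (\<lambda>n. ?u n \<xi>) \<partial>lborel)"
    by simp
  also have "\<dots> \<le> liminf (\<lambda>n. \<integral>\<^sup>+\<xi>. ?u n \<xi> \<partial>lborel)"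
    by (rule nn_integral_liminf) measurable
  also have "\<dots> \<le> energy g"
  proof -
    have "\<forall>n. (\<integral>\<^sup>+\<xi>. ?u n \<xi> \<partial>lborel) \<le> energy g"
      by (intro allI fourier_L2_weighted[OF g]) (simp add: \<epsilon>_def)
    then have "liminf (\<lambda>n. \<integral>\<^sup>+\<xi>. ?u n \<xi> \<partial>lborel) \<le> liminf (\<lambda>n. \<integral>\<^sup>+x. ennreal ((norm (g x))\<^sup>2) \<partial>lborel)"
      by (intro Liminf_mono always_eventually)
    then show ?thesis by (simp add: Liminf_const)
  qed
  finally show ?thesis .
qed

subsection \<open>Test functions\<close>

abbreviation (input) test_fns :: "'a::euclidean_space set \<Rightarrow> ('a \<Rightarrow> complex) set" where
  "test_fns \<equiv> smooth_compact_support"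

lemma test_fnI:
  assumes "smooth f" "compact K" "K \<subseteq> B" "\<And>x. f x \<noteq> 0 \<Longrightarrow> x \<in> K"
  shows "f \<in> test_fns B"
proof -
  have "closure {x. f x \<noteq> 0} \<subseteq> K"
    using assms by (intro closure_minimal compact_imp_closed) auto
  moreover have "compact (closure {x. f x \<noteq> 0})"
    using calculation assms(2) by (meson closed_closure compact_Int_closed compact_eq_bounded_closed bounded_subset)
  ultimately show ?thesis
    using assms by (auto simp: smooth_compact_support_def smooth_def)
qed

lemma
  assumes "f \<in> test_fns B"
  shows test_fn_smooth: "smooth f"
    and test_fn_compact: "compact (closure {x. f x \<noteq> 0})"
    and test_fn_subset: "closure {x. f x \<noteq> 0} \<subseteq> B"
  using assms by (auto simp: smooth_compact_support_def smooth_def)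

lemma test_fn_zero:
  "f \<in> test_fns B \<Longrightarrow> x \<notin> B \<Longrightarrow> f x = 0"
  using test_fn_subset[of f B] closure_subset[of "{x. f x \<noteq> 0}"] by auto

lemma test_fn_measurable [measurable_dest]:
  "f \<in> test_fns B \<Longrightarrow> f \<in> borel_measurable borel"
  using test_fn_smooth smooth_continuous_on borel_measurable_continuous_onI by blast

lemma test_fn_integrable:
  assumes "f \<in> test_fns B" shows "integrable lborel f"
proof -
  let ?K = "closure {x. f x \<noteq> 0}"
  have "integrable lborel (\<lambda>x. indicator ?K x *\<^sub>R f x)"
    by (intro borel_integrable_compact test_fn_compact[OF assms]
        smooth_continuous_on test_fn_smooth[OF assms])
  also have "(\<lambda>x. indicator ?K x *\<^sub>R f x) = f"
    using closure_subset[of "{x. f x \<noteq> 0}"] by (auto simp: fun_eq_iff indicator_def)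
  finally show ?thesis .
qed

lemma test_fn_mult:
  assumes "f \<in> test_fns B" "smooth g"
  shows "(\<lambda>x. f x * g x) \<in> test_fns B" "(\<lambda>x. g x * f x) \<in> test_fns B"
proof -
  let ?K = "closure {x. f x \<noteq> 0}"
  have K: "x \<in> ?K" if "f x \<noteq> 0" for x using that closure_subset[of "{x. f x \<noteq> 0}"] by auto
  have f: "smooth f" by (rule test_fn_smooth[OF assms(1)])
  note c = test_fn_compact[OF assms(1)] test_fn_subset[OF assms(1)]
  show "(\<lambda>x. f x * g x) \<in> test_fns B"
    by (rule test_fnI[OF smooth_mult[OF f assms(2)] c]) (rule K, simp)
  show "(\<lambda>x. g x * f x) \<in> test_fns B"
    by (rule test_fnI[OF smooth_mult[OF assms(2) f] c]) (rule K, simp)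
qed

lemma test_fn_add:
  assumes "f \<in> test_fns B" "g \<in> test_fns B"
  shows "(\<lambda>x. f x + g x) \<in> test_fns B"
proof (rule test_fnI)
  let ?K = "closure {x. f x \<noteq> 0} \<union> closure {x. g x \<noteq> 0}"
  show "smooth (\<lambda>x. f x + g x)"
    by (intro smooth_add test_fn_smooth[OF assms(1)] test_fn_smooth[OF assms(2)])
  show "compact ?K" "?K \<subseteq> B"
    by (intro compact_Un test_fn_compact[OF assms(1)] test_fn_compact[OF assms(2)],
        intro Un_least test_fn_subset[OF assms(1)] test_fn_subset[OF assms(2)])
  show "x \<in> ?K" if "f x + g x \<noteq> 0" for x
  proof -
    have "f x \<noteq> 0 \<or> g x \<noteq> 0" using that by auto
    then show ?thesis
      using closure_subset[of "{x. f x \<noteq> 0}"] closure_subset[of "{x. g x \<noteq> 0}"] by auto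
  qed
qed

lemma test_fn_zero_fun [simp]: "(\<lambda>x. 0) \<in> test_fns B"
  by (rule test_fnI[where K = "{}"]) (auto intro: smooth_intros)

lemma test_fn_sum:
  "(\<And>i. i \<in> I \<Longrightarrow> f i \<in> test_fns B) \<Longrightarrow> (\<lambda>x. \<Sum>i\<in>I. f i x) \<in> test_fns B"
  by (induction I rule: infinite_finite_induct) (auto intro: test_fn_add)

lemma test_fn_derivative:
  assumes f: "f \<in> test_fns B"
  shows "(\<lambda>x. frechet_derivative f (at x) v) \<in> test_fns B"
proof (rule test_fnI)
  let ?K = "closure {x. f x \<noteq> 0}"
  show "smooth (\<lambda>x. frechet_derivative f (at x) v)"
    by (intro smooth_intros test_fn_smooth[OF f])
  show "compact ?K" "?K \<subseteq> B"
    using f by (rule test_fn_compact, rule test_fn_subset)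
  show "x \<in> ?K" if "frechet_derivative f (at x) v \<noteq> 0" for x
  proof (rule ccontr)
    assume x: "x \<notin> ?K"
    have "((\<lambda>x. 0) has_derivative (\<lambda>v. 0)) (at x)" by simp
    then have "(f has_derivative (\<lambda>v. 0)) (at x)"
      by (rule has_derivative_transform_within_open[of _ _ _ _ "- ?K"])
         (use x closure_subset[of "{x. f x \<noteq> 0}"] in auto)
    then show False using that frechet_derivative_at by metis
  qed
qed

lemma integral_derivative_eq_0:
  fixes f :: "'a::euclidean_space \<Rightarrow> complex"
  assumes f: "f \<in> test_fns B"
  shows "(LINT x|lborel. frechet_derivative f (at x) v) = 0"
proof -
  define D where "D = (\<lambda>x. frechet_derivative f (at x) v)"
  have D: "D \<in> test_fns B"
    unfolding D_def by (rule test_fn_derivative[OF f])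
  note Dint = test_fn_integrable[OF D]
  note fint = test_fn_integrable[OF f]
  have Dc: "continuous_on UNIV D"
    using D test_fn_smooth smooth_continuous_on by blast
  have [measurable]: "D \<in> borel_measurable borel" "f \<in> borel_measurable borel" using Dint fint by auto
  have FTC: "(LINT s|lborel. indicator {0..1} s *\<^sub>R D (s *\<^sub>R v + x)) = f (v + x) - f x" for x
  proof -
    have "((\<lambda>s. f (s *\<^sub>R v + x)) has_vector_derivative D (s *\<^sub>R v + x)) (at s within {0..1})" for s
    proof -
      have "(f has_derivative frechet_derivative f (at (s *\<^sub>R v + x))) (at (s *\<^sub>R v + x))"
        by (rule smooth_has_derivative[OF test_fn_smooth[OF f]])
      moreover have "((\<lambda>s. s *\<^sub>R v + x) has_derivative (\<lambda>t. t *\<^sub>R v)) (at s within {0..1})"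
        by (auto intro!: derivative_eq_intros)
      ultimately have "((\<lambda>s. f (s *\<^sub>R v + x)) has_derivative (\<lambda>t. frechet_derivative f (at (s *\<^sub>R v + x)) (t *\<^sub>R v))) (at s within {0..1})"
        by (rule has_derivative_compose[rotated])
      then show ?thesis
        using has_derivative_bounded_linear[OF smooth_has_derivative[OF test_fn_smooth[OF f], of "s *\<^sub>R v + x"]]
        by (simp add: has_vector_derivative_def D_def linear_cmul bounded_linear.linear)
    qed
    then have "(LINT s|lborel. indicator {0..1} s *\<^sub>R D (s *\<^sub>R v + x)) = f (1 *\<^sub>R v + x) - f (0 *\<^sub>R v + x)"
      by (intro integral_FTC_Icc continuous_on_compose2[OF Dc] continuous_intros) auto
    then show ?thesis by simp
  qed
  have int: "integrable (lborel \<Otimes>\<^sub>M lborel) (\<lambda>(s, x). indicator {0..1::real} s *\<^sub>R D (s *\<^sub>R v + x))"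
  proof (rule lborel_pair.Fubini_integrable)
    have eq: "(LINT x|lborel. norm (indicator {0..1} s *\<^sub>R D (s *\<^sub>R v + x))) = indicator {0..1} s * (LINT x|lborel. norm (D x))" for s :: real
      using lborel_integral_translate(1)[of "\<lambda>x. norm (D x)" "s *\<^sub>R v"] by simp
    then show "integrable lborel (\<lambda>s::real. LINT x|lborel. norm (case (s, x) of (s, x) \<Rightarrow> indicator {0..1} s *\<^sub>R D (s *\<^sub>R v + x)))"
      by (simp only: case_prod_conv eq) (intro integrable_mult_left integrable_real_indicator, auto)
    show "AE s in lborel. integrable lborel (\<lambda>x. case (s, x) of (s, x) \<Rightarrow> indicator {0..1::real} s *\<^sub>R D (s *\<^sub>R v + x))"
      using lborel_integral_translate(2)[of D] Dint by simp
  qed measurable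
  have "(LINT x|lborel. D x) = (LINT s|lborel. indicator {0..1::real} s *\<^sub>R (LINT x|lborel. D x))"
    by simp
  also have "\<dots> = (LINT s|lborel. LINT x|lborel. indicator {0..1::real} s *\<^sub>R D (s *\<^sub>R v + x))"
    using lborel_integral_translate(1)[of D] by simp
  also have "\<dots> = (LINT x|lborel. LINT s|lborel. indicator {0..1::real} s *\<^sub>R D (s *\<^sub>R v + x))"
    using lborel_pair.Fubini_integral[OF int] by simp
  also have "\<dots> = (LINT x|lborel. f (v + x) - f x)"
    unfolding FTC ..
  also have "\<dots> = 0"
    using lborel_integral_translate[of f v] fint by simp
  finally show ?thesis by (simp add: D_def)
qed

lemma fourier_derivative:
  fixes f :: "'a::euclidean_space \<Rightarrow> complex"
  assumes f: "f \<in> test_fns B"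
  shows "fourier (\<lambda>x. frechet_derivative f (at x) v) \<xi> = 2 * pi * \<i> * complex_of_real (v \<bullet> \<xi>) * fourier f \<xi>"
proof -
  define e where "e = (\<lambda>y. exp (- 2 * pi * \<i> * complex_of_real (y \<bullet> \<xi>)))"
  define D where "D = (\<lambda>x. frechet_derivative f (at x) v)"
  let ?c = "2 * pi * \<i> * complex_of_real (v \<bullet> \<xi>)"
  have e: "smooth e" unfolding e_def
    by (intro smooth_intros)
  have "(e has_derivative (\<lambda>v. e y * (- 2 * pi * \<i> * complex_of_real (v \<bullet> \<xi>)))) (at y)" for y
    unfolding e_def by (rule has_derivative_exp_complex) (auto intro!: derivative_eq_intros)
  from has_derivative_mult[OF smooth_has_derivative[OF test_fn_smooth[OF f]] this]
  have fe: "frechet_derivative (\<lambda>y. f y * e y) (at y) v = D y * e y - ?c * (f y * e y)" for y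
    unfolding D_def by (subst frechet_derivative_at[symmetric], assumption) (simp add: algebra_simps)
  have int: "integrable lborel (\<lambda>y. f y * e y)" "integrable lborel (\<lambda>y. D y * e y)"
    unfolding D_def
    by (rule test_fn_integrable[of _ B],
        intro test_fn_mult(1) test_fn_derivative f e)+
  have "0 = (LINT y|lborel. D y * e y - ?c * (f y * e y))"
    unfolding fe[symmetric]
    by (rule integral_derivative_eq_0[symmetric], rule test_fn_mult(1)[OF f e])
  also have "\<dots> = fourier D \<xi> - ?c * fourier f \<xi>"
    using int by (simp add: fourier_def e_def)
  finally show ?thesis by (simp add: D_def)
qed

lemma integrable_Poisson_kernel: "integrable lborel (\<lambda>s::real. inverse (1 + (2 * pi * s)\<^sup>2))"
proof -
  have "integrable lborel (\<lambda>x::real. inverse (1 + x\<^sup>2))"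
    using integrable_inverse_1_plus_square by (simp add: set_integrable_def)
  from lborel_integrable_real_affine[OF this, of "2 * pi" 0] show ?thesis by simp
qed

lemma fourier_elliptic_multiple:
  fixes f :: "'a::euclidean_space \<Rightarrow> complex"
  assumes f: "f \<in> test_fns B" and S: "finite S"
  shows "\<exists>F\<in>test_fns B. \<forall>\<xi>. fourier F \<xi> = (\<Prod>b\<in>S. complex_of_real (1 + (2 * pi * (\<xi> \<bullet> b))\<^sup>2)) * fourier f \<xi>"
  using S
proof induction
  case empty
  then show ?case using f by auto
next
  case (insert b S)
  then obtain F where F: "F \<in> test_fns B"
    "\<And>\<xi>. fourier F \<xi> = (\<Prod>b\<in>S. complex_of_real (1 + (2 * pi * (\<xi> \<bullet> b))\<^sup>2)) * fourier f \<xi>" by blast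
  define D where "D = (\<lambda>x. frechet_derivative F (at x) b)"
  define D2 where "D2 = (\<lambda>x. frechet_derivative D (at x) b)"
  have D: "D \<in> test_fns B" "D2 \<in> test_fns B"
    unfolding D_def D2_def by (intro test_fn_derivative F)+
  let ?G = "\<lambda>x. F x + (-1) * D2 x"
  have G: "?G \<in> test_fns B"
    by (intro test_fn_add test_fn_mult smooth_intros F D)
  have "fourier D2 \<xi> = - complex_of_real ((2 * pi * (\<xi> \<bullet> b))\<^sup>2) * fourier F \<xi>" for \<xi>
    unfolding D2_def fourier_derivative[OF D(1)] unfolding D_def fourier_derivative[OF F(1)]
    by (simp add: power2_eq_square inner_commute)
  moreover have "fourier ?G \<xi> = fourier F \<xi> - fourier D2 \<xi>" for \<xi>
  proof -
    have "integrable lborel (\<lambda>y. F y * exp (- 2 * pi * \<i> * complex_of_real (y \<bullet> \<xi>)))"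
      "integrable lborel (\<lambda>y. D2 y * exp (- 2 * pi * \<i> * complex_of_real (y \<bullet> \<xi>)))"
      by (rule test_fn_integrable[of _ B], intro test_fn_mult(1) F D smooth_intros)+
    then show ?thesis by (simp add: fourier_def ring_distribs)
  qed
  ultimately have "fourier ?G \<xi> = complex_of_real (1 + (2 * pi * (\<xi> \<bullet> b))\<^sup>2) * fourier F \<xi>" for \<xi>
    by (simp add: algebra_simps)
  with F(2) G insert show ?case
    by (intro bexI[of _ ?G]) (simp_all add: mult.assoc)
qed

lemma fourier_integrable:
  fixes f :: "'a::euclidean_space \<Rightarrow> complex"
  assumes f: "f \<in> test_fns B"
  shows "integrable lborel (fourier f)"
proof -
  obtain F where F: "F \<in> test_fns B"
    "\<And>\<xi>. fourier F \<xi> = (\<Prod>b\<in>Basis. complex_of_real (1 + (2 * pi * (\<xi> \<bullet> b))\<^sup>2)) * fourier f \<xi>"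
    using fourier_elliptic_multiple[OF f finite_Basis] by blast
  let ?C = "LINT y|lborel. norm (F y)"
  let ?P = "\<lambda>\<xi>::'a. \<Prod>b\<in>Basis. 1 + (2 * pi * (\<xi> \<bullet> b))\<^sup>2"
  have P: "?P \<xi> > 0" for \<xi> by (intro prod_pos) (auto intro: add_pos_nonneg)
  have bound: "norm (fourier f \<xi>) \<le> ?C * inverse (?P \<xi>)" for \<xi>
  proof -
    have "?P \<xi> * norm (fourier f \<xi>) = norm (fourier F \<xi>)"
      unfolding F(2) of_real_prod[symmetric] norm_mult norm_of_real using P[of \<xi>] by simp
    also have "\<dots> \<le> ?C" by (rule norm_fourier_le)
    finally show ?thesis using P[of \<xi>] by (simp add: field_simps)
  qed
  have "integrable lborel (\<lambda>\<xi>::'a. \<Prod>b\<in>Basis. complex_of_real (inverse (1 + (2 * pi * (\<xi> \<bullet> b))\<^sup>2)))"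
    by (intro lborel_integral_prod_Basis(2) integrable_of_real integrable_Poisson_kernel)
  then have "integrable lborel (\<lambda>\<xi>. ?C * complex_of_real (inverse (?P \<xi>)))"
    by (intro integrable_mult_right) (simp only: prod_inversef[symmetric] o_def of_real_prod)
  then show ?thesis
  proof (rule Bochner_Integration.integrable_bound)
    show "fourier f \<in> borel_measurable lborel" 
      using test_fn_integrable[OF f] by auto
    have "norm (fourier f \<xi>) \<le> norm (?C * complex_of_real (inverse (?P \<xi>)))" for \<xi>
      using bound[of \<xi>] abs_ge_self order_trans unfolding of_real_mult[symmetric] norm_of_real by blast
    then show "AE \<xi> in lborel. norm (fourier f \<xi>) \<le> norm (?C * complex_of_real (inverse (?P \<xi>)))"
      by simp
  qed
qed

lemma borel_measurable_cnj [measurable]: "cnj \<in> borel_measurable borel"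
  by (intro borel_measurable_continuous_onI continuous_intros)

lemma fourier_product_integrable:
  fixes f g :: "'a::euclidean_space \<Rightarrow> complex"
  assumes f: "f \<in> test_fns U" and g: "g \<in> test_fns V"
  shows "integrable lborel (\<lambda>x. fourier f x * cnj (fourier g x))"
proof (rule Bochner_Integration.integrable_bound)
  show "integrable lborel (\<lambda>x. complex_of_real (LINT y|lborel. norm (g y)) * fourier f x)"
    using fourier_integrable[OF f] by simp
  show "(\<lambda>x. fourier f x * cnj (fourier g x)) \<in> borel_measurable lborel"
    using f g by (auto dest!: fourier_integrable borel_measurable_integrable)
  show "AE x in lborel. norm (fourier f x * cnj (fourier g x)) \<le> norm (complex_of_real (LINT y|lborel. norm (g y)) * fourier f x)"
    using norm_fourier_le[of g] by (auto simp: norm_mult mult.commute intro!: mult_left_mono order_trans[OF _ abs_ge_self])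
qed

subsection \<open>The cone multiplier on test functions\<close>

lemma forward_cone_measurable [measurable]: "forward_cone \<in> sets borel"
proof -
  have "forward_cone = {x :: real \<times> (real ^ 'n). norm (snd x) < fst x}"
    by (auto simp: forward_cone_def)
  also have "\<dots> \<in> sets borel"
    by (intro borel_open open_Collect_less continuous_intros)
  finally show ?thesis .
qed

lemma cone_multiplier_eq_fourier:
  "cone_multiplier f x = fourier (\<lambda>\<xi>. indicator forward_cone \<xi> *\<^sub>R fourier f \<xi>) (- x)"
  by (simp add: cone_multiplier_def fourier_def set_lebesgue_integral_def inner_commute)

lemma cone_cutoff_integrable:
  fixes f :: "real \<times> (real ^ 'n) \<Rightarrow> complex"
  assumes f: "f \<in> test_fns B"
  shows "integrable lborel (\<lambda>\<xi>. indicator forward_cone \<xi> *\<^sub>R fourier f \<xi>)"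
  by (intro integrable_mult_indicator fourier_integrable[OF f]) simp

lemma cone_multiplier_measurable [measurable]:
  fixes f :: "real \<times> (real ^ 'n) \<Rightarrow> complex"
  assumes f: "f \<in> test_fns B"
  shows "cone_multiplier f \<in> borel_measurable borel"
  unfolding cone_multiplier_eq_fourier[abs_def]
  using cone_cutoff_integrable[OF f] by measurable

lemma cone_multiplier_L2_le:
  fixes f :: "real \<times> (real ^ 'n) \<Rightarrow> complex"
  assumes f: "f \<in> test_fns B"
  shows "energy (cone_multiplier f) \<le> energy f"
proof -
  let ?g = "\<lambda>\<xi>. indicator forward_cone \<xi> *\<^sub>R fourier f \<xi>"
  have [measurable]: "?g \<in> borel_measurable borel" "fourier f \<in> borel_measurable borel"
    using cone_cutoff_integrable[OF f] fourier_integrable[OF f] by auto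
  have "energy (cone_multiplier f) = energy (fourier ?g)"
    unfolding cone_multiplier_eq_fourier
    by (rule nn_integral_lborel_uminus) measurable
  also have "\<dots> \<le> energy ?g"
    by (rule fourier_L2_le[OF cone_cutoff_integrable[OF f]])
  also have "\<dots> \<le> energy (fourier f)"
    by (intro nn_integral_mono ennreal_leI) (auto simp: indicator_def)
  also have "\<dots> \<le> energy f"
    by (rule fourier_L2_le[OF test_fn_integrable[OF f]])
  finally show ?thesis .
qed

lemma cone_multiplier_Parseval:
  fixes f g :: "real \<times> (real ^ 'n) \<Rightarrow> complex"
  assumes f: "f \<in> test_fns B" and g: "g \<in> test_fns B'"
  shows "(LINT x|lborel. cone_multiplier f x * cnj (g x))
    = (LINT \<xi>:forward_cone|lborel. fourier f \<xi> * cnj (fourier g \<xi>))"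
    and "integrable lborel (\<lambda>x. cone_multiplier f x * cnj (g x))"
proof -
  define F where "F = (\<lambda>\<xi>. indicator forward_cone \<xi> *\<^sub>R fourier f \<xi>)"
  define e where "e = (\<lambda>t. exp (2 * pi * \<i> * complex_of_real t))"
  have F: "integrable lborel F" unfolding F_def by (rule cone_cutoff_integrable[OF f])
  note gint = test_fn_integrable[OF g]
  have S: "cone_multiplier f x = (LINT \<xi>|lborel. F \<xi> * e (x \<bullet> \<xi>))" for x
    by (simp add: cone_multiplier_def set_lebesgue_integral_def F_def e_def)
  have "integrable lborel (\<lambda>p. (case p of (x, \<xi>) \<Rightarrow> cnj (g x) * F \<xi>) * e (fst p \<bullet> snd p))"
    by (rule integrable_mult_unimodular, rule integrable_tensor(1))
       (use gint F in \<open>auto simp: e_def intro!: borel_measurable_continuous_onI continuous_intros\<close>)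
  then have int: "integrable (lborel \<Otimes>\<^sub>M lborel) (\<lambda>(x, \<xi>). cnj (g x) * F \<xi> * e (x \<bullet> \<xi>))"
    by (simp add: lborel_prod case_prod_beta')
  have inner: "(LINT \<xi>|lborel. cnj (g x) * F \<xi> * e (x \<bullet> \<xi>)) = cone_multiplier f x * cnj (g x)" for x
    unfolding S by (subst integral_mult_left_zero[symmetric]) (simp add: mult_ac)
  show "integrable lborel (\<lambda>x. cone_multiplier f x * cnj (g x))"
    using lborel_pair.integrable_fst'[OF int] by (simp add: inner)
  have "(LINT x|lborel. cone_multiplier f x * cnj (g x)) = (LINT \<xi>|lborel. LINT x|lborel. cnj (g x) * F \<xi> * e (x \<bullet> \<xi>))"
    using lborel_pair.Fubini_integral[OF int] by (simp add: inner)
  also have "\<dots> = (LINT \<xi>|lborel. F \<xi> * cnj (fourier g \<xi>))"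
  proof (rule Bochner_Integration.integral_cong[OF refl])
    fix \<xi>
    have "cnj (fourier g \<xi>) = (LINT x|lborel. cnj (g x * exp (- 2 * pi * \<i> * complex_of_real (x \<bullet> \<xi>))))"
      unfolding fourier_def by (rule Bochner_Integration.integral_cnj[symmetric])
    also have "\<dots> = (LINT x|lborel. cnj (g x) * e (x \<bullet> \<xi>))"
      by (simp add: e_def exp_cnj)
    finally have g: "cnj (fourier g \<xi>) = (LINT x|lborel. cnj (g x) * e (x \<bullet> \<xi>))" .
    have "(LINT x|lborel. cnj (g x) * F \<xi> * e (x \<bullet> \<xi>)) = (LINT x|lborel. F \<xi> * (cnj (g x) * e (x \<bullet> \<xi>)))"
      by (rule Bochner_Integration.integral_cong[OF refl]) (simp only: mult_ac)
    then show "(LINT x|lborel. cnj (g x) * F \<xi> * e (x \<bullet> \<xi>)) = F \<xi> * cnj (fourier g \<xi>)"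
      unfolding g by (simp only: integral_mult_right_zero)
  qed
  finally show "(LINT x|lborel. cone_multiplier f x * cnj (g x))
    = (LINT \<xi>:forward_cone|lborel. fourier f \<xi> * cnj (fourier g \<xi>))"
    by (simp add: set_lebesgue_integral_def F_def)
qed

subsection \<open>Comparison of Lebesgue norms on sets of finite measure\<close>

lemma Lp_norm_le_iff:
  fixes f :: "'a::euclidean_space \<Rightarrow> complex"
  assumes p: "1 \<le> p" "p \<noteq> \<infinity>" and K: "0 \<le> K"
  shows "Lp_norm p B f \<le> ennreal K \<longleftrightarrow>
    (\<integral>\<^sup>+ x\<in>B. ennreal (norm (f x) powr enn2real p) \<partial>lborel) \<le> ennreal (K powr enn2real p)"
proof -
  define r where "r = enn2real p"
  have r: "r \<ge> 1" using p unfolding r_def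
    by (metis enn2real_1 enn2real_mono infinity_ennreal_def less_top)
  define I where "I = (\<integral>\<^sup>+ x\<in>B. ennreal (norm (f x) powr r) \<partial>lborel)"
  have "Lp_norm p B f = (if I = \<infinity> then \<infinity> else ennreal (enn2real I powr (1 / r)))"
    using p by (simp add: Lp_norm_def Let_def I_def r_def)
  moreover have "(if I = \<infinity> then \<infinity> else ennreal (enn2real I powr (1 / r))) \<le> ennreal K \<longleftrightarrow> I \<le> ennreal (K powr r)"
  proof (cases I)
    case (real i)
    have "i powr (1 / r) \<le> K \<longleftrightarrow> i \<le> K powr r"
    proof
      assume "i powr (1 / r) \<le> K"
      then have "(i powr (1 / r)) powr r \<le> K powr r" using r by (intro powr_mono2) auto
      then show "i \<le> K powr r" using r real by (simp add: powr_powr)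
    next
      assume "i \<le> K powr r"
      then have "i powr (1 / r) \<le> (K powr r) powr (1 / r)" using r real by (intro powr_mono2) auto
      then show "i powr (1 / r) \<le> K" using r K by (simp add: powr_powr)
    qed
    then show ?thesis using real K by simp
  qed (simp add: top_unique)
  ultimately show ?thesis by (simp add: I_def r_def)
qed

lemma Lp_norm_infinity_le_iff:
  fixes f :: "'a::euclidean_space \<Rightarrow> complex"
  assumes [measurable]: "B \<in> sets borel" "f \<in> borel_measurable borel" and K: "0 \<le> K"
  shows "Lp_norm \<infinity> B f \<le> ennreal K \<longleftrightarrow> (AE x in lborel. x \<in> B \<longrightarrow> norm (f x) \<le> K)"
proof -
  let ?M = "restrict_space lborel B"
  have m: "(\<lambda>x. ennreal (norm (f x))) \<in> borel_measurable ?M"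
    by (rule measurable_restrict_space1) measurable
  have "Lp_norm \<infinity> B f \<le> ennreal K \<longleftrightarrow> (AE x in ?M. ennreal (norm (f x)) \<le> ennreal K)"
  proof
    assume "Lp_norm \<infinity> B f \<le> ennreal K"
    then have "esssup ?M (\<lambda>x. ennreal (norm (f x))) \<le> ennreal K" by (simp add: Lp_norm_def)
    with esssup_AE[of "\<lambda>x. ennreal (norm (f x))" ?M]
    show "AE x in ?M. ennreal (norm (f x)) \<le> ennreal K"
      by (auto elim!: eventually_mono)
  next
    assume "AE x in ?M. ennreal (norm (f x)) \<le> ennreal K"
    then show "Lp_norm \<infinity> B f \<le> ennreal K"
      using esssup_I[OF m] by (simp add: Lp_norm_def)
  qed
  also have "\<dots> \<longleftrightarrow> (AE x in lborel. x \<in> B \<longrightarrow> norm (f x) \<le> K)"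
    using K by (subst AE_restrict_space_iff) auto
  finally show ?thesis .
qed

lemma Lp_norm_interpolation:
  fixes a b :: ennreal
  assumes a: "1 \<le> a" and ab: "a < b"
  obtains s where "s > 0"
    "\<And>t K E B (f :: 'a::euclidean_space \<Rightarrow> complex). \<lbrakk>t \<ge> 1; K > 0; E \<subseteq> B; E \<in> sets borel; B \<in> sets borel;
       f \<in> borel_measurable borel; Lp_norm b B f \<le> ennreal K\<rbrakk> \<Longrightarrow>
     (\<integral>\<^sup>+ x\<in>E. ennreal (norm (f x) powr enn2real a) \<partial>lborel) \<le>
       ennreal (K powr enn2real a) * (ennreal (t powr enn2real a) * emeasure lborel E + ennreal (t powr (- s)))"
proof -
  define \<alpha> where "\<alpha> = enn2real a"
  have \<alpha>: "\<alpha> \<ge> 1" using a ab unfolding \<alpha>_def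
    by (metis enn2real_1 enn2real_mono less_top order_less_le_trans top_greatest)
  show ?thesis
  proof (cases "b = \<infinity>")
    case True
    show ?thesis
    proof (rule that[of 1])
      fix t K E B and f :: "'a \<Rightarrow> complex"
      assume t: "(t::real) \<ge> 1" and K: "(K::real) > 0" and EB: "E \<subseteq> B"
        and [measurable]: "E \<in> sets borel" "B \<in> sets borel" "f \<in> borel_measurable borel"
        and le: "Lp_norm b B f \<le> ennreal K"
      have "AE x in lborel. x \<in> B \<longrightarrow> norm (f x) \<le> K"
        using le K Lp_norm_infinity_le_iff[of B f K] by (simp add: True)
      then have "(\<integral>\<^sup>+ x\<in>E. ennreal (norm (f x) powr \<alpha>) \<partial>lborel) \<le> (\<integral>\<^sup>+ x. ennreal (K powr \<alpha>) * indicator E x \<partial>lborel)"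
        using EB \<alpha> by (intro nn_integral_mono_AE) (auto elim!: eventually_mono simp: indicator_def intro!: ennreal_leI powr_mono2)
      also have "\<dots> = ennreal (K powr \<alpha>) * (1 * emeasure lborel E)"
        by (simp add: nn_integral_cmult_indicator)
      also have "\<dots> \<le> ennreal (K powr \<alpha>) * (ennreal (t powr \<alpha>) * emeasure lborel E + ennreal (t powr (- 1)))"
      proof (intro mult_left_mono)
        have "1 \<le> ennreal (t powr \<alpha>)"
          using t \<alpha> ge_one_powr_ge_zero[of t \<alpha>] ennreal_leI[of 1 "t powr \<alpha>"] by simp
        from mult_right_mono[OF this, of "emeasure lborel E"]
        show "1 * emeasure lborel E \<le> ennreal (t powr \<alpha>) * emeasure lborel E + ennreal (t powr (- 1))"
          by (rule order_trans) simp_all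
      qed simp
      finally show "(\<integral>\<^sup>+ x\<in>E. ennreal (norm (f x) powr enn2real a) \<partial>lborel) \<le>
       ennreal (K powr enn2real a) * (ennreal (t powr enn2real a) * emeasure lborel E + ennreal (t powr (- 1)))"
        by (simp add: \<alpha>_def)
    qed simp
  next
    case False
    define \<beta> where "\<beta> = enn2real b"
    have "ennreal \<alpha> < ennreal \<beta>"
      using ab False by (simp add: \<alpha>_def \<beta>_def less_top order_less_trans[OF ab])
    then have \<beta>: "\<beta> > \<alpha>" using \<alpha> by (simp add: ennreal_less_iff)
    have b1: "1 \<le> b" using a ab by simp
    show ?thesis
    proof (rule that[of "\<beta> - \<alpha>"])
      fix t K E B and f :: "'a \<Rightarrow> complex"
      assume t: "(t::real) \<ge> 1" and K: "(K::real) > 0" and EB: "E \<subseteq> B"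
        and [measurable]: "E \<in> sets borel" "B \<in> sets borel" "f \<in> borel_measurable borel"
        and le: "Lp_norm b B f \<le> ennreal K"
      have le': "(\<integral>\<^sup>+ x\<in>B. ennreal (norm (f x) powr \<beta>) \<partial>lborel) \<le> ennreal (K powr \<beta>)"
        using le K Lp_norm_le_iff[OF b1 False, of K B f] by (simp add: \<beta>_def)
      have tK: "t * K > 0" using t K by simp
      have pt: "norm (f x) powr \<alpha> \<le> (t * K) powr \<alpha> + (t * K) powr (\<alpha> - \<beta>) * norm (f x) powr \<beta>" for x
      proof (cases "norm (f x) \<le> t * K")
        case True
        then show ?thesis using \<alpha> by (intro add_increasing2 powr_mono2) auto
      next
        case False
        have "norm (f x) powr \<alpha> = norm (f x) powr (\<alpha> - \<beta>) * norm (f x) powr \<beta>"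
          using False tK by (simp add: powr_add[symmetric])
        also have "\<dots> \<le> (t * K) powr (\<alpha> - \<beta>) * norm (f x) powr \<beta>"
          using False tK \<beta> by (intro mult_right_mono powr_mono2') auto
        finally show ?thesis using powr_ge_zero[of "t * K" \<alpha>] by linarith
      qed
      have "(\<integral>\<^sup>+ x\<in>E. ennreal (norm (f x) powr \<alpha>) \<partial>lborel)
        \<le> (\<integral>\<^sup>+ x. ennreal ((t * K) powr \<alpha>) * indicator E x + ennreal ((t * K) powr (\<alpha> - \<beta>)) * (ennreal (norm (f x) powr \<beta>) * indicator B x) \<partial>lborel)"
      proof (rule nn_integral_mono)
        fix x
        show "ennreal (norm (f x) powr \<alpha>) * indicator E x \<le> ennreal ((t * K) powr \<alpha>) * indicator E x + ennreal ((t * K) powr (\<alpha> - \<beta>)) * (ennreal (norm (f x) powr \<beta>) * indicator B x)"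
          using ennreal_leI[OF pt[of x]] EB by (auto simp: indicator_def ennreal_mult)
      qed
      also have "\<dots> = ennreal ((t * K) powr \<alpha>) * emeasure lborel E + ennreal ((t * K) powr (\<alpha> - \<beta>)) * (\<integral>\<^sup>+ x\<in>B. ennreal (norm (f x) powr \<beta>) \<partial>lborel)"
        by (simp add: nn_integral_add nn_integral_cmult nn_integral_cmult_indicator)
      also have "\<dots> \<le> ennreal ((t * K) powr \<alpha>) * emeasure lborel E + ennreal ((t * K) powr (\<alpha> - \<beta>)) * ennreal (K powr \<beta>)"
        by (intro add_left_mono mult_left_mono le') auto
      also have "(t * K) powr \<alpha> = K powr \<alpha> * t powr \<alpha>" using t K by (simp add: powr_mult)
      also have "ennreal ((t * K) powr (\<alpha> - \<beta>)) * ennreal (K powr \<beta>) = ennreal (K powr \<alpha> * t powr (- (\<beta> - \<alpha>)))"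
        using t K by (simp add: ennreal_mult[symmetric] powr_mult powr_add[symmetric] mult.assoc)
      also have "ennreal (K powr \<alpha> * t powr \<alpha>) * emeasure lborel E + ennreal (K powr \<alpha> * t powr (- (\<beta> - \<alpha>)))
        = ennreal (K powr \<alpha>) * (ennreal (t powr \<alpha>) * emeasure lborel E + ennreal (t powr (- (\<beta> - \<alpha>))))"
        by (simp add: ennreal_mult distrib_left mult.assoc)
      finally show "(\<integral>\<^sup>+ x\<in>E. ennreal (norm (f x) powr enn2real a) \<partial>lborel) \<le>
       ennreal (K powr enn2real a) * (ennreal (t powr enn2real a) * emeasure lborel E + ennreal (t powr (- (\<beta> - \<alpha>))))"
        by (simp add: \<alpha>_def)
    qed (use \<beta> in simp)
  qed
qed

lemma Lp_norm_small_support: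
  fixes a b :: ennreal
  assumes a: "1 \<le> a" and ab: "a < b" and \<epsilon>: "\<epsilon> > 0"
  obtains \<delta> where "\<delta> > 0"
    "\<And>K E B (f :: 'a::euclidean_space \<Rightarrow> complex). \<lbrakk>K > 0; E \<subseteq> B; E \<in> sets borel; B \<in> sets borel;
       f \<in> borel_measurable borel; emeasure lborel E \<le> ennreal \<delta>; Lp_norm b B f \<le> ennreal K\<rbrakk> \<Longrightarrow>
     Lp_norm a E f \<le> ennreal (\<epsilon> * K)"
proof -
  obtain s where s: "s > 0"
    "\<And>t K E B (f :: 'a \<Rightarrow> complex). \<lbrakk>t \<ge> 1; K > 0; E \<subseteq> B; E \<in> sets borel; B \<in> sets borel;
       f \<in> borel_measurable borel; Lp_norm b B f \<le> ennreal K\<rbrakk> \<Longrightarrow>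
     (\<integral>\<^sup>+ x\<in>E. ennreal (norm (f x) powr enn2real a) \<partial>lborel) \<le>
       ennreal (K powr enn2real a) * (ennreal (t powr enn2real a) * emeasure lborel E + ennreal (t powr (- s)))"
    using Lp_norm_interpolation[OF a ab] by blast
  define \<alpha> where "\<alpha> = enn2real a"
  define h where "h = \<epsilon> powr \<alpha> / 2"
  have h: "h > 0" using \<epsilon> by (simp add: h_def)
  define t where "t = max 1 (h powr (- 1 / s))"
  have t: "t \<ge> 1" by (simp add: t_def)
  have "t powr (- s) \<le> (h powr (- 1 / s)) powr (- s)"
    using s(1) h by (intro powr_mono2') (auto simp: t_def)
  also have "\<dots> = h" using s(1) h by (simp add: powr_powr)
  finally have th: "t powr (- s) \<le> h" .
  have ainf: "a \<noteq> \<infinity>" using ab by auto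
  show ?thesis
  proof (rule that[of "h / t powr \<alpha>"])
    show "h / t powr \<alpha> > 0" using h t by simp
    fix K E B and f :: "'a \<Rightarrow> complex"
    assume *: "(K::real) > 0" "E \<subseteq> B" "E \<in> sets borel" "B \<in> sets borel"
       "f \<in> borel_measurable borel" "emeasure lborel E \<le> ennreal (h / t powr \<alpha>)" "Lp_norm b B f \<le> ennreal K"
    have "(\<integral>\<^sup>+ x\<in>E. ennreal (norm (f x) powr \<alpha>) \<partial>lborel) \<le>
       ennreal (K powr \<alpha>) * (ennreal (t powr \<alpha>) * emeasure lborel E + ennreal (t powr (- s)))"
      using s(2)[OF t *(1-5,7)] by (simp add: \<alpha>_def)
    also have "\<dots> \<le> ennreal (K powr \<alpha>) * (ennreal (t powr \<alpha>) * ennreal (h / t powr \<alpha>) + ennreal h)"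
      by (intro mult_left_mono add_mono *(6) ennreal_leI th) auto
    also have "\<dots> = ennreal ((\<epsilon> * K) powr \<alpha>)"
      using t h \<epsilon> *(1) by (simp add: ennreal_mult[symmetric] ennreal_plus[symmetric] powr_mult del: ennreal_plus) (simp add: h_def mult.commute)
    finally show "Lp_norm a E f \<le> ennreal (\<epsilon> * K)"
      using Lp_norm_le_iff[OF a ainf, of "\<epsilon> * K" E f] \<epsilon> *(1) by (simp add: \<alpha>_def)
  qed
qed

lemma Lp_norm_mono_exponent:
  fixes f :: "'a::euclidean_space \<Rightarrow> complex"
  assumes a: "1 \<le> a" and ab: "a \<le> b" and [measurable]: "B \<in> sets borel" "f \<in> borel_measurable borel"
    and V: "emeasure lborel B \<le> ennreal V" "V \<ge> 0" and K: "K > 0" and le: "Lp_norm b B f \<le> ennreal K"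
  shows "Lp_norm a B f \<le> ennreal ((1 + V) * K)"
proof (cases "a = b")
  case True
  have "K \<le> (1 + V) * K" using V K by simp
  then show ?thesis using le True by (meson ennreal_leI order_trans)
next
  case False
  then have ab: "a < b" using ab by simp
  then have ainf: "a \<noteq> \<infinity>" by auto
  define \<alpha> where "\<alpha> = enn2real a"
  have \<alpha>: "\<alpha> \<ge> 1" using a ab unfolding \<alpha>_def
    by (metis enn2real_1 enn2real_mono less_top order_less_le_trans top_greatest)
  obtain s where s: "s > 0" "(\<integral>\<^sup>+ x\<in>B. ennreal (norm (f x) powr enn2real a) \<partial>lborel) \<le>
       ennreal (K powr enn2real a) * (ennreal (1 powr enn2real a) * emeasure lborel B + ennreal (1 powr (- s)))"
    by (rule Lp_norm_interpolation[OF a ab, where 'a = 'a]) (use assms in blast)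
  have "(\<integral>\<^sup>+ x\<in>B. ennreal (norm (f x) powr \<alpha>) \<partial>lborel) \<le> ennreal (K powr \<alpha>) * (emeasure lborel B + 1)"
    using s(2) by (simp add: \<alpha>_def)
  also have "\<dots> \<le> ennreal (K powr \<alpha>) * (ennreal V + ennreal 1)"
    using V by (intro mult_left_mono add_mono) auto
  also have "\<dots> = ennreal (K powr \<alpha> * (1 + V))"
    using V by (subst ennreal_plus[symmetric]) (auto simp: ennreal_mult add.commute)
  also have "K powr \<alpha> * (1 + V) \<le> ((1 + V) * K) powr \<alpha>"
  proof -
    have "1 + V \<le> (1 + V) powr \<alpha>" using V \<alpha> powr_mono[of 1 \<alpha> "1 + V"] by simp
    then show ?thesis using V K by (simp add: powr_mult mult.commute mult_right_mono)
  qed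
  finally show ?thesis
    using Lp_norm_le_iff[OF a ainf, of "(1 + V) * K" B f] V K by (simp add: \<alpha>_def ennreal_leI)
qed

lemma Lp_norm_bounded:
  fixes f :: "'a::euclidean_space \<Rightarrow> complex"
  assumes "1 \<le> p" "B \<in> sets borel" "f \<in> borel_measurable borel"
    "emeasure lborel B \<le> ennreal V" "V \<ge> 0" "\<And>x. norm (f x) \<le> 1"
  shows "Lp_norm p B f \<le> ennreal (1 + V)"
proof -
  have "Lp_norm \<infinity> B f \<le> ennreal 1"
    using assms by (subst Lp_norm_infinity_le_iff) auto
  with Lp_norm_mono_exponent[of p \<infinity> B f V 1] assms show ?thesis by simp
qed

lemma Lp_norm_2_le_iff:
  fixes f :: "'a::euclidean_space \<Rightarrow> complex"
  assumes "0 \<le> K"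
  shows "Lp_norm 2 B f \<le> ennreal K \<longleftrightarrow> (\<integral>\<^sup>+ x\<in>B. ennreal ((norm (f x))\<^sup>2) \<partial>lborel) \<le> ennreal (K\<^sup>2)"
proof -
  have "enn2real 2 = 2" using enn2real_ennreal[of 2] by (simp flip: ennreal_numeral)
  then show ?thesis using Lp_norm_le_iff[of 2 K B f] assms by (simp add: powr_numeral)
qed

lemma Lp_norm_1_le_iff:
  fixes f :: "'a::euclidean_space \<Rightarrow> complex"
  assumes "0 \<le> K"
  shows "Lp_norm 1 B f \<le> ennreal K \<longleftrightarrow> (\<integral>\<^sup>+ x\<in>B. ennreal (norm (f x)) \<partial>lborel) \<le> ennreal K"
  using Lp_norm_le_iff[of 1 K B f] assms by simp

lemma ennreal_le_mult_if:
  fixes X N :: ennreal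
  assumes C: "C > 0" and le: "\<And>K. K > 0 \<Longrightarrow> N \<le> ennreal K \<Longrightarrow> X \<le> ennreal (C * K)"
  shows "X \<le> ennreal C * N"
proof (cases N)
  case (real n)
  have "X \<le> ennreal (C * n) + ennreal e" if e: "e > 0" for e
  proof -
    have n: "0 < n + e / C" using real e C by (intro add_nonneg_pos) auto
    have "N \<le> ennreal (n + e / C)"
      unfolding real(2) by (rule ennreal_leI) (use e C in simp)
    then have "X \<le> ennreal (C * (n + e / C))" by (rule le[OF n])
    also have "C * (n + e / C) = C * n + e" using C by (simp add: distrib_left)
    also have "ennreal (C * n + e) = ennreal (C * n) + ennreal e"
      using real(1) e C by (intro ennreal_plus) auto
    finally show ?thesis .
  qed
  then have "X \<le> ennreal (C * n)" by (rule ennreal_le_epsilon)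
  then show ?thesis unfolding real(2) using real(1) C by (subst ennreal_mult[symmetric]) auto
next
  case top
  have "ennreal C * top = top" using C by (simp add: ennreal_mult_eq_top_iff)
  then show ?thesis unfolding top by simp
qed

subsection \<open>Sheared products\<close>

lemma distr_lborel_eqI:
  fixes S :: "'a::euclidean_space \<Rightarrow> 'a"
  assumes S: "S \<in> borel_measurable borel"
    and eq: "\<And>A. A \<in> sets borel \<Longrightarrow> (\<integral>\<^sup>+z. indicator A (S z) \<partial>lborel) = emeasure lborel A"
  shows "distr lborel borel S = lborel"
proof (rule measure_eqI)
  fix A assume "A \<in> sets (distr lborel borel S)"
  then have A: "A \<in> sets borel" by simp
  have "S \<in> measurable lborel borel" using S by simp
  then show "emeasure (distr lborel borel S) A = emeasure lborel A"
  proof -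
    have "emeasure (distr lborel borel S) A = (\<integral>\<^sup>+z. indicator A z \<partial>distr lborel borel S)" using A by simp
    also have "\<dots> = (\<integral>\<^sup>+z. indicator A (S z) \<partial>lborel)"
      by (rule nn_integral_distr[OF \<open>S \<in> measurable lborel borel\<close>]) (use A in simp)
    finally show ?thesis using eq[OF A] by simp
  qed
qed simp

lemma distr_shear_snd:
  fixes \<omega> :: "'a::euclidean_space"
  shows "distr lborel borel (\<lambda>z. (fst z, snd z + fst z *\<^sub>R \<omega>)) = (lborel :: (real \<times> 'a) measure)"
proof (rule distr_lborel_eqI)
  show "(\<lambda>z. (fst z :: real, snd z + fst z *\<^sub>R \<omega>)) \<in> borel_measurable borel"
    by (intro borel_measurable_continuous_onI continuous_intros)
  fix A :: "(real \<times> 'a) set" assume "A \<in> sets borel"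
  then have [measurable]: "A \<in> sets (lborel \<Otimes>\<^sub>M lborel)" unfolding lborel_prod sets_lborel .
  have "(\<lambda>z. indicator A (fst z, snd z + fst z *\<^sub>R \<omega>) :: ennreal) \<in> borel_measurable (lborel \<Otimes>\<^sub>M lborel)"
    by measurable
  from lborel.nn_integral_fst[OF this]
  have "(\<integral>\<^sup>+z. indicator A (fst z, snd z + fst z *\<^sub>R \<omega>) \<partial>lborel) = (\<integral>\<^sup>+t. \<integral>\<^sup>+y. indicator A (t, y + t *\<^sub>R \<omega>) \<partial>lborel \<partial>lborel)"
    by (simp add: lborel_prod)
  also have "\<dots> = (\<integral>\<^sup>+t. \<integral>\<^sup>+y. indicator A (t, y) \<partial>lborel \<partial>lborel)"
  proof (rule nn_integral_cong)
    fix t :: real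
    show "(\<integral>\<^sup>+y. indicator A (t, y + t *\<^sub>R \<omega>) \<partial>lborel) = (\<integral>\<^sup>+y. indicator A (t, y) \<partial>lborel)"
      using nn_integral_lborel_translate[of "\<lambda>y. indicator A (t, y)" "t *\<^sub>R \<omega>"] by (simp add: add.commute)
  qed
  also have "\<dots> = emeasure lborel A"
    using \<open>A \<in> sets borel\<close> by (subst lborel.nn_integral_fst) (auto simp: lborel_prod)
  finally show "(\<integral>\<^sup>+z. indicator A (fst z, snd z + fst z *\<^sub>R \<omega>) \<partial>lborel) = emeasure lborel A" .
qed

lemma distr_shear_fst:
  fixes \<omega> :: "'a::euclidean_space"
  shows "distr lborel borel (\<lambda>z. (fst z - \<omega> \<bullet> snd z, snd z)) = (lborel :: (real \<times> 'a) measure)"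
proof (rule distr_lborel_eqI)
  show "(\<lambda>z. (fst z - \<omega> \<bullet> snd z, snd z)) \<in> borel_measurable borel"
    by (intro borel_measurable_continuous_onI continuous_intros)
  fix A :: "(real \<times> 'a) set" assume "A \<in> sets borel"
  then have [measurable]: "A \<in> sets (lborel \<Otimes>\<^sub>M lborel)" unfolding lborel_prod sets_lborel .
  have m: "(\<lambda>(s, \<eta>). indicator A (s - \<omega> \<bullet> \<eta>, \<eta>) :: ennreal) \<in> borel_measurable (lborel \<Otimes>\<^sub>M lborel)"
    "(\<lambda>(s, \<eta>). indicator A (s, \<eta>) :: ennreal) \<in> borel_measurable (lborel \<Otimes>\<^sub>M lborel)"
    by measurable
  have "(\<integral>\<^sup>+z. indicator A (fst z - \<omega> \<bullet> snd z, snd z) \<partial>lborel) = (\<integral>\<^sup>+\<eta>. \<integral>\<^sup>+s. indicator A (s - \<omega> \<bullet> \<eta>, \<eta>) \<partial>lborel \<partial>lborel)"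
    using lborel_pair.nn_integral_snd[OF m(1)] by (simp add: lborel_prod case_prod_beta')
  also have "\<dots> = (\<integral>\<^sup>+\<eta>. \<integral>\<^sup>+s. indicator A (s, \<eta>) \<partial>lborel \<partial>lborel)"
  proof (rule nn_integral_cong)
    fix \<eta> :: 'a
    show "(\<integral>\<^sup>+s. indicator A (s - \<omega> \<bullet> \<eta>, \<eta>) \<partial>lborel) = (\<integral>\<^sup>+s. indicator A (s, \<eta>) \<partial>lborel)"
      using nn_integral_lborel_translate[of "\<lambda>s. indicator A (s, \<eta>)" "- (\<omega> \<bullet> \<eta>)"] by simp
  qed
  also have "\<dots> = emeasure lborel A"
    using lborel_pair.nn_integral_snd[OF m(2)] \<open>A \<in> sets borel\<close> by (simp add: lborel_prod)
  finally show "(\<integral>\<^sup>+z. indicator A (fst z - \<omega> \<bullet> snd z, snd z) \<partial>lborel) = emeasure lborel A" .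
qed

lemma
  fixes f :: "real \<times> 'a::euclidean_space \<Rightarrow> 'b::{banach, second_countable_topology}"
  assumes [measurable]: "f \<in> borel_measurable borel"
  shows integral_shear_snd: "(LINT z|lborel. f (fst z, snd z + fst z *\<^sub>R \<omega>)) = (LINT z|lborel. f z)"
    and integral_shear_fst: "(LINT z|lborel. f (fst z - \<omega> \<bullet> snd z, snd z)) = (LINT z|lborel. f z)"
proof -
  have [measurable]: "(\<lambda>z. (fst z, snd z + fst z *\<^sub>R \<omega>)) \<in> borel_measurable borel"
    "(\<lambda>z. (fst z - \<omega> \<bullet> snd z, snd z)) \<in> borel_measurable borel"
    by (intro borel_measurable_continuous_onI continuous_intros)+
  show "(LINT z|lborel. f (fst z, snd z + fst z *\<^sub>R \<omega>)) = (LINT z|lborel. f z)"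
    by (subst (2) distr_shear_snd[of \<omega>, symmetric], subst integral_distr) auto
  show "(LINT z|lborel. f (fst z - \<omega> \<bullet> snd z, snd z)) = (LINT z|lborel. f z)"
    by (subst (2) distr_shear_fst[of \<omega>, symmetric], subst integral_distr) auto
qed

lemma fourier_sheared_product:
  fixes a :: "real \<Rightarrow> complex" and b :: "'a::euclidean_space \<Rightarrow> complex"
  assumes a: "integrable lborel a" and b: "integrable lborel b"
  shows "fourier (\<lambda>z. a (fst z) * b (snd z + fst z *\<^sub>R \<omega>)) (s, \<eta>) = fourier a (s - \<omega> \<bullet> \<eta>) * fourier b \<eta>"
proof -
  have [measurable]: "a \<in> borel_measurable borel" "b \<in> borel_measurable borel" using a b by auto
  note e = wave_add norm_wave
  define A where "A = (\<lambda>t. a t * wave (t * (s - \<omega> \<bullet> \<eta>)))"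
  define B where "B = (\<lambda>y. b y * wave (y \<bullet> \<eta>))"
  have A: "integrable lborel A" unfolding A_def by (rule integrable_mult_unimodular[OF a]) (auto simp: e)
  have B: "integrable lborel B" unfolding B_def by (rule integrable_mult_unimodular[OF b]) (auto simp: e)
  define h where "h = (\<lambda>(t, y). A t * B y)"
  have h: "integrable lborel h" unfolding h_def by (rule integrable_tensor(1)[OF A B])
  have eq: "a t * b (y + t *\<^sub>R \<omega>) * wave ((t, y) \<bullet> (s, \<eta>)) = h (t, y + t *\<^sub>R \<omega>)" for t y
  proof -
    have "(t, y) \<bullet> (s, \<eta>) = t * (s - \<omega> \<bullet> \<eta>) + (y + t *\<^sub>R \<omega>) \<bullet> \<eta>"
      by (simp add: inner_add_left algebra_simps)
    then show ?thesis by (simp add: h_def A_def B_def e)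
  qed
  have "fourier (\<lambda>z. a (fst z) * b (snd z + fst z *\<^sub>R \<omega>)) (s, \<eta>)
      = (LINT z|lborel. a (fst z) * b (snd z + fst z *\<^sub>R \<omega>) * wave (z \<bullet> (s, \<eta>)))"
    by (simp only: fourier_wave)
  also have "\<dots> = (LINT z|lborel. h (fst z, snd z + fst z *\<^sub>R \<omega>))"
  proof (rule Bochner_Integration.integral_cong[OF refl])
    fix z :: "real \<times> 'a"
    show "a (fst z) * b (snd z + fst z *\<^sub>R \<omega>) * wave (z \<bullet> (s, \<eta>)) = h (fst z, snd z + fst z *\<^sub>R \<omega>)"
      using eq[of "fst z" "snd z"] by (simp only: prod.collapse)
  qed
  also have "\<dots> = (LINT z|lborel. h z)"
    using h by (intro integral_shear_snd) auto
  also have "\<dots> = fourier a (s - \<omega> \<bullet> \<eta>) * fourier b \<eta>"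
    unfolding h_def integrable_tensor(2)[OF A B] by (simp add: A_def B_def fourier_wave)
  finally show ?thesis .
qed

lemma halfspace_form_sheared_product:
  fixes a a' :: "real \<Rightarrow> complex" and b :: "'a::euclidean_space \<Rightarrow> complex" and \<omega> :: 'a
  assumes a: "a \<in> test_fns U" and a': "a' \<in> test_fns U"
    and b: "b \<in> test_fns V"
  defines "\<phi> \<equiv> \<lambda>z. a (fst z) * b (snd z + fst z *\<^sub>R \<omega>)"
    and "\<psi> \<equiv> \<lambda>z. a' (fst z) * b (snd z + fst z *\<^sub>R \<omega>)"
  shows "(LINT z:{z. \<omega> \<bullet> snd z < fst z}|lborel. fourier \<phi> z * cnj (fourier \<psi> z))
    = (LINT s:{0<..}|lborel. fourier a s * cnj (fourier a' s)) * complex_of_real (LINT \<eta>|lborel. (norm (fourier b \<eta>))\<^sup>2)"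
proof -
  let ?A = "\<lambda>s. indicator {0<..} s *\<^sub>R (fourier a s * cnj (fourier a' s))"
  let ?B = "\<lambda>\<eta>. complex_of_real ((norm (fourier b \<eta>))\<^sup>2)"
  have A: "integrable lborel ?A" by (intro integrable_mult_indicator fourier_product_integrable[OF a a']) simp
  have B: "integrable lborel ?B" unfolding complex_norm_square by (rule fourier_product_integrable[OF b b])
  define h where "h = (\<lambda>(s, \<eta>). ?A s * ?B \<eta>)"
  have h: "integrable lborel h" unfolding h_def by (rule integrable_tensor(1)[OF A B])
  have "(LINT z:{z. \<omega> \<bullet> snd z < fst z}|lborel. fourier \<phi> z * cnj (fourier \<psi> z)) = (LINT z|lborel. h (fst z - \<omega> \<bullet> snd z, snd z))"
    unfolding set_lebesgue_integral_def
  proof (rule Bochner_Integration.integral_cong[OF refl])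
    fix z :: "real \<times> 'a"
    obtain s \<eta> where z: "z = (s, \<eta>)" by (cases z)
    note F = fourier_sheared_product[OF test_fn_integrable test_fn_integrable, OF _ b, of _ _ \<omega> s \<eta>]
    show "indicator {z. \<omega> \<bullet> snd z < fst z} z *\<^sub>R (fourier \<phi> z * cnj (fourier \<psi> z)) = h (fst z - \<omega> \<bullet> snd z, snd z)"
      unfolding z \<phi>_def \<psi>_def F[OF a] F[OF a'] h_def
      by (simp add: indicator_def complex_norm_square[symmetric])
  qed
  also have "\<dots> = (LINT z|lborel. h z)"
    using h by (intro integral_shear_fst) auto
  also have "\<dots> = (LINT s:{0<..}|lborel. fourier a s * cnj (fourier a' s)) * complex_of_real (LINT \<eta>|lborel. (norm (fourier b \<eta>))\<^sup>2)"
    unfolding h_def integrable_tensor(2)[OF A B] set_lebesgue_integral_def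
    by (simp only: integral_complex_of_real)
  finally show ?thesis .
qed

subsection \<open>Anisotropic dilations\<close>

definition dil :: "('a \<Rightarrow> real) \<Rightarrow> 'a \<Rightarrow> 'a::euclidean_space" where
  "dil c y = (\<Sum>j\<in>Basis. (c j * (y \<bullet> j)) *\<^sub>R j)"

lemma dil_inner: "j \<in> Basis \<Longrightarrow> dil c y \<bullet> j = c j * (y \<bullet> j)"
  by (simp add: dil_def)

lemma dil_adjoint: "dil c x \<bullet> y = x \<bullet> dil c y"
  by (simp add: euclidean_inner[of "dil c x" y] euclidean_inner[of x "dil c y"] dil_inner mult_ac)

lemma bounded_linear_dil: "bounded_linear (dil c)"
proof -
  have "linear (dil c)"
    by (rule linearI; rule euclidean_eqI) (simp_all add: dil_inner inner_add_left algebra_simps)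
  then show ?thesis by (simp add: linear_conv_bounded_linear)
qed

lemma dil_inverse:
  assumes "\<And>j. j \<in> Basis \<Longrightarrow> c j \<noteq> 0"
  shows "dil (\<lambda>j. 1 / c j) (dil c x) = x"
  by (rule euclidean_eqI) (simp add: dil_inner assms)

lemma
  fixes b :: "'a::euclidean_space \<Rightarrow> complex" and t :: 'a
  assumes b: "integrable lborel b" and c: "\<And>j. j \<in> Basis \<Longrightarrow> c j > 0"
  defines "d \<equiv> \<lambda>y. b (dil (\<lambda>j. 1 / c j) (y - t))" and "D \<equiv> \<Prod>j\<in>Basis. c j"
  shows L2_dil: "(LINT y|lborel. (norm (d y))\<^sup>2) = D * (LINT y|lborel. (norm (b y))\<^sup>2)"
    and fourier_L2_dil: "(LINT y|lborel. (norm (fourier d y))\<^sup>2) = D * (LINT y|lborel. (norm (fourier b y))\<^sup>2)"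
proof -
  have [measurable]: "b \<in> borel_measurable borel" using b by auto
  have [measurable]: "dil c \<in> borel_measurable borel" "dil (\<lambda>j. 1 / c j) \<in> borel_measurable borel"
    by (intro borel_measurable_continuous_onI linear_continuous_on bounded_linear_dil)+
  have [measurable]: "d \<in> borel_measurable borel" unfolding d_def by measurable
  have c0: "c j \<noteq> 0" if "j \<in> Basis" for j using c[OF that] by simp
  have D: "(\<Prod>j\<in>(Basis::'a set). \<bar>c j\<bar>) = D" "D > 0"
    by (auto simp: D_def c abs_of_pos intro!: prod.cong prod_pos)
  have aff: "(LINT x|lborel. f x) = D *\<^sub>R (LINT x|lborel. f (u + dil c x))"
    if "f \<in> borel_measurable borel" for f :: "'a \<Rightarrow> 'b::{banach, second_countable_topology}" and u
    using lborel_integral_affine(1)[OF c0 refl that, where t = u] D(1) by (simp add: dil_def)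
  have dT: "d (t + dil c x) = b x" for x by (simp add: d_def dil_inverse[OF c0])
  show "(LINT y|lborel. (norm (d y))\<^sup>2) = D * (LINT y|lborel. (norm (b y))\<^sup>2)"
    by (subst aff[of _ t]) (simp_all add: dT)
  note e = wave_add norm_wave
  have "fourier d \<eta> = D *\<^sub>R (wave (t \<bullet> \<eta>) * fourier b (dil c \<eta>))" for \<eta>
  proof -
    have "fourier d \<eta> = (LINT y|lborel. d y * wave (y \<bullet> \<eta>))"
      by (simp only: fourier_wave)
    also have "\<dots> = D *\<^sub>R (LINT y|lborel. d (t + dil c y) * wave ((t + dil c y) \<bullet> \<eta>))"
      by (rule aff) measurable
    also have "(LINT y|lborel. d (t + dil c y) * wave ((t + dil c y) \<bullet> \<eta>)) = (LINT y|lborel. wave (t \<bullet> \<eta>) * (b y * wave (y \<bullet> dil c \<eta>)))"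
      by (rule Bochner_Integration.integral_cong[OF refl]) (simp add: dT e inner_add_left dil_adjoint)
    also have "\<dots> = wave (t \<bullet> \<eta>) * fourier b (dil c \<eta>)"
      by (simp only: integral_mult_right_zero fourier_wave)
    finally show ?thesis .
  qed
  then have nf: "(norm (fourier d \<eta>))\<^sup>2 = D\<^sup>2 * (norm (fourier b (0 + dil c \<eta>)))\<^sup>2" for \<eta>
    using D(2) by (simp add: norm_mult e power_mult_distrib)
  have [measurable]: "fourier b \<in> borel_measurable borel" by measurable
  have "(LINT y|lborel. (norm (fourier b y))\<^sup>2) = D * (LINT y|lborel. (norm (fourier b (0 + dil c y)))\<^sup>2)"
    by (subst aff[of _ 0]) simp_all
  then show "(LINT y|lborel. (norm (fourier d y))\<^sup>2) = D * (LINT y|lborel. (norm (fourier b y))\<^sup>2)"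
    unfolding nf by (simp add: power2_eq_square)
qed

subsection \<open>The half-line multiplier on separated bumps\<close>

lemma integral_exp_halfline:
  assumes \<epsilon>: "\<epsilon> > 0"
  shows "integrable lborel (\<lambda>s::real. indicator {0<..} s *\<^sub>R complex_of_real (exp (- 2 * pi * \<epsilon> * s)))"
    and "(LINT s|lborel. (indicator {0<..} s *\<^sub>R complex_of_real (exp (- 2 * pi * \<epsilon> * s))) * exp (- 2 * pi * \<i> * complex_of_real (u * s)))
      = 1 / (2 * pi * (\<epsilon> + \<i> * u))"
proof -
  have "set_integrable lborel {0 <..} (\<lambda>x. exp (-(x * (2 * pi * \<epsilon>))))"
    by (rule integrable_I0i_exp_mscale) (use \<epsilon> in simp)
  then have "integrable lborel (\<lambda>s. complex_of_real (indicator {0<..} s *\<^sub>R exp (-(s * (2 * pi * \<epsilon>)))))"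
    unfolding set_integrable_def by (rule integrable_of_real)
  then show int: "integrable lborel (\<lambda>s::real. indicator {0<..} s *\<^sub>R complex_of_real (exp (- 2 * pi * \<epsilon> * s)))"
    by (simp add: mult_ac scaleR_conv_of_real)
  define z where "z = 2 * pi * (\<epsilon> + \<i> * u)"
  have z0: "z \<noteq> 0" using \<epsilon> by (auto simp: z_def complex_eq_iff)
  have Re: "Re z = 2 * pi * \<epsilon>" by (simp add: z_def)
  have ez: "complex_of_real (exp (- 2 * pi * \<epsilon> * s)) * exp (- 2 * pi * \<i> * complex_of_real (u * s)) = exp (- z * complex_of_real s)" for s
    by (simp add: exp_of_real[symmetric] exp_add[symmetric] z_def algebra_simps)
  have int2: "set_integrable lborel (einterval 0 \<infinity>) (\<lambda>s. exp (- z * complex_of_real s))"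
  proof -
    have "integrable lborel (\<lambda>s. (indicator {0<..} s *\<^sub>R complex_of_real (exp (- 2 * pi * \<epsilon> * s))) * exp (- 2 * pi * \<i> * complex_of_real (u * s)))"
      by (rule integrable_mult_unimodular[OF int]) auto
    then show ?thesis
      by (simp only: set_integrable_def zero_ereal_def einterval_eq_Ici mult_scaleR_left ez)
  qed
  have "(LBINT s=0..\<infinity>. exp (- z * complex_of_real s)) = 0 - (- exp (- z * complex_of_real 0) / z)"
  proof (rule interval_integral_FTC_integrable[where F = "\<lambda>s. - exp (- z * complex_of_real s) / z"])
    show "((\<lambda>s. - exp (- z * complex_of_real s) / z) has_vector_derivative exp (- z * complex_of_real s)) (at s)" for s
    proof -
      have "((\<lambda>w. - exp (- z * w) / z) has_field_derivative exp (- z * complex_of_real s)) (at (complex_of_real s))"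
        using z0 by (auto intro!: derivative_eq_intros)
      from field_vector_diff_chain_at[OF has_vector_derivative_of_real[OF DERIV_ident] this]
      show ?thesis by (simp add: o_def)
    qed
    show "isCont (\<lambda>s. exp (- z * complex_of_real s)) s" for s by (intro continuous_intros)
    show "(((\<lambda>s. - exp (- z * complex_of_real s) / z) \<circ> real_of_ereal) \<longlongrightarrow> - exp (- z * complex_of_real 0) / z) (at_right 0)"
      unfolding zero_ereal_def ereal_tendsto_simps
      by (intro tendsto_intros z0)
    have "filterlim (\<lambda>s. - (2 * pi * \<epsilon> * s)) at_bot at_top"
      using \<epsilon> by (auto simp: filterlim_uminus_at_bot intro!: filterlim_tendsto_pos_mult_at_top filterlim_ident)
    then have "((\<lambda>s. exp (- (2 * pi * \<epsilon> * s)) / norm z) \<longlongrightarrow> 0 / norm z) at_top"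
      by (intro tendsto_divide exp_at_bot[THEN filterlim_compose] tendsto_const) (use z0 in auto)
    then have lim: "((\<lambda>s. exp (- (2 * pi * \<epsilon> * s)) / norm z) \<longlongrightarrow> 0) at_top" by simp
    show "(((\<lambda>s. - exp (- z * complex_of_real s) / z) \<circ> real_of_ereal) \<longlongrightarrow> 0) (at_left \<infinity>)"
      unfolding ereal_tendsto_simps
      by (rule Lim_null_comparison[OF _ lim]) (auto simp: norm_divide Re)
  qed (use int2 in auto)
  then have "(LBINT s=0..\<infinity>. exp (- z * complex_of_real s)) = 1 / z" by simp
  then show "(LINT s|lborel. (indicator {0<..} s *\<^sub>R complex_of_real (exp (- 2 * pi * \<epsilon> * s))) * exp (- 2 * pi * \<i> * complex_of_real (u * s)))
      = 1 / (2 * pi * (\<epsilon> + \<i> * u))"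
    unfolding interval_lebesgue_integral_0_infty set_lebesgue_integral_def z_def[symmetric]
    by (simp only: mult_scaleR_left ez)
qed

lemma halfline_form_Im_le:
  fixes a b :: "real \<Rightarrow> real"
  assumes a: "integrable lborel a" and b: "integrable lborel b"
    and a0: "\<And>x. a x \<ge> 0" and b0: "\<And>x. b x \<ge> 0" and \<rho>: "\<rho> > 0"
    and supp: "\<And>x y. a x \<noteq> 0 \<Longrightarrow> b y \<noteq> 0 \<Longrightarrow> \<rho> \<le> x - y \<and> x - y \<le> 3 * \<rho>"
    and F: "integrable lborel (\<lambda>s. fourier (\<lambda>x. complex_of_real (a x)) s * cnj (fourier (\<lambda>x. complex_of_real (b x)) s))"
  shows "Im (LINT s:{0<..}|lborel. fourier (\<lambda>x. complex_of_real (a x)) s * cnj (fourier (\<lambda>x. complex_of_real (b x)) s))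
    \<le> - ((LINT x|lborel. a x) * (LINT x|lborel. b x) / (20 * pi * \<rho>))"
proof -
  let ?F = "\<lambda>s. fourier (\<lambda>x. complex_of_real (a x)) s * cnj (fourier (\<lambda>x. complex_of_real (b x)) s)"
  let ?M = "(LINT x|lborel. a x) * (LINT x|lborel. b x) / (20 * pi * \<rho>)"
  define k where "k = (\<lambda>\<epsilon> s::real. indicator {0<..} s *\<^sub>R complex_of_real (exp (- 2 * pi * \<epsilon> * s)))"
  define I where "I = (\<lambda>\<epsilon>. LINT s|lborel. k \<epsilon> s * ?F s)"
  have ai: "integrable lborel (\<lambda>x. complex_of_real (a x))" and bi: "integrable lborel (\<lambda>x. complex_of_real (b x))"
    using a b by auto
  have I_le: "Im (I \<epsilon>) \<le> - ?M" if \<epsilon>: "0 < \<epsilon>" "\<epsilon> \<le> \<rho>" for \<epsilon>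
  proof -
    have ki: "integrable lborel (k \<epsilon>)" unfolding k_def by (rule integral_exp_halfline(1)[OF \<epsilon>(1)])
    have kf: "fourier (k \<epsilon>) u = 1 / (2 * pi * (\<epsilon> + \<i> * u))" for u
      unfolding fourier_def k_def using integral_exp_halfline(2)[OF \<epsilon>(1), of u] by (simp add: mult.commute)
    note form = fourier_weighted_form[OF ai bi ki]
    let ?G = "\<lambda>z. complex_of_real (a (fst z)) * cnj (complex_of_real (b (snd z))) * fourier (k \<epsilon>) (fst z - snd z)"
    have ab: "integrable lborel (\<lambda>z. a (fst z) * b (snd z))"
      "(LINT z|lborel. a (fst z) * b (snd z)) = (LINT x|lborel. a x) * (LINT x|lborel. b x)"
      using integrable_tensor[OF a b] by (simp_all add: case_prod_beta')
    have "Im (?G z) \<le> - (1 / (20 * pi * \<rho>)) * (a (fst z) * b (snd z))" for z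
    proof (cases "a (fst z) = 0 \<or> b (snd z) = 0")
      case False
      define u where "u = fst z - snd z"
      have u: "\<rho> \<le> u" "u \<le> 3 * \<rho>" using supp False by (auto simp: u_def)
      have "Im (1 / (2 * pi * (\<epsilon> + \<i> * u))) = - (u / (2 * pi * (\<epsilon>\<^sup>2 + u\<^sup>2)))"
      proof -
        have "1 / (2 * pi * (\<epsilon> + \<i> * u)) = complex_of_real (1 / (2 * pi)) * inverse (Complex \<epsilon> u)"
          by (simp add: Complex_eq divide_simps)
        also have "Im \<dots> = 1 / (2 * pi) * Im (inverse (Complex \<epsilon> u))" by (simp only: Im_complex_of_real Re_complex_of_real times_complex.simps)
        also have "\<dots> = - (u / (2 * pi * (\<epsilon>\<^sup>2 + u\<^sup>2)))" by simp
        finally show ?thesis .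
      qed
      moreover have "1 / (20 * pi * \<rho>) \<le> u / (2 * pi * (\<epsilon>\<^sup>2 + u\<^sup>2))"
      proof -
        have "\<epsilon>\<^sup>2 + u\<^sup>2 \<le> \<rho>\<^sup>2 + (3 * \<rho>)\<^sup>2"
          using \<epsilon> u \<rho> by (intro add_mono power_mono) auto
        also have "\<dots> = 10 * \<rho> * \<rho>" by (simp add: power2_eq_square)
        also have "\<dots> \<le> 10 * \<rho> * u" using u \<rho> by (intro mult_left_mono) auto
        finally have S: "\<epsilon>\<^sup>2 + u\<^sup>2 \<le> 10 * \<rho> * u" .
        define S where "S = \<epsilon>\<^sup>2 + u\<^sup>2"
        have "S > 0" using \<epsilon> unfolding S_def by (intro add_pos_nonneg) auto
        moreover have "S \<le> 10 * \<rho> * u" using S by (simp add: S_def)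
        ultimately have "1 / (20 * pi * \<rho>) \<le> u / (2 * pi * S)" using \<rho> by (simp add: field_simps)
        then show ?thesis by (simp add: S_def)
      qed
      ultimately have "Im (fourier (k \<epsilon>) u) \<le> - (1 / (20 * pi * \<rho>))" unfolding kf by linarith
      then have "(a (fst z) * b (snd z)) * Im (fourier (k \<epsilon>) u) \<le> (a (fst z) * b (snd z)) * - (1 / (20 * pi * \<rho>))"
        using a0 b0 by (intro mult_left_mono) auto
      then show ?thesis by (simp add: u_def)
    qed auto
    then have "(LINT z|lborel. Im (?G z)) \<le> (LINT z|lborel. - (1 / (20 * pi * \<rho>)) * (a (fst z) * b (snd z)))"
      by (intro integral_mono integrable_Im form(2) integrable_mult_right ab(1))
    also have "\<dots> = - ?M" by (simp only: integral_mult_right_zero ab(2)) simp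
    also have "(LINT z|lborel. Im (?G z)) = Im (I \<epsilon>)"
      unfolding I_def form(3) by (rule integral_Im[OF form(2)])
    finally show ?thesis .
  qed
  define \<epsilon> where "\<epsilon> = (\<lambda>n. \<rho> / real (Suc n))"
  have \<epsilon>: "0 < \<epsilon> n" "\<epsilon> n \<le> \<rho>" for n using \<rho> by (auto simp: \<epsilon>_def field_simps)
  have "(\<lambda>n. \<rho> * (1 / real (Suc n))) \<longlonglongrightarrow> \<rho> * 0"
    by (intro tendsto_mult_left LIMSEQ_Suc[OF lim_1_over_n])
  then have \<epsilon>0: "\<epsilon> \<longlonglongrightarrow> 0" by (simp add: \<epsilon>_def)
  have "(\<lambda>n. I (\<epsilon> n)) \<longlonglongrightarrow> (LINT s|lborel. indicator {0<..} s *\<^sub>R ?F s)"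
    unfolding I_def
  proof (rule integral_dominated_convergence[where w = "\<lambda>s. norm (?F s)"])
    show "(\<lambda>s. indicator {0<..} s *\<^sub>R ?F s) \<in> borel_measurable lborel"
      by (rule borel_measurable_scaleR[OF _ borel_measurable_integrable[OF F]]) simp
    show "(\<lambda>s. k (\<epsilon> n) s * ?F s) \<in> borel_measurable lborel" for n
      by (rule borel_measurable_times[OF _ borel_measurable_integrable[OF F]]) (simp add: k_def)
    show "AE s in lborel. (\<lambda>n. k (\<epsilon> n) s * ?F s) \<longlonglongrightarrow> indicator {0<..} s *\<^sub>R ?F s"
    proof (rule AE_I2)
      fix s :: real
      have "(\<lambda>n. (indicator {0<..} s *\<^sub>R complex_of_real (exp (- 2 * pi * \<epsilon> n * s))) * ?F s) \<longlonglongrightarrow> (indicator {0<..} s *\<^sub>R complex_of_real (exp (- 2 * pi * 0 * s))) * ?F s"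
        by (intro tendsto_intros \<epsilon>0)
      then show "(\<lambda>n. k (\<epsilon> n) s * ?F s) \<longlonglongrightarrow> indicator {0<..} s *\<^sub>R ?F s"
        by (simp add: k_def)
    qed
    show "AE s in lborel. norm (k (\<epsilon> n) s * ?F s) \<le> norm (?F s)" for n
      using \<epsilon>(1)[of n] by (intro AE_I2) (auto simp: k_def norm_mult indicator_def intro!: mult_left_le_one_le)
  qed (use F in auto)
  then have "(\<lambda>n. Im (I (\<epsilon> n))) \<longlonglongrightarrow> Im (LINT s|lborel. indicator {0<..} s *\<^sub>R ?F s)"
    by (rule tendsto_Im)
  then have "Im (LINT s|lborel. indicator {0<..} s *\<^sub>R ?F s) \<le> - ?M"
    by (rule LIMSEQ_le_const2) (use I_le[OF \<epsilon>] in auto)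
  then show ?thesis by (simp only: set_lebesgue_integral_def)
qed

subsection \<open>Blowing up the cone at a boundary point\<close>

lemma AE_not_hyperplane:
  fixes a :: "'a::euclidean_space"
  assumes "a \<noteq> 0"
  shows "AE x in lborel. a \<bullet> x \<noteq> 0"
proof -
  have "negligible {x. a \<bullet> x = 0}" by (rule negligible_hyperplane) (use assms in simp)
  then have "{x. a \<bullet> x = 0} \<in> null_sets lebesgue" by (simp add: negligible_iff_null_sets)
  moreover have "{x. a \<bullet> x = 0} \<in> sets lborel"
    using closed_hyperplane[of a 0] by simp
  ultimately have "{x. a \<bullet> x = 0} \<in> null_sets lborel"
    by (auto simp: null_sets_def)
  then show ?thesis by (rule AE_I') auto
qed

lemma cone_blowup_limit:
  fixes F :: "real \<times> (real ^ 'n) \<Rightarrow> complex"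
  assumes F: "integrable lborel F" and \<omega>: "norm \<omega> = 1"
  shows "(\<lambda>k. LINT \<xi>:forward_cone|lborel. F (\<xi> - real k *\<^sub>R (1, \<omega>))) \<longlonglongrightarrow> (LINT \<xi>:{z. \<omega> \<bullet> snd z < fst z}|lborel. F \<xi>)"
proof -
  let ?H = "{z. \<omega> \<bullet> snd z < fst z}"
  have [measurable]: "F \<in> borel_measurable borel" using F by auto
  have H: "?H \<in> sets borel"
    by (intro borel_open open_Collect_less continuous_intros)
  have shift: "(LINT \<xi>:forward_cone|lborel. F (\<xi> - v)) = (LINT \<xi>|lborel. indicator forward_cone (v + \<xi>) *\<^sub>R F \<xi>)" for v
    unfolding set_lebesgue_integral_def
    by (subst lborel_integral_translate(1)[of _ v, symmetric]) (auto simp: algebra_simps)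
  have "(\<lambda>k. LINT \<xi>|lborel. indicator forward_cone (real k *\<^sub>R (1, \<omega>) + \<xi>) *\<^sub>R F \<xi>) \<longlonglongrightarrow> (LINT \<xi>|lborel. indicator ?H \<xi> *\<^sub>R F \<xi>)"
  proof (rule integral_dominated_convergence[where w = "\<lambda>\<xi>. norm (F \<xi>)"])
    have "((1, - \<omega>) :: real \<times> (real ^ 'n)) \<noteq> 0" by (simp add: zero_prod_def)
    then have "AE \<xi> in lborel. (1::real, - \<omega>) \<bullet> \<xi> \<noteq> 0" by (rule AE_not_hyperplane)
    then show "AE \<xi> in lborel. (\<lambda>k. indicator forward_cone (real k *\<^sub>R (1, \<omega>) + \<xi>) *\<^sub>R F \<xi>) \<longlonglongrightarrow> indicator ?H \<xi> *\<^sub>R F \<xi>"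
    proof (rule eventually_mono)
      fix \<xi> :: "real \<times> (real ^ 'n)"
      assume *: "(1::real, - \<omega>) \<bullet> \<xi> \<noteq> 0"
      obtain s \<eta> where \<xi>: "\<xi> = (s, \<eta>)" by (cases \<xi>)
      define \<delta> where "\<delta> = s - \<omega> \<bullet> \<eta>"
      have \<delta>: "\<delta> \<noteq> 0" using * by (simp add: \<xi> \<delta>_def)
      have mem: "(real k *\<^sub>R (1, \<omega>) + \<xi> \<in> forward_cone) = (\<delta> > 0)"
        if k: "real k > \<bar>s\<bar>" "real k > \<bar>(norm \<eta>)\<^sup>2 - s\<^sup>2\<bar> / (2 * \<bar>\<delta>\<bar>)" for k
      proof -
        have "real k *\<^sub>R (1, \<omega>) + \<xi> \<in> forward_cone \<longleftrightarrow> norm (real k *\<^sub>R \<omega> + \<eta>) < real k + s"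
          by (simp add: \<xi> forward_cone_def)
        also have "\<dots> \<longleftrightarrow> (norm (real k *\<^sub>R \<omega> + \<eta>))\<^sup>2 < (real k + s)\<^sup>2"
          using k by (intro iffI power_strict_mono) (auto intro: power2_less_imp_less)
        also have "(norm (real k *\<^sub>R \<omega> + \<eta>))\<^sup>2 = (real k)\<^sup>2 + 2 * real k * (\<omega> \<bullet> \<eta>) + (norm \<eta>)\<^sup>2"
          using \<omega> unfolding power2_norm_eq_inner
          by (simp add: inner_add_left inner_add_right inner_commute power2_eq_square norm_eq_1)
        also have "\<dots> < (real k + s)\<^sup>2 \<longleftrightarrow> (norm \<eta>)\<^sup>2 - s\<^sup>2 < 2 * real k * \<delta>"
          by (simp add: \<delta>_def power2_eq_square algebra_simps)
        also have "\<dots> \<longleftrightarrow> \<delta> > 0"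
        proof -
          have "\<bar>(norm \<eta>)\<^sup>2 - s\<^sup>2\<bar> < 2 * real k * \<bar>\<delta>\<bar>" using k(2) \<delta> by (simp add: field_simps)
          then show ?thesis by (cases "\<delta> > 0") (auto simp: abs_if split: if_splits)
        qed
        finally show ?thesis .
      qed
      have "eventually (\<lambda>k. real k > \<bar>s\<bar>) sequentially"
        "eventually (\<lambda>k. real k > \<bar>(norm \<eta>)\<^sup>2 - s\<^sup>2\<bar> / (2 * \<bar>\<delta>\<bar>)) sequentially"
        using filterlim_real_sequentially by (auto simp: filterlim_at_top_dense)
      then have "eventually (\<lambda>k. indicator forward_cone (real k *\<^sub>R (1, \<omega>) + \<xi>) *\<^sub>R F \<xi> = indicator ?H \<xi> *\<^sub>R F \<xi>) sequentially"
        by eventually_elim (use mem in \<open>simp add: indicator_def \<xi> \<delta>_def\<close>)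
      then show "(\<lambda>k. indicator forward_cone (real k *\<^sub>R (1, \<omega>) + \<xi>) *\<^sub>R F \<xi>) \<longlonglongrightarrow> indicator ?H \<xi> *\<^sub>R F \<xi>"
        by (rule tendsto_eventually)
    qed
    show "(\<lambda>\<xi>. indicator ?H \<xi> *\<^sub>R F \<xi>) \<in> borel_measurable lborel"
      using H by (intro borel_measurable_scaleR borel_measurable_indicator) auto
    show "(\<lambda>\<xi>. indicator forward_cone (real k *\<^sub>R (1, \<omega>) + \<xi>) *\<^sub>R F \<xi>) \<in> borel_measurable lborel" for k
      by measurable
  qed (use F in \<open>auto simp: indicator_def\<close>)
  then show ?thesis unfolding shift unfolding set_lebesgue_integral_def .
qed

lemma fourier_modulate:
  "fourier (\<lambda>x. exp (2 * pi * \<i> * complex_of_real (x \<bullet> v)) * f x) \<xi> = fourier f (\<xi> - v)"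
  unfolding fourier_def
  by (rule Bochner_Integration.integral_cong[OF refl])
     (simp add: exp_add[symmetric] inner_diff_right algebra_simps)

subsection \<open>A Kakeya compression by binary digits\<close>

text \<open>
  A set \<open>A\<close> of binary places codes a line of slope \<open>\<Sum>l\<in>A. 1 / 2 ^ l\<close>, whose \<open>l\<close>-th digit is
  focused at time \<open>l / n\<close>. At a time in \<open>[k / n, (k + 1) / n]\<close> the digits after the \<open>k\<close>-th contribute
  only \<open>O(1 / (n 2 ^ k))\<close>, so the lines are compressed; after time \<open>1\<close> all digits act in the
  same direction and the lines are ordered and separated.
\<close>
definition digit_line :: "nat \<Rightarrow> nat set \<Rightarrow> real \<Rightarrow> real" where
  "digit_line n A t = (\<Sum>l\<in>A. (t - real l / real n) / 2 ^ l)"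

definition digit_slope :: "nat set \<Rightarrow> real" where
  "digit_slope A = (\<Sum>l\<in>A. 1 / 2 ^ l)"

lemma digit_line_affine: "digit_line n A t = digit_line n A 0 + t * digit_slope A"
  by (simp add: digit_line_def digit_slope_def sum_distrib_left sum.distrib[symmetric] diff_divide_distrib)

lemma geometric_tail: "k \<le> n \<Longrightarrow> (\<Sum>l\<in>{k<..n}. 1 / 2 ^ l :: real) = 1 / 2 ^ k - 1 / 2 ^ n"
proof (induction n rule: dec_induct)
  case (step n)
  have "{k<..Suc n} = insert (Suc n) {k<..n}" using step by auto
  then have "(\<Sum>l\<in>{k<..Suc n}. 1 / 2 ^ l :: real) = 1 / 2 ^ Suc n + (1 / 2 ^ k - 1 / 2 ^ n)"
    using step.IH by simp
  then show ?case by simp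
qed simp

lemma arithmetic_geometric_tail:
  "k \<le> n \<Longrightarrow> (\<Sum>l\<in>{k<..n}. (real l - real k) / 2 ^ l) = 2 / 2 ^ k - (real n - real k + 2) / 2 ^ n"
proof (induction n rule: dec_induct)
  case (step n)
  have "{k<..Suc n} = insert (Suc n) {k<..n}" using step by auto
  then have "(\<Sum>l\<in>{k<..Suc n}. (real l - real k) / 2 ^ l)
      = (real (Suc n) - real k) / 2 ^ Suc n + (2 / 2 ^ k - (real n - real k + 2) / 2 ^ n)"
    using step.IH by simp
  also have "\<dots> = 2 / 2 ^ k - (real (Suc n) - real k + 2) / 2 ^ Suc n"
    by (simp add: add_divide_distrib diff_divide_distrib)
  finally show ?case .
qed simp

lemma digit_slope_bounds:
  assumes "A \<subseteq> {1..n}" shows "0 \<le> digit_slope A" "digit_slope A \<le> 1"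
proof -
  show "0 \<le> digit_slope A" by (auto simp: digit_slope_def intro: sum_nonneg)
  have "digit_slope A \<le> (\<Sum>l\<in>{0<..n}. 1 / 2 ^ l)"
    unfolding digit_slope_def using assms by (intro sum_mono2) auto
  also have "\<dots> \<le> 1" using geometric_tail[of 0 n] by simp
  finally show "digit_slope A \<le> 1" .
qed

lemma digit_line_intercept_bound:
  assumes "A \<subseteq> {1..n}" shows "\<bar>digit_line n A 0\<bar> \<le> 1"
proof -
  have "\<bar>digit_line n A 0\<bar> \<le> (\<Sum>l\<in>A. \<bar>(0 - real l / real n) / 2 ^ l\<bar>)"
    unfolding digit_line_def by (rule sum_abs)
  also have "\<dots> \<le> digit_slope A"
    unfolding digit_slope_def
  proof (rule sum_mono)
    fix l assume "l \<in> A"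
    then have "real l / real n \<le> 1" using assms by (auto simp: divide_le_eq_1)
    then have "(real l / real n) / 2 ^ l \<le> 1 / 2 ^ l" by (rule divide_right_mono) simp
    then show "\<bar>(0 - real l / real n) / 2 ^ l\<bar> \<le> 1 / 2 ^ l" by simp
  qed
  also have "\<dots> \<le> 1" by (rule digit_slope_bounds(2)[OF assms])
  finally show ?thesis .
qed

lemma digit_line_separated_aux:
  assumes A: "A \<subseteq> {1..n}" and B: "B \<subseteq> {1..n}" and t: "t \<ge> 2"
    and k: "k \<in> A" "k \<notin> B" and eq: "A \<inter> {..<k} = B \<inter> {..<k}"
  shows "1 / 2 ^ n \<le> digit_line n A t - digit_line n B t"
proof -
  let ?w = "\<lambda>l. (t - real l / real n) / 2 ^ l"
  have fin: "finite A" "finite B" using A B finite_subset by auto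
  have kn: "1 \<le> k" "k \<le> n" using A k by auto
  have w0: "0 \<le> ?w l" if "l \<le> n" for l
  proof -
    have "real l / real n \<le> 1" using that by (cases "n = 0") auto
    then show ?thesis using t by simp
  qed
  have "A = (A \<inter> {..<k}) \<union> (insert k (A \<inter> {k<..n}))" using A k by auto
  then have "sum ?w A = sum ?w ((A \<inter> {..<k}) \<union> (insert k (A \<inter> {k<..n})))" by simp
  also have "\<dots> = sum ?w (A \<inter> {..<k}) + (?w k + sum ?w (A \<inter> {k<..n}))"
    using fin by (subst sum.union_disjoint) auto
  finally have 1: "sum ?w A = sum ?w (A \<inter> {..<k}) + (?w k + sum ?w (A \<inter> {k<..n}))" .
  have "l \<in> (B \<inter> {..<k}) \<union> (B \<inter> {k<..n})" if "l \<in> B" for l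
    using that B k by (cases "l < k"; cases "l = k") auto
  then have "B = (B \<inter> {..<k}) \<union> (B \<inter> {k<..n})" by blast
  then have "sum ?w B = sum ?w ((B \<inter> {..<k}) \<union> (B \<inter> {k<..n}))" by simp
  also have "\<dots> = sum ?w (B \<inter> {..<k}) + sum ?w (B \<inter> {k<..n})"
    using fin by (subst sum.union_disjoint) auto
  finally have 2: "sum ?w B = sum ?w (A \<inter> {..<k}) + sum ?w (B \<inter> {k<..n})" by (simp add: eq)
  have "sum ?w (B \<inter> {k<..n}) \<le> sum ?w {k<..n}"
    by (rule sum_mono2) (auto intro: w0)
  also have "\<dots> \<le> (\<Sum>l\<in>{k<..n}. (t - real k / real n) * (1 / 2 ^ l))"
    by (intro sum_mono) (auto intro!: divide_right_mono simp: divide_right_mono)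
  also have "\<dots> = (t - real k / real n) * (1 / 2 ^ k - 1 / 2 ^ n)"
    using geometric_tail[OF kn(2)] by (simp only: sum_distrib_left[symmetric])
  finally have "?w k - sum ?w (B \<inter> {k<..n}) \<ge> (t - real k / real n) * (1 / 2 ^ n)"
    by (simp add: algebra_simps)
  moreover have "(t - real k / real n) * (1 / 2 ^ n) \<ge> 1 * (1 / 2 ^ n)"
    using kn t by (intro mult_right_mono) (auto simp: divide_le_eq_1 intro: order_trans[of _ "t - 1"])
  moreover have "sum ?w (A \<inter> {k<..n}) \<ge> 0" by (rule sum_nonneg) (auto intro: w0)
  ultimately show ?thesis unfolding digit_line_def 1 2 by linarith
qed

lemma digit_line_separated:
  assumes A: "A \<subseteq> {1..n}" and B: "B \<subseteq> {1..n}" and t: "t \<ge> 2" and "A \<noteq> B"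
  shows "1 / 2 ^ n \<le> \<bar>digit_line n A t - digit_line n B t\<bar>"
proof -
  define k where "k = (LEAST k. (k \<in> A) \<noteq> (k \<in> B))"
  have ex: "\<exists>k. (k \<in> A) \<noteq> (k \<in> B)" using \<open>A \<noteq> B\<close> by auto
  have k: "(k \<in> A) \<noteq> (k \<in> B)" unfolding k_def by (rule LeastI_ex[OF ex])
  have "(l \<in> A) = (l \<in> B)" if "l < k" for l using not_less_Least[of l] that by (auto simp: k_def)
  then have eq: "A \<inter> {..<k} = B \<inter> {..<k}" by auto
  show ?thesis
  proof (cases "k \<in> A")
    case True
    then show ?thesis using digit_line_separated_aux[OF A B t _ _ eq] k by auto
  next
    case False
    then show ?thesis using digit_line_separated_aux[OF B A t _ _ eq[symmetric]] k by auto
  qed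
qed

lemma digit_line_compressed:
  assumes A: "A \<subseteq> {1..n}" and k: "k < n" and t: "real k / real n \<le> t" "t \<le> real (Suc k) / real n"
  shows "digit_line n A t \<le> digit_line n (A \<inter> {..k}) t"
    and "digit_line n (A \<inter> {..k}) t - 2 / (real n * 2 ^ k) \<le> digit_line n A t"
proof -
  let ?w = "\<lambda>l. (t - real l / real n) / 2 ^ l"
  have n: "n > 0" using k by simp
  have fin: "finite A" using A finite_subset by auto
  have "A = (A \<inter> {..k}) \<union> (A \<inter> {k<..n})" using A by auto
  then have "sum ?w A = sum ?w ((A \<inter> {..k}) \<union> (A \<inter> {k<..n}))" by simp
  also have "\<dots> = sum ?w (A \<inter> {..k}) + sum ?w (A \<inter> {k<..n})"
    using fin by (subst sum.union_disjoint) auto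
  finally have split: "digit_line n A t = digit_line n (A \<inter> {..k}) t + sum ?w (A \<inter> {k<..n})"
    by (simp add: digit_line_def)
  have neg: "?w l \<le> 0" if "l > k" for l
  proof -
    have "real (Suc k) / real n \<le> real l / real n" using that n by (intro divide_right_mono) auto
    then have "t - real l / real n \<le> 0" using t by linarith
    then show ?thesis by (simp add: divide_nonpos_pos)
  qed
  show "digit_line n A t \<le> digit_line n (A \<inter> {..k}) t"
    unfolding split using sum_nonpos[of "A \<inter> {k<..n}" ?w] neg by auto
  have "- sum ?w (A \<inter> {k<..n}) = (\<Sum>l\<in>A \<inter> {k<..n}. - ?w l)" by (simp add: sum_negf)
  also have "\<dots> \<le> (\<Sum>l\<in>{k<..n}. - ?w l)"
    by (rule sum_mono2) (use neg in auto)
  also have "\<dots> \<le> (\<Sum>l\<in>{k<..n}. (1 / real n) * ((real l - real k) / 2 ^ l))"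
  proof (rule sum_mono)
    fix l
    have "- (t - real l / real n) \<le> (1 / real n) * (real l - real k)"
      using t(1) by (simp add: diff_divide_distrib)
    then have "- (t - real l / real n) / 2 ^ l \<le> (1 / real n) * (real l - real k) / 2 ^ l"
      by (rule divide_right_mono) simp
    then show "- ?w l \<le> (1 / real n) * ((real l - real k) / 2 ^ l)"
      by (simp only: minus_divide_left times_divide_eq_right)
  qed
  also have "\<dots> = (1 / real n) * (2 / 2 ^ k - (real n - real k + 2) / 2 ^ n)"
    unfolding sum_distrib_left[symmetric] using k by (subst arithmetic_geometric_tail) auto
  also have "\<dots> \<le> (1 / real n) * (2 / 2 ^ k)"
    using k by (intro mult_left_mono) auto
  finally show "digit_line n (A \<inter> {..k}) t - 2 / (real n * 2 ^ k) \<le> digit_line n A t"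
    unfolding split by simp
qed

lemma integral_pos_continuous:
  fixes f :: "'a::euclidean_space \<Rightarrow> real"
  assumes f: "integrable lborel f" "continuous_on UNIV f" "\<And>x. f x \<ge> 0" and x: "f x > 0"
  shows "(LINT x|lborel. f x) > 0"
proof (rule ccontr)
  assume "\<not> ?thesis"
  then have "(LINT x|lborel. f x) = 0"
    using f by (intro antisym integral_nonneg_AE) auto
  then have "AE x in lborel. f x = 0"
    using integral_nonneg_eq_0_iff_AE[OF f(1)] f(3) by simp
  then have "{x. f x \<noteq> 0} \<in> null_sets lborel"
    using f(1) by (subst (asm) AE_iff_null) auto
  then have "negligible {x. f x \<noteq> 0}"
    by (simp add: negligible_iff_null_sets null_sets_completionI)
  moreover have "open {x. f x \<noteq> 0}"
    by (intro open_Collect_neq continuous_on_const f(2))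
  moreover have "x \<in> {x. f x \<noteq> 0}" using x by simp
  ultimately show False using open_not_negligible by blast
qed

subsection \<open>Planks in light directions\<close>

locale planks =
  fixes \<rho> :: real and i1 i2 :: "'n::finite"
  assumes \<rho>: "\<rho> > 0" and i12: "i1 \<noteq> i2"
begin

definition \<alpha> :: "real \<Rightarrow> real" where "\<alpha> t = flat_exp 0 ((t - 2 * \<rho>) * (3 * \<rho> - t))"
definition \<beta> :: "real \<Rightarrow> real" where "\<beta> t = flat_exp 0 (t * (\<rho> - t))"
definition bump :: "real ^ 'n \<Rightarrow> complex" where "bump y = complex_of_real (flat_exp 0 ((\<rho> / 2)\<^sup>2 - (norm y)\<^sup>2))"

definition squeeze :: "nat \<Rightarrow> real ^ 'n \<Rightarrow> real" where
  "squeeze n j = (if j = axis i2 1 then 1 / 2 ^ n else 1)"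

definition light :: "nat set \<Rightarrow> real ^ 'n" where
  "light A = sqrt (1 - (digit_slope A)\<^sup>2) *\<^sub>R axis i1 1 - digit_slope A *\<^sub>R axis i2 1"

definition plate :: "nat \<Rightarrow> nat set \<Rightarrow> real ^ 'n \<Rightarrow> complex" where
  "plate n A y = bump (dil (\<lambda>j. 1 / squeeze n j) (y - (\<rho> * digit_line n A 0) *\<^sub>R axis i2 1))"

definition late :: "nat \<Rightarrow> nat set \<Rightarrow> real \<times> (real ^ 'n) \<Rightarrow> complex" where
  "late n A z = complex_of_real (\<alpha> (fst z)) * plate n A (snd z + fst z *\<^sub>R light A)"

definition early :: "nat \<Rightarrow> nat set \<Rightarrow> real \<times> (real ^ 'n) \<Rightarrow> complex" where
  "early n A z = complex_of_real (\<beta> (fst z)) * plate n A (snd z + fst z *\<^sub>R light A)"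

lemma squeeze_pos: "squeeze n j > 0" and squeeze_le_1: "squeeze n j \<le> 1"
  by (auto simp: squeeze_def)

lemma prod_squeeze: "(\<Prod>j\<in>Basis. squeeze n j) = 1 / 2 ^ n"
proof -
  have "(axis i2 1 :: real ^ 'n) \<in> Basis" by (auto simp: Basis_vec_def)
  then show ?thesis by (simp add: squeeze_def)
qed

lemma norm_light: "A \<subseteq> {1..n} \<Longrightarrow> norm (light A) = 1"
proof -
  assume A: "A \<subseteq> {1..n}"
  let ?m = "digit_slope A"
  have "?m\<^sup>2 \<le> 1" using digit_slope_bounds[OF A] by (simp add: power_le_one)
  then have "light A \<bullet> light A = 1"
    using i12 by (simp add: light_def inner_diff_left inner_diff_right inner_axis_axis power2_eq_square[symmetric])
  then show ?thesis by (simp add: norm_eq_1)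
qed

lemma light_i2: "light A $ i2 = - digit_slope A"
  using i12 by (simp add: light_def axis_def)

lemma \<alpha>_props: "0 \<le> \<alpha> t" "\<alpha> t \<le> 1" "\<alpha> t \<noteq> 0 \<Longrightarrow> 2 * \<rho> < t \<and> t < 3 * \<rho>"
  and \<beta>_props: "0 \<le> \<beta> t" "\<beta> t \<le> 1" "\<beta> t \<noteq> 0 \<Longrightarrow> 0 < t \<and> t < \<rho>"
  using \<rho> by (auto simp: \<alpha>_def \<beta>_def flat_exp_nonneg flat_exp_0_le_1) 
    (auto simp: flat_exp_def zero_less_mult_iff split: if_splits)

lemma bump_props: "norm (bump y) \<le> 1" "bump y \<noteq> 0 \<longleftrightarrow> norm y < \<rho> / 2"
proof -
  show "norm (bump y) \<le> 1" by (simp add: bump_def flat_exp_nonneg flat_exp_0_le_1)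
  have "bump y \<noteq> 0 \<longleftrightarrow> (norm y)\<^sup>2 < (\<rho> / 2)\<^sup>2"
    using flat_exp_pos_iff[of 0 "(\<rho> / 2)\<^sup>2 - (norm y)\<^sup>2"] flat_exp_nonneg[of 0 "(\<rho> / 2)\<^sup>2 - (norm y)\<^sup>2"]
    by (auto simp: bump_def)
  also have "\<dots> \<longleftrightarrow> norm y < \<rho> / 2"
    using \<rho> by (metis abs_of_pos half_gt_zero norm_ge_zero power2_less_imp_less power_strict_mono zero_less_numeral less_imp_le pos2)
  finally show "bump y \<noteq> 0 \<longleftrightarrow> norm y < \<rho> / 2" .
qed

lemma plate_support:
  assumes "plate n A y \<noteq> 0"
  shows "\<bar>y $ i2 - \<rho> * digit_line n A 0\<bar> < \<rho> / 2 / 2 ^ n"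
    and "norm (y - (\<rho> * digit_line n A 0) *\<^sub>R axis i2 1) < \<rho> / 2"
proof -
  let ?y = "y - (\<rho> * digit_line n A 0) *\<^sub>R axis i2 1"
  let ?d = "dil (\<lambda>j. 1 / squeeze n j) ?y"
  have d: "norm ?d < \<rho> / 2" using assms by (simp add: plate_def bump_props)
  have B: "(axis i2 1 :: real ^ 'n) \<in> Basis" by (auto simp: Basis_vec_def)
  have "\<bar>?d \<bullet> axis i2 1\<bar> \<le> norm ?d" by (rule Basis_le_norm[OF B])
  then have "\<bar>2 ^ n * (?y \<bullet> axis i2 1)\<bar> < \<rho> / 2"
    unfolding dil_inner[OF B] using d by (simp add: squeeze_def)
  moreover have "?y \<bullet> axis i2 1 = y $ i2 - \<rho> * digit_line n A 0"
    unfolding inner_axis by (simp add: axis_def)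
  ultimately have "\<bar>2 ^ n * (y $ i2 - \<rho> * digit_line n A 0)\<bar> < \<rho> / 2" by simp
  then show "\<bar>y $ i2 - \<rho> * digit_line n A 0\<bar> < \<rho> / 2 / 2 ^ n"
    unfolding abs_mult by (simp add: field_simps)
  have "norm ?y \<le> norm ?d"
  proof (rule norm_le_componentwise)
    fix j :: "real ^ 'n" assume j: "j \<in> Basis"
    have "1 * \<bar>?y \<bullet> j\<bar> \<le> (1 / squeeze n j) * \<bar>?y \<bullet> j\<bar>"
      using squeeze_pos[of n j] squeeze_le_1[of n j] by (intro mult_right_mono) (auto simp: field_simps)
    also have "\<dots> = \<bar>?d \<bullet> j\<bar>"
      unfolding dil_inner[OF j] using squeeze_pos[of n j] by (simp add: abs_mult)
    finally show "\<bar>?y \<bullet> j\<bar> \<le> \<bar>?d \<bullet> j\<bar>" by simp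
  qed
  then show "norm ?y < \<rho> / 2" using d by simp
qed

lemma plank_support:
  assumes A: "A \<subseteq> {1..n}" and p: "plate n A (y + t *\<^sub>R light A) \<noteq> 0" and t: "0 \<le> t" "t \<le> 3 * \<rho>"
  shows "\<bar>y $ i2 - \<rho> * digit_line n A (t / \<rho>)\<bar> < \<rho> / 2 / 2 ^ n"
    and "norm y \<le> 5 * \<rho>" and "norm (t, y) \<le> 8 * \<rho>"
proof -
  have "(y + t *\<^sub>R light A) $ i2 - \<rho> * digit_line n A 0 = y $ i2 - \<rho> * digit_line n A (t / \<rho>)"
    using \<rho> by (subst (2) digit_line_affine) (simp add: light_i2 field_simps)
  then show "\<bar>y $ i2 - \<rho> * digit_line n A (t / \<rho>)\<bar> < \<rho> / 2 / 2 ^ n"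
    using plate_support(1)[OF p] by simp
  let ?u = "(\<rho> * digit_line n A 0) *\<^sub>R (axis i2 1 :: real ^ 'n)"
  have "y = (y + t *\<^sub>R light A - ?u) + ?u - t *\<^sub>R light A" by simp
  then have "norm y \<le> norm (y + t *\<^sub>R light A - ?u) + norm ?u + norm (t *\<^sub>R light A)"
    using norm_triangle_ineq4[of "(y + t *\<^sub>R light A - ?u) + ?u" "t *\<^sub>R light A"]
      norm_triangle_ineq[of "y + t *\<^sub>R light A - ?u" ?u] by simp
  moreover have "norm ?u \<le> \<rho>"
    using \<rho> digit_line_intercept_bound[OF A] by (simp add: abs_mult)
  moreover have "norm (t *\<^sub>R light A) \<le> 3 * \<rho>" using norm_light[OF A] t by simp
  ultimately show y: "norm y \<le> 5 * \<rho>" using plate_support(2)[OF p] \<rho> by simp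
  have "norm (t, y) \<le> norm t + norm y" by (rule norm_Pair_le)
  then show "norm (t, y) \<le> 8 * \<rho>" using y t by simp
qed

lemma smooth_plate: "smooth (\<lambda>z. plate n A (snd z + (fst z :: real) *\<^sub>R light A))"
proof -
  have "bounded_linear (\<lambda>z::real \<times> (real ^ 'n). snd z + fst z *\<^sub>R light A)"
    by (intro bounded_linear_add bounded_linear_snd bounded_linear_scaleR_const bounded_linear_fst)
  then show ?thesis
    unfolding plate_def bump_def
    by (intro smooth_of_real smooth_flat_exp smooth_diff smooth_const smooth_norm_power2
        smooth_bounded_linear_comp[OF bounded_linear_dil] smooth_bounded_linear)
qed

lemma smooth_fst: "smooth (\<lambda>z::real \<times> (real ^ 'n). fst z)"
  by (rule smooth_bounded_linear[OF bounded_linear_fst])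

lemma late_test: "A \<subseteq> {1..n} \<Longrightarrow> late n A \<in> test_fns (ball 0 (10 * \<rho>))"
  and early_test: "A \<subseteq> {1..n} \<Longrightarrow> early n A \<in> test_fns (ball 0 (10 * \<rho>))"
proof -
  assume A: "A \<subseteq> {1..n}"
  have sub: "cball 0 (8 * \<rho>) \<subseteq> ball (0 :: real \<times> (real ^ 'n)) (10 * \<rho>)" using \<rho> by auto
  show "late n A \<in> test_fns (ball 0 (10 * \<rho>))"
  proof (rule test_fnI[OF _ compact_cball sub])
    show "smooth (late n A)" unfolding late_def[abs_def] \<alpha>_def
      by (intro smooth_plate smooth_intros smooth_fst)
    show "z \<in> cball 0 (8 * \<rho>)" if "late n A z \<noteq> 0" for z
      using plank_support(3)[OF A, of "snd z" "fst z"] \<alpha>_props(3)[of "fst z"] that \<rho> by (simp add: late_def)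
  qed
  show "early n A \<in> test_fns (ball 0 (10 * \<rho>))"
  proof (rule test_fnI[OF _ compact_cball sub])
    show "smooth (early n A)" unfolding early_def[abs_def] \<beta>_def
      by (intro smooth_plate smooth_intros smooth_fst)
    show "z \<in> cball 0 (8 * \<rho>)" if "early n A z \<noteq> 0" for z
      using plank_support(3)[OF A, of "snd z" "fst z"] \<beta>_props(3)[of "fst z"] that \<rho> by (simp add: early_def)
  qed
qed

lemma norm_late_le: "norm (late n A z) \<le> 1"
  using \<alpha>_props(1,2)[of "fst z"] by (simp add: late_def norm_mult plate_def bump_props mult_le_one)

lemma late_support:
  assumes "A \<subseteq> {1..n}" "late n A z \<noteq> 0"
  shows "2 * \<rho> < fst z" "fst z < 3 * \<rho>" "\<bar>snd z $ i2 - \<rho> * digit_line n A (fst z / \<rho>)\<bar> < \<rho> / 2 / 2 ^ n"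
proof -
  show t: "2 * \<rho> < fst z" "fst z < 3 * \<rho>"
    using \<alpha>_props(3)[of "fst z"] assms by (auto simp: late_def)
  show "\<bar>snd z $ i2 - \<rho> * digit_line n A (fst z / \<rho>)\<bar> < \<rho> / 2 / 2 ^ n"
    by (rule plank_support(1)[OF assms(1)]) (use assms(2) t \<rho> in \<open>simp_all add: late_def\<close>)
qed

lemma early_support:
  assumes "A \<subseteq> {1..n}" "early n A z \<noteq> 0"
  shows "0 < fst z" "fst z < \<rho>" "\<bar>snd z $ i2 - \<rho> * digit_line n A (fst z / \<rho>)\<bar> < \<rho> / 2 / 2 ^ n"
    "norm (snd z) \<le> 5 * \<rho>"
proof -
  show t: "0 < fst z" "fst z < \<rho>"
    using \<beta>_props(3)[of "fst z"] assms by (auto simp: early_def)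
  show "\<bar>snd z $ i2 - \<rho> * digit_line n A (fst z / \<rho>)\<bar> < \<rho> / 2 / 2 ^ n"
    by (rule plank_support(1)[OF assms(1)]) (use assms(2) t \<rho> in \<open>simp_all add: early_def\<close>)
  show "norm (snd z) \<le> 5 * \<rho>"
    by (rule plank_support(2)[OF assms(1), of _ "fst z"]) (use assms(2) t \<rho> in \<open>simp_all add: early_def\<close>)
qed

lemma late_disjoint:
  assumes A: "A \<subseteq> {1..n}" and B: "B \<subseteq> {1..n}" and "A \<noteq> B"
  shows "late n A z = 0 \<or> late n B z = 0"
proof (rule ccontr)
  assume *: "\<not> ?thesis"
  then have nz: "late n A z \<noteq> 0" "late n B z \<noteq> 0" by auto
  let ?h = "\<rho> / 2 / 2 ^ n" and ?a = "digit_line n A (fst z / \<rho>)" and ?b = "digit_line n B (fst z / \<rho>)"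
  have "2 \<le> fst z / \<rho>" using late_support(1)[OF A nz(1)] \<rho> by (simp add: field_simps)
  from digit_line_separated[OF A B this \<open>A \<noteq> B\<close>]
  have "\<rho> * (1 / 2 ^ n) \<le> \<rho> * \<bar>?a - ?b\<bar>" using \<rho> by (intro mult_left_mono) auto
  also have "\<dots> = \<bar>\<rho> * ?a - \<rho> * ?b\<bar>"
    using \<rho> by (simp add: abs_mult right_diff_distrib[symmetric])
  also have "\<dots> < ?h + ?h"
    using late_support(3)[OF A nz(1)] late_support(3)[OF B nz(2)] by linarith
  also have "\<dots> = \<rho> * (1 / 2 ^ n)" by simp
  finally show False by simp
qed

definition early_set :: "nat \<Rightarrow> (real \<times> (real ^ 'n)) set" where
  "early_set n = (\<Union>A\<in>Pow {1..n}. {z. early n A z \<noteq> 0})"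

lemma early_set_open: "open (early_set n)"
  unfolding early_set_def
  using smooth_continuous_on[OF test_fn_smooth[OF early_test]]
  by (intro open_UN ballI open_Collect_neq continuous_on_const) auto

definition slab :: "real \<Rightarrow> real \<Rightarrow> (real ^ 'n) set" where
  "slab l u = cbox (\<chi> i. if i = i2 then l else - 5 * \<rho>) (\<chi> i. if i = i2 then u else 5 * \<rho>)"

lemma slabI:
  assumes "\<And>i. \<bar>y $ i\<bar> \<le> 5 * \<rho>" "l \<le> y $ i2" "y $ i2 \<le> u" shows "y \<in> slab l u"
  using assms by (auto simp: slab_def mem_box_cart abs_le_iff minus_le_iff)

lemma emeasure_slab:
  assumes "l \<le> u"
  shows "emeasure lborel (slab l u) = ennreal ((u - l) * (10 * \<rho>) ^ (CARD('n) - 1))"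
proof -
  let ?a = "(\<chi> i. if i = i2 then l else - 5 * \<rho>) :: real ^ 'n"
  let ?b = "(\<chi> i. if i = i2 then u else 5 * \<rho>) :: real ^ 'n"
  have le: "?a $ i \<le> ?b $ i" for i using assms \<rho> by simp
  have "measure lborel (slab l u) = (\<Prod>i\<in>UNIV. ?b $ i - ?a $ i)"
    using content_cbox_cart[of ?a ?b] le unfolding slab_def by (simp add: interval_ne_empty_cart)
  also have "\<dots> = (?b $ i2 - ?a $ i2) * (\<Prod>i\<in>UNIV - {i2}. ?b $ i - ?a $ i)"
    by (rule prod.remove) auto
  also have "(\<Prod>i\<in>UNIV - {i2}. ?b $ i - ?a $ i) = (\<Prod>i\<in>UNIV - {i2}. 10 * \<rho>)"
    by (rule prod.cong) auto
  finally show ?thesis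
    unfolding slab_def using emeasure_lborel_cbox_finite[of ?a ?b]
    by (subst emeasure_eq_ennreal_measure) auto
qed

definition cover :: "nat \<Rightarrow> nat \<Rightarrow> real \<Rightarrow> nat set \<Rightarrow> (real ^ 'n) set" where
  "cover n k t A = slab (\<rho> * digit_line n A (t / \<rho>) - \<rho> * (2 / (real n * 2 ^ k)) - \<rho> / 2 / 2 ^ n)
    (\<rho> * digit_line n A (t / \<rho>) + \<rho> / 2 / 2 ^ n)"

lemma early_slice_subset:
  assumes k: "k < n" and t: "\<rho> * (real k / real n) \<le> t" "t \<le> \<rho> * (real (Suc k) / real n)"
  shows "{y. (t, y) \<in> early_set n} \<subseteq> (\<Union>A\<in>Pow {1..k}. cover n k t A)"
proof safe
  fix y assume "(t, y) \<in> early_set n"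
  then obtain A where A: "A \<subseteq> {1..n}" and nz: "early n A (t, y) \<noteq> 0" by (auto simp: early_set_def)
  note s = early_support[OF A nz, unfolded fst_conv snd_conv]
  have t': "real k / real n \<le> t / \<rho>" "t / \<rho> \<le> real (Suc k) / real n"
    using t \<rho> by (simp_all add: field_simps)
  note c = digit_line_compressed[OF A k t']
  have c1: "\<rho> * digit_line n A (t / \<rho>) \<le> \<rho> * digit_line n (A \<inter> {..k}) (t / \<rho>)"
    using c(1) \<rho> by simp
  have "\<rho> * (digit_line n (A \<inter> {..k}) (t / \<rho>) - 2 / (real n * 2 ^ k)) \<le> \<rho> * digit_line n A (t / \<rho>)"
    using c(2) \<rho> by (intro mult_left_mono) auto
  then have c2: "\<rho> * digit_line n (A \<inter> {..k}) (t / \<rho>) - \<rho> * (2 / (real n * 2 ^ k)) \<le> \<rho> * digit_line n A (t / \<rho>)"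
    by (simp only: right_diff_distrib)
  have comp: "\<bar>y $ i\<bar> \<le> 5 * \<rho>" for i using component_le_norm_cart[of y i] s(4) by linarith
  have "A \<inter> {..k} \<in> Pow {1..k}" using A by auto
  moreover have "y \<in> cover n k t (A \<inter> {..k})"
    unfolding cover_def by (rule slabI[OF comp]) (use s(3) c1 c2 in linarith)+
  ultimately show "y \<in> (\<Union>A\<in>Pow {1..k}. cover n k t A)" by blast
qed

lemma emeasure_early_slice:
  assumes k: "k < n" and t: "\<rho> * (real k / real n) \<le> t" "t \<le> \<rho> * (real (Suc k) / real n)"
  shows "emeasure lborel {y. (t, y) \<in> early_set n} \<le> ennreal (\<rho> * (2 / real n + 2 ^ k / 2 ^ n) * (10 * \<rho>) ^ (CARD('n) - 1))"
proof -
  have pos: "0 \<le> \<rho> * (2 / (real n * 2 ^ k)) + \<rho> / 2 ^ n" using \<rho> by simp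
  have cov: "emeasure lborel (cover n k t A) = ennreal ((\<rho> * (2 / (real n * 2 ^ k)) + \<rho> / 2 ^ n) * (10 * \<rho>) ^ (CARD('n) - 1))" for A
    unfolding cover_def
  proof (subst emeasure_slab)
    have "0 \<le> \<rho> * (2 / (real n * 2 ^ k))" "0 \<le> \<rho> / 2 / 2 ^ n" using \<rho> by simp_all
    then show "\<rho> * digit_line n A (t / \<rho>) - \<rho> * (2 / (real n * 2 ^ k)) - \<rho> / 2 / 2 ^ n \<le> \<rho> * digit_line n A (t / \<rho>) + \<rho> / 2 / 2 ^ n"
      by linarith
  qed (simp add: add.commute)
  have "emeasure lborel {y. (t, y) \<in> early_set n} \<le> emeasure lborel (\<Union>A\<in>Pow {1..k}. cover n k t A)"
    by (rule emeasure_mono[OF early_slice_subset[OF k t]]) (auto simp: cover_def slab_def)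
  also have "\<dots> \<le> (\<Sum>A\<in>Pow {1..k}. emeasure lborel (cover n k t A))"
    by (rule emeasure_subadditive_finite) (auto simp: cover_def slab_def)
  also have "\<dots> = ennreal (2 ^ k * ((\<rho> * (2 / (real n * 2 ^ k)) + \<rho> / 2 ^ n) * (10 * \<rho>) ^ (CARD('n) - 1)))"
    unfolding cov using pos \<rho> by (subst sum_ennreal) (auto simp: card_Pow intro!: mult_nonneg_nonneg)
  also have "2 ^ k * ((\<rho> * (2 / (real n * 2 ^ k)) + \<rho> / 2 ^ n) * (10 * \<rho>) ^ (CARD('n) - 1))
      = \<rho> * (2 / real n + 2 ^ k / 2 ^ n) * (10 * \<rho>) ^ (CARD('n) - 1)"
    by (simp add: distrib_left)
  finally show ?thesis .
qed

lemma emeasure_early_set: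
  assumes n: "n > 0"
  shows "emeasure lborel (early_set n) \<le> ennreal (3 * \<rho>\<^sup>2 * (10 * \<rho>) ^ (CARD('n) - 1) / real n)"
proof -
  let ?c = "(10 * \<rho>) ^ (CARD('n) - 1)"
  let ?I = "\<lambda>k. {\<rho> * (real k / real n)..\<rho> * (real (Suc k) / real n)}"
  let ?b = "\<lambda>k. \<rho> * (2 / real n + 2 ^ k / 2 ^ n) * ?c"
  have c: "?c > 0" using \<rho> by simp
  have b: "?b k \<ge> 0" for k using c \<rho> by simp
  have "early_set n \<in> sets (lborel \<Otimes>\<^sub>M lborel)"
    unfolding lborel_prod using early_set_open by simp
  then have "emeasure lborel (early_set n) = (\<integral>\<^sup>+t. emeasure lborel (Pair t -` early_set n) \<partial>lborel)"
    unfolding lborel_prod[symmetric] by (rule lborel.emeasure_pair_measure_alt)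
  also have "\<dots> \<le> (\<integral>\<^sup>+t. (\<Sum>k<n. ennreal (?b k) * indicator (?I k) t) \<partial>lborel)"
  proof (rule nn_integral_mono)
    fix t :: real
    have vi: "Pair t -` early_set n = {y. (t, y) \<in> early_set n}" by auto
    show "emeasure lborel (Pair t -` early_set n) \<le> (\<Sum>k<n. ennreal (?b k) * indicator (?I k) t)"
    proof (cases "0 < t \<and> t < \<rho>")
      case True
      define k where "k = nat \<lfloor>real n * (t / \<rho>)\<rfloor>"
      have x: "0 \<le> real n * (t / \<rho>)" using True \<rho> by simp
      have fl: "real k \<le> real n * (t / \<rho>)" "real n * (t / \<rho>) < real (Suc k)"
        using x unfolding k_def by linarith+
      have "real n * (t / \<rho>) < real n * 1" using True \<rho> n by (intro mult_strict_left_mono) auto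
      then have kn: "k < n" using fl by simp
      have tI: "\<rho> * (real k / real n) \<le> t" "t \<le> \<rho> * (real (Suc k) / real n)"
        using fl \<rho> n by (simp_all add: field_simps)
      have "emeasure lborel {y. (t, y) \<in> early_set n} \<le> ennreal (?b k) * indicator (?I k) t"
        using emeasure_early_slice[OF kn tI] tI by simp
      also have "\<dots> \<le> (\<Sum>k<n. ennreal (?b k) * indicator (?I k) t)"
        using kn by (intro member_le_sum) auto
      finally show ?thesis unfolding vi .
    next
      case False
      then have "{y. (t, y) \<in> early_set n} = {}"
      proof -
        have "early n A (t, y) = 0" if "A \<subseteq> {1..n}" for A y
          using early_support(1,2)[OF that, of "(t, y)"] False by auto
        then show ?thesis by (auto simp: early_set_def)
      qed
      then show ?thesis unfolding vi by simp
    qed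
  qed
  also have "\<dots> = (\<Sum>k<n. ennreal (?b k) * emeasure lborel (?I k))"
    by (subst nn_integral_sum) (auto simp: nn_integral_cmult_indicator)
  also have "\<dots> = (\<Sum>k<n. ennreal (?b k * (\<rho> / real n)))"
  proof (rule sum.cong[OF refl])
    fix k
    have "\<rho> * (real (Suc k) / real n) - \<rho> * (real k / real n) = \<rho> / real n"
      by (simp add: right_diff_distrib[symmetric] diff_divide_distrib[symmetric])
    moreover have "\<rho> * (real k / real n) \<le> \<rho> * (real (Suc k) / real n)"
      using \<rho> by (intro mult_left_mono divide_right_mono) auto
    ultimately show "ennreal (?b k) * emeasure lborel (?I k) = ennreal (?b k * (\<rho> / real n))"
      using b[of k] \<rho> by (simp only: emeasure_lborel_Icc) (rule ennreal_mult[symmetric], auto)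
  qed
  also have "\<dots> = ennreal (\<Sum>k<n. ?b k * (\<rho> / real n))"
    using b \<rho> by (intro sum_ennreal mult_nonneg_nonneg) auto
  also have "(\<Sum>k<n. ?b k * (\<rho> / real n)) = \<rho>\<^sup>2 * ?c / real n * (\<Sum>k<n. 2 / real n + 2 ^ k / 2 ^ n)"
    unfolding sum_distrib_left by (intro sum.cong refl) (simp add: power2_eq_square)
  also have "\<dots> \<le> \<rho>\<^sup>2 * ?c / real n * 3"
  proof (rule mult_left_mono)
    have "(\<Sum>k<n. (2::real) ^ k) = 2 ^ n - 1" by (induction n) auto
    then have "(\<Sum>k<n. (2::real) ^ k / 2 ^ n) \<le> 1"
      by (simp add: sum_divide_distrib[symmetric])
    then show "(\<Sum>k<n. 2 / real n + 2 ^ k / 2 ^ n) \<le> 3"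
      using n by (simp add: sum.distrib)
  qed (use c in simp)
  finally show ?thesis by (simp add: ennreal_leI mult_ac)
qed

end

subsection \<open>Choice of signs\<close>

lemma signs_quadratic_form:
  fixes a :: "'i \<Rightarrow> 'i \<Rightarrow> real"
  assumes "finite I"
  obtains \<epsilon> :: "'i \<Rightarrow> real" where "\<And>i. \<epsilon> i = 1 \<or> \<epsilon> i = - 1"
    "(\<Sum>i\<in>I. a i i) \<le> (\<Sum>i\<in>I. \<Sum>j\<in>I. \<epsilon> i * \<epsilon> j * a i j)"
proof -
  have "\<exists>\<epsilon> :: 'i \<Rightarrow> real. (\<forall>i. \<epsilon> i = 1 \<or> \<epsilon> i = - 1) \<and>
    (\<Sum>i\<in>I. a i i) \<le> (\<Sum>i\<in>I. \<Sum>j\<in>I. \<epsilon> i * \<epsilon> j * a i j)"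
    using assms
  proof induction
    case empty
    show ?case by (rule exI[of _ "\<lambda>_. 1"]) simp
  next
    case (insert k I)
    then obtain \<epsilon> :: "'i \<Rightarrow> real" where \<epsilon>: "\<And>i. \<epsilon> i = 1 \<or> \<epsilon> i = - 1"
      "(\<Sum>i\<in>I. a i i) \<le> (\<Sum>i\<in>I. \<Sum>j\<in>I. \<epsilon> i * \<epsilon> j * a i j)" by blast
    let ?L = "(\<Sum>j\<in>I. \<epsilon> j * a k j) + (\<Sum>i\<in>I. \<epsilon> i * a i k)"
    define s :: real where "s = (if ?L \<ge> 0 then 1 else - 1)"
    have s: "s = 1 \<or> s = - 1" "s * s = 1" "s * ?L \<ge> 0" by (auto simp: s_def)
    define \<epsilon>' where "\<epsilon>' = \<epsilon>(k := s)"
    have eq: "\<epsilon>' i = \<epsilon> i" if "i \<in> I" for i using that insert(2) by (auto simp: \<epsilon>'_def)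
    have k: "\<epsilon>' k = s" by (simp add: \<epsilon>'_def)
    have "(\<Sum>i\<in>insert k I. \<Sum>j\<in>insert k I. \<epsilon>' i * \<epsilon>' j * a i j)
      = s * s * a k k + (\<Sum>j\<in>I. s * \<epsilon> j * a k j) + (\<Sum>i\<in>I. \<epsilon> i * s * a i k + (\<Sum>j\<in>I. \<epsilon> i * \<epsilon> j * a i j))"
      using insert(1,2) by (simp add: k eq cong: sum.cong)
    also have "\<dots> = a k k + s * ?L + (\<Sum>i\<in>I. \<Sum>j\<in>I. \<epsilon> i * \<epsilon> j * a i j)"
      by (simp add: s(2) sum.distrib sum_distrib_left distrib_left mult_ac)
    finally have "(\<Sum>i\<in>insert k I. a i i) \<le> (\<Sum>i\<in>insert k I. \<Sum>j\<in>insert k I. \<epsilon>' i * \<epsilon>' j * a i j)"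
      using insert(1,2) \<epsilon>(2) s(3) by simp
    moreover have "\<forall>i. \<epsilon>' i = 1 \<or> \<epsilon>' i = - 1" using \<epsilon>(1) s(1) by (auto simp: \<epsilon>'_def)
    ultimately show ?case by blast
  qed
  then show ?thesis using that by blast
qed

subsection \<open>Pairings of modulated planks\<close>

lemma integral_double_sum:
  fixes h :: "'i \<Rightarrow> 'i \<Rightarrow> 'a \<Rightarrow> complex"
  assumes int: "\<And>i j. i \<in> I \<Longrightarrow> j \<in> I \<Longrightarrow> integrable M (h i j)"
  shows "(LINT x|M. (\<Sum>i\<in>I. \<Sum>j\<in>I. c i j * h i j x)) = (\<Sum>i\<in>I. \<Sum>j\<in>I. c i j * (LINT x|M. h i j x))"
proof -
  have "(LINT x|M. (\<Sum>i\<in>I. \<Sum>j\<in>I. c i j * h i j x)) = (\<Sum>i\<in>I. LINT x|M. (\<Sum>j\<in>I. c i j * h i j x))"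
    by (rule Bochner_Integration.integral_sum) (auto intro!: Bochner_Integration.integrable_sum int)
  also have "\<dots> = (\<Sum>i\<in>I. \<Sum>j\<in>I. LINT x|M. c i j * h i j x)"
    by (intro sum.cong refl Bochner_Integration.integral_sum) (auto intro!: int)
  finally show ?thesis by (simp only: integral_mult_right_zero)
qed

lemma fourier_sum:
  fixes f :: "'i \<Rightarrow> 'a::euclidean_space \<Rightarrow> complex"
  assumes "\<And>i. i \<in> I \<Longrightarrow> integrable lborel (f i)"
  shows "fourier (\<lambda>x. \<Sum>i\<in>I. c i * f i x) \<xi> = (\<Sum>i\<in>I. c i * fourier (f i) \<xi>)"
proof -
  have int: "integrable lborel (\<lambda>y. f i y * wave (y \<bullet> \<xi>))" if "i \<in> I" for i
    by (rule integrable_mult_unimodular[OF assms[OF that]]) (auto simp: norm_wave)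
  then show ?thesis
    unfolding fourier_wave sum_distrib_right mult.assoc
    by (subst Bochner_Integration.integral_sum) (simp_all only: integrable_mult_right integral_mult_right_zero)
qed

definition cone_form :: "(real \<times> (real ^ 'n) \<Rightarrow> complex) \<Rightarrow> (real \<times> (real ^ 'n) \<Rightarrow> complex) \<Rightarrow> real" where
  "cone_form f g = Re (LINT \<xi>:forward_cone|lborel. fourier f \<xi> * cnj (fourier g \<xi>))"

lemma cone_form_commute: "cone_form f g = cone_form g f"
proof -
  have "(LINT \<xi>:forward_cone|lborel. fourier g \<xi> * cnj (fourier f \<xi>)) = cnj (LINT \<xi>:forward_cone|lborel. fourier f \<xi> * cnj (fourier g \<xi>))"
    unfolding set_lebesgue_integral_def Bochner_Integration.integral_cnj[symmetric]
    by (simp add: mult.commute)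
  then show ?thesis by (simp add: cone_form_def)
qed

lemma cone_form_sum:
  fixes f g :: "'i \<Rightarrow> real \<times> (real ^ 'n) \<Rightarrow> complex" and c :: "'i \<Rightarrow> real"
  assumes f: "\<And>i. i \<in> I \<Longrightarrow> f i \<in> test_fns B" and g: "\<And>i. i \<in> I \<Longrightarrow> g i \<in> test_fns B"
  shows "cone_form (\<lambda>x. \<Sum>i\<in>I. c i * f i x) (\<lambda>x. \<Sum>i\<in>I. c i * g i x) = (\<Sum>i\<in>I. \<Sum>j\<in>I. c i * c j * cone_form (f i) (g j))"
proof -
  let ?h = "\<lambda>i j \<xi>. indicator forward_cone \<xi> *\<^sub>R (fourier (f i) \<xi> * cnj (fourier (g j) \<xi>))"
  have int: "integrable lborel (?h i j)" if "i \<in> I" "j \<in> I" for i j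
    using that by (intro integrable_mult_indicator fourier_product_integrable[OF f g]) auto
  have F: "fourier (\<lambda>x. \<Sum>i\<in>I. c i * f i x) \<xi> = (\<Sum>i\<in>I. c i * fourier (f i) \<xi>)"
    "fourier (\<lambda>x. \<Sum>i\<in>I. c i * g i x) \<xi> = (\<Sum>i\<in>I. c i * fourier (g i) \<xi>)" for \<xi>
    using f g by (auto intro!: fourier_sum test_fn_integrable)
  have "cone_form (\<lambda>x. \<Sum>i\<in>I. c i * f i x) (\<lambda>x. \<Sum>i\<in>I. c i * g i x)
    = Re (LINT \<xi>|lborel. (\<Sum>i\<in>I. \<Sum>j\<in>I. complex_of_real (c i * c j) * ?h i j \<xi>))"
    unfolding cone_form_def set_lebesgue_integral_def F
    by (simp add: sum_product scaleR_sum_right mult_ac)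
  also have "\<dots> = Re (\<Sum>i\<in>I. \<Sum>j\<in>I. complex_of_real (c i * c j) * (LINT \<xi>|lborel. ?h i j \<xi>))"
    by (subst integral_double_sum[OF int]) simp_all
  also have "\<dots> = (\<Sum>i\<in>I. \<Sum>j\<in>I. c i * c j * cone_form (f i) (g j))"
    by (simp add: cone_form_def set_lebesgue_integral_def)
  finally show ?thesis .
qed

definition L2_form :: "('a::euclidean_space \<Rightarrow> complex) \<Rightarrow> ('a \<Rightarrow> complex) \<Rightarrow> real" where
  "L2_form f g = Re (LINT x|lborel. f x * cnj (g x))"

lemma smooth_cnj: "smooth f \<Longrightarrow> smooth (\<lambda>x. cnj (f x))"
  by (rule smooth_bounded_linear_comp[OF bounded_linear_cnj])

lemma product_integrable:
  fixes f g :: "'a::euclidean_space \<Rightarrow> complex"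
  assumes "f \<in> test_fns U" "g \<in> test_fns V"
  shows "integrable lborel (\<lambda>x. f x * cnj (g x))"
  by (rule test_fn_integrable[of _ U], rule test_fn_mult(1)[OF assms(1)],
      rule smooth_cnj, rule test_fn_smooth[OF assms(2)])

lemma L2_form_self:
  fixes f :: "'a::euclidean_space \<Rightarrow> complex"
  assumes f: "f \<in> test_fns U"
  shows "L2_form f f = (LINT x|lborel. (norm (f x))\<^sup>2)" "integrable lborel (\<lambda>x. (norm (f x))\<^sup>2)"
proof -
  show "L2_form f f = (LINT x|lborel. (norm (f x))\<^sup>2)"
    unfolding L2_form_def complex_norm_square[symmetric] integral_complex_of_real by (rule Re_complex_of_real)
  show "integrable lborel (\<lambda>x. (norm (f x))\<^sup>2)"
    using integrable_Re[OF product_integrable[OF f f]] unfolding complex_norm_square[symmetric] by simp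
qed

lemma L2_form_sum:
  fixes f g :: "'i \<Rightarrow> 'a::euclidean_space \<Rightarrow> complex" and c :: "'i \<Rightarrow> real"
  assumes f: "\<And>i. i \<in> I \<Longrightarrow> f i \<in> test_fns B" and g: "\<And>i. i \<in> I \<Longrightarrow> g i \<in> test_fns B"
  shows "L2_form (\<lambda>x. \<Sum>i\<in>I. c i * f i x) (\<lambda>x. \<Sum>i\<in>I. c i * g i x) = (\<Sum>i\<in>I. \<Sum>j\<in>I. c i * c j * L2_form (f i) (g j))"
proof -
  let ?h = "\<lambda>i j x. f i x * cnj (g j x)"
  have int: "integrable lborel (?h i j)" if "i \<in> I" "j \<in> I" for i j
    using that by (intro product_integrable[OF f g])
  have "L2_form (\<lambda>x. \<Sum>i\<in>I. c i * f i x) (\<lambda>x. \<Sum>i\<in>I. c i * g i x)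
    = Re (LINT x|lborel. (\<Sum>i\<in>I. \<Sum>j\<in>I. complex_of_real (c i * c j) * ?h i j x))"
    unfolding L2_form_def by (simp add: sum_product mult_ac)
  also have "\<dots> = Re (\<Sum>i\<in>I. \<Sum>j\<in>I. complex_of_real (c i * c j) * (LINT x|lborel. ?h i j x))"
    by (subst integral_double_sum[OF int]) simp_all
  also have "\<dots> = (\<Sum>i\<in>I. \<Sum>j\<in>I. c i * c j * L2_form (f i) (g j))"
    by (simp add: L2_form_def)
  finally show ?thesis .
qed

context planks
begin

lemma
  shows \<alpha>_test: "(\<lambda>t. complex_of_real (\<alpha> t)) \<in> test_fns UNIV"
    and \<beta>_test: "(\<lambda>t. complex_of_real (\<beta> t)) \<in> test_fns UNIV"
    and bump_test: "bump \<in> test_fns UNIV"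
    and plate_test: "plate n A \<in> test_fns UNIV"
proof -
  show "(\<lambda>t. complex_of_real (\<alpha> t)) \<in> test_fns UNIV"
  proof (rule test_fnI[where K = "{2 * \<rho>..3 * \<rho>}"])
    show "smooth (\<lambda>t. complex_of_real (\<alpha> t))" unfolding \<alpha>_def by (intro smooth_intros)
  qed (use \<alpha>_props(3) in \<open>auto intro: less_imp_le\<close>)
  show "(\<lambda>t. complex_of_real (\<beta> t)) \<in> test_fns UNIV"
  proof (rule test_fnI[where K = "{0..\<rho>}"])
    show "smooth (\<lambda>t. complex_of_real (\<beta> t))" unfolding \<beta>_def by (intro smooth_intros)
  qed (use \<beta>_props(3) in \<open>auto intro: less_imp_le\<close>)
  show "bump \<in> test_fns UNIV"
  proof (rule test_fnI[where K = "cball 0 (\<rho> / 2)"])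
    show "smooth bump" unfolding bump_def[abs_def] by (intro smooth_intros)
  qed (simp_all add: bump_props)
  show "plate n A \<in> test_fns UNIV"
  proof (rule test_fnI[where K = "cball ((\<rho> * digit_line n A 0) *\<^sub>R axis i2 1) (\<rho> / 2)"])
    show "smooth (plate n A)"
      unfolding plate_def[abs_def] bump_def
      by (intro smooth_intros smooth_bounded_linear_comp[OF bounded_linear_dil])
    show "y \<in> cball ((\<rho> * digit_line n A 0) *\<^sub>R axis i2 1) (\<rho> / 2)" if "plate n A y \<noteq> 0" for y
      using plate_support(2)[OF that] by (simp add: dist_norm norm_minus_commute)
  qed simp_all
qed

definition "halfline = (LINT s:{0<..}|lborel. fourier (\<lambda>t. complex_of_real (\<alpha> t)) s * cnj (fourier (\<lambda>t. complex_of_real (\<beta> t)) s))"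
definition "bump_energy = (LINT \<eta>|lborel. (norm (fourier bump \<eta>))\<^sup>2)"

lemma real_test_integrable:
  fixes a :: "real \<Rightarrow> real"
  assumes "(\<lambda>t. complex_of_real (a t)) \<in> test_fns UNIV"
  shows "integrable lborel a" "continuous_on UNIV a"
  using integrable_Re[OF test_fn_integrable[OF assms]]
    continuous_on_Re[OF smooth_continuous_on[OF test_fn_smooth[OF assms], of UNIV]] by simp_all

lemma Im_halfline_neg: "Im halfline < 0"
proof -
  have a: "(LINT x|lborel. \<alpha> x) > 0"
    by (rule integral_pos_continuous[OF real_test_integrable[OF \<alpha>_test] \<alpha>_props(1), of "5 / 2 * \<rho>"])
       (use \<rho> in \<open>simp add: \<alpha>_def flat_exp_pos_iff zero_less_mult_iff field_simps\<close>)
  have b: "(LINT x|lborel. \<beta> x) > 0"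
    by (rule integral_pos_continuous[OF real_test_integrable[OF \<beta>_test] \<beta>_props(1), of "1 / 2 * \<rho>"])
       (use \<rho> in \<open>simp add: \<beta>_def flat_exp_pos_iff zero_less_mult_iff field_simps\<close>)
  have "Im halfline \<le> - ((LINT x|lborel. \<alpha> x) * (LINT x|lborel. \<beta> x) / (20 * pi * \<rho>))"
    unfolding halfline_def
  proof (rule halfline_form_Im_le)
    show "\<rho> \<le> x - y \<and> x - y \<le> 3 * \<rho>" if "\<alpha> x \<noteq> 0" "\<beta> y \<noteq> 0" for x y
      using \<alpha>_props(3)[OF that(1)] \<beta>_props(3)[OF that(2)] by simp
    show "integrable lborel (\<lambda>s. fourier (\<lambda>x. complex_of_real (\<alpha> x)) s * cnj (fourier (\<lambda>x. complex_of_real (\<beta> x)) s))"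
      by (rule fourier_product_integrable[OF \<alpha>_test \<beta>_test])
  qed (use \<rho> \<alpha>_props \<beta>_props real_test_integrable[OF \<alpha>_test] real_test_integrable[OF \<beta>_test] in auto)
  also have "\<dots> < 0" using a b \<rho> by simp
  finally show ?thesis .
qed

lemma bump_energy_pos: "bump_energy > 0"
  unfolding bump_energy_def
proof (rule integral_pos_continuous)
  have int: "integrable lborel bump" by (rule test_fn_integrable[OF bump_test])
  show "continuous_on UNIV (\<lambda>\<eta>. (norm (fourier bump \<eta>))\<^sup>2)"
    by (intro continuous_intros continuous_on_fourier[OF int])
  show "integrable lborel (\<lambda>\<eta>. (norm (fourier bump \<eta>))\<^sup>2)"
    using integrable_Re[OF fourier_product_integrable[OF bump_test bump_test]]
    unfolding complex_norm_square[symmetric] by simp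
  have "(LINT y|lborel. Re (bump y)) > 0"
  proof (rule integral_pos_continuous)
    show "integrable lborel (\<lambda>y. Re (bump y))" by (rule integrable_Re[OF int])
    show "continuous_on UNIV (\<lambda>y. Re (bump y))"
      by (intro continuous_on_Re smooth_continuous_on test_fn_smooth[OF bump_test])
    show "Re (bump 0) > 0" using \<rho> by (simp add: bump_def flat_exp_pos_iff)
  qed (simp add: bump_def flat_exp_nonneg)
  then have "Re (fourier bump 0) > 0" using integral_Re[OF int] by (simp add: fourier_def)
  then show "(norm (fourier bump 0))\<^sup>2 > 0" by auto
qed simp

definition "late_mod k n A z = exp (2 * pi * \<i> * complex_of_real (z \<bullet> (real k *\<^sub>R (1, light A)))) * late n A z"
definition "early_mod k n A z = - \<i> * (exp (2 * pi * \<i> * complex_of_real (z \<bullet> (real k *\<^sub>R (1, light A)))) * early n A z)"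

lemma late_mod_test: "A \<subseteq> {1..n} \<Longrightarrow> late_mod k n A \<in> test_fns (ball 0 (10 * \<rho>))"
  unfolding late_mod_def[abs_def]
  by (intro test_fn_mult(2) late_test smooth_intros)

lemma early_mod_test: "A \<subseteq> {1..n} \<Longrightarrow> early_mod k n A \<in> test_fns (ball 0 (10 * \<rho>))"
  unfolding early_mod_def[abs_def]
  by (intro test_fn_mult(2) early_test smooth_intros)

lemma norm_late_mod: "norm (late_mod k n A z) = norm (late n A z)"
  and norm_early_mod: "norm (early_mod k n A z) = norm (early n A z)"
  by (simp_all add: late_mod_def early_mod_def norm_mult)

lemma cone_form_modulated_limit:
  assumes A: "A \<subseteq> {1..n}"
  shows "(\<lambda>k. cone_form (late_mod k n A) (early_mod k n A)) \<longlonglongrightarrow> - Im halfline * bump_energy / 2 ^ n"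
proof -
  define F where "F = (\<lambda>\<xi>. fourier (late n A) \<xi> * cnj (fourier (early n A) \<xi>))"
  have F: "integrable lborel F" unfolding F_def
    by (rule fourier_product_integrable[OF late_test[OF A] early_test[OF A]])
  have fe: "fourier (early_mod k n A) \<xi> = - \<i> * fourier (early n A) (\<xi> - real k *\<^sub>R (1, light A))" for k \<xi>
  proof -
    have "fourier (early_mod k n A) \<xi> = - \<i> * fourier (\<lambda>z. exp (2 * pi * \<i> * complex_of_real (z \<bullet> (real k *\<^sub>R (1, light A)))) * early n A z) \<xi>"
      unfolding fourier_def early_mod_def by (simp only: mult.assoc integral_mult_right_zero)
    then show ?thesis by (simp only: fourier_modulate)
  qed
  have fl: "fourier (late_mod k n A) \<xi> = fourier (late n A) (\<xi> - real k *\<^sub>R (1, light A))" for k \<xi>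
    unfolding late_mod_def[abs_def] by (rule fourier_modulate)
  have "fourier (late_mod k n A) \<xi> * cnj (fourier (early_mod k n A) \<xi>) = \<i> * F (\<xi> - real k *\<^sub>R (1, light A))" for k \<xi>
    unfolding fe fl F_def by simp
  then have cf: "cone_form (late_mod k n A) (early_mod k n A) = Re (\<i> * (LINT \<xi>:forward_cone|lborel. F (\<xi> - real k *\<^sub>R (1, light A))))" for k
    unfolding cone_form_def by (simp only: set_integral_mult_right)
  have "(LINT \<xi>:{z. light A \<bullet> snd z < fst z}|lborel. F \<xi>) = halfline * complex_of_real (LINT \<eta>|lborel. (norm (fourier (plate n A) \<eta>))\<^sup>2)"
    using halfspace_form_sheared_product[OF \<alpha>_test \<beta>_test plate_test, of "light A" n A]
    unfolding F_def late_def[abs_def] early_def[abs_def] halfline_def .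
  also have "(LINT \<eta>|lborel. (norm (fourier (plate n A) \<eta>))\<^sup>2) = 1 / 2 ^ n * bump_energy"
    using fourier_L2_dil[where c = "squeeze n" and t = "(\<rho> * digit_line n A 0) *\<^sub>R axis i2 1", OF test_fn_integrable[OF bump_test] squeeze_pos]
    unfolding prod_squeeze plate_def[abs_def] bump_energy_def .
  finally have lim: "(LINT \<xi>:{z. light A \<bullet> snd z < fst z}|lborel. F \<xi>) = halfline * complex_of_real (1 / 2 ^ n * bump_energy)" .
  have "(\<lambda>k. Re (\<i> * (LINT \<xi>:forward_cone|lborel. F (\<xi> - real k *\<^sub>R (1, light A))))) \<longlonglongrightarrow> Re (\<i> * (halfline * complex_of_real (1 / 2 ^ n * bump_energy)))"
    unfolding lim[symmetric]
    by (intro tendsto_Re tendsto_mult_left cone_blowup_limit[OF F norm_light[OF A]])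
  then show ?thesis unfolding cf by simp
qed

definition "gain = - Im halfline * bump_energy / 2"

lemma gain_pos: "gain > 0"
  using Im_halfline_neg bump_energy_pos by (simp add: gain_def mult_neg_pos)

lemma ex_modulation:
  assumes A: "A \<subseteq> {1..n}"
  shows "\<exists>k. cone_form (late_mod k n A) (early_mod k n A) \<ge> gain / 2 ^ n"
proof -
  have "gain / 2 ^ n < - Im halfline * bump_energy / 2 ^ n"
  proof (rule divide_strict_right_mono)
    show "gain < - Im halfline * bump_energy" using gain_pos by (simp add: gain_def)
  qed simp
  from order_tendstoD(1)[OF cone_form_modulated_limit[OF A] this]
  obtain k where "gain / 2 ^ n < cone_form (late_mod k n A) (early_mod k n A)"
    by (auto simp: eventually_sequentially)
  then show ?thesis by (auto intro: less_imp_le)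
qed

definition "mass = (LINT t|lborel. (\<beta> t)\<^sup>2) * (LINT y|lborel. (norm (bump y))\<^sup>2)"

lemma mass_nonneg: "mass \<ge> 0"
  by (simp add: mass_def)

lemma L2_early_mod:
  assumes A: "A \<subseteq> {1..n}"
  shows "L2_form (early_mod k n A) (early_mod k n A) = mass / 2 ^ n"
proof -
  have b: "integrable lborel (\<lambda>t. (\<beta> t)\<^sup>2)"
    using L2_form_self(2)[OF \<beta>_test] by simp
  have p: "integrable lborel (\<lambda>y. (norm (plate n A y))\<^sup>2)" by (rule L2_form_self(2)[OF plate_test])
  define h where "h = (\<lambda>(t, y). (\<beta> t)\<^sup>2 * (norm (plate n A y))\<^sup>2)"
  have h: "integrable lborel h" unfolding h_def by (rule integrable_tensor(1)[OF b p])
  have "L2_form (early_mod k n A) (early_mod k n A) = (LINT z|lborel. (norm (early n A z))\<^sup>2)"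
    unfolding L2_form_self(1)[OF early_mod_test[OF A]] norm_early_mod ..
  also have "\<dots> = (LINT z|lborel. h (fst z, snd z + fst z *\<^sub>R light A))"
    by (simp add: early_def h_def norm_mult power_mult_distrib)
  also have "\<dots> = (LINT z|lborel. h z)" using h by (intro integral_shear_snd) auto
  also have "\<dots> = (LINT t|lborel. (\<beta> t)\<^sup>2) * (LINT y|lborel. (norm (plate n A y))\<^sup>2)"
    unfolding h_def by (rule integrable_tensor(2)[OF b p])
  also have "(LINT y|lborel. (norm (plate n A y))\<^sup>2) = 1 / 2 ^ n * (LINT y|lborel. (norm (bump y))\<^sup>2)"
    using L2_dil[where c = "squeeze n" and t = "(\<rho> * digit_line n A 0) *\<^sub>R axis i2 1", OF test_fn_integrable[OF bump_test] squeeze_pos]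
    unfolding prod_squeeze plate_def[abs_def] .
  finally show ?thesis by (simp add: mass_def)
qed

end

context planks
begin

lemma ex_test_pair:
  defines "s \<equiv> gain / (2 * (mass + 1))"
  shows "\<exists>f g. f \<in> test_fns (ball 0 (10 * \<rho>)) \<and> g \<in> test_fns (ball 0 (10 * \<rho>)) \<and>
    (\<forall>x. norm (f x) \<le> 1) \<and> {x. g x \<noteq> 0} \<subseteq> early_set n \<and> gain / 2 + s * L2_form g g \<le> cone_form f g"
proof -
  define I where "I = Pow {1..n}"
  have I: "finite I" "card I = 2 ^ n" "\<And>A. A \<in> I \<Longrightarrow> A \<subseteq> {1..n}" by (auto simp: I_def card_Pow)
  have "\<forall>A\<in>I. \<exists>k. gain / 2 ^ n \<le> cone_form (late_mod k n A) (early_mod k n A)"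
    using ex_modulation[of _ n] I(3) by blast
  then obtain k where k: "\<And>A. A \<in> I \<Longrightarrow> gain / 2 ^ n \<le> cone_form (late_mod (k A) n A) (early_mod (k A) n A)"
    by metis
  define l where "l = (\<lambda>A. late_mod (k A) n A)"
  define e where "e = (\<lambda>A. early_mod (k A) n A)"
  have l: "A \<in> I \<Longrightarrow> l A \<in> test_fns (ball 0 (10 * \<rho>))"
    and e: "A \<in> I \<Longrightarrow> e A \<in> test_fns (ball 0 (10 * \<rho>))" for A
    unfolding l_def e_def using late_mod_test early_mod_test I(3) by blast+
  obtain \<epsilon> :: "nat set \<Rightarrow> real" where \<epsilon>: "\<And>A. \<epsilon> A = 1 \<or> \<epsilon> A = - 1"
    "(\<Sum>A\<in>I. cone_form (l A) (e A) - s * L2_form (e A) (e A))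
      \<le> (\<Sum>A\<in>I. \<Sum>B\<in>I. \<epsilon> A * \<epsilon> B * (cone_form (l A) (e B) - s * L2_form (e A) (e B)))"
    using signs_quadratic_form[OF I(1), of "\<lambda>A B. cone_form (l A) (e B) - s * L2_form (e A) (e B)"] by blast
  define f where "f = (\<lambda>x. \<Sum>A\<in>I. complex_of_real (\<epsilon> A) * l A x)"
  define g where "g = (\<lambda>x. \<Sum>A\<in>I. complex_of_real (\<epsilon> A) * e A x)"
  have f: "f \<in> test_fns (ball 0 (10 * \<rho>))" and g: "g \<in> test_fns (ball 0 (10 * \<rho>))"
    unfolding f_def g_def
    by (intro test_fn_sum test_fn_mult(2) l e smooth_const; assumption)+
  have "norm (f x) \<le> 1" for x
  proof (cases "\<exists>A\<in>I. l A x \<noteq> 0")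
    case True
    then obtain A where A: "A \<in> I" "l A x \<noteq> 0" by blast
    have "l B x = 0" if "B \<in> I - {A}" for B
    proof -
      have "late n A x \<noteq> 0" using A(2) norm_late_mod[of "k A" n A x] by (auto simp: l_def)
      then have "late n B x = 0" using late_disjoint[OF I(3)[OF A(1)] I(3)[of B], of x] that by auto
      then show ?thesis using norm_late_mod[of "k B" n B x] by (simp add: l_def)
    qed
    then have "f x = complex_of_real (\<epsilon> A) * l A x"
      unfolding f_def using A(1) I(1) by (subst sum.remove[of _ A]) auto
    then have "norm (f x) = norm (l A x)" using \<epsilon>(1)[of A] by (auto simp: norm_mult)
    then show ?thesis using norm_late_le[of n A x] by (simp add: l_def norm_late_mod)
  next
    case False
    then show ?thesis by (simp add: f_def)
  qed
  moreover have "x \<in> early_set n" if "g x \<noteq> 0" for x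
  proof (rule ccontr)
    assume "x \<notin> early_set n"
    then have "early n A x = 0" if "A \<in> I" for A using that by (auto simp: early_set_def I_def)
    then have "e A x = 0" if "A \<in> I" for A using that norm_early_mod[of "k A" n A x] by (simp add: e_def)
    then show False using \<open>g x \<noteq> 0\<close> by (simp add: g_def)
  qed
  moreover have "gain / 2 + s * L2_form g g \<le> cone_form f g"
  proof -
    have "s * mass \<le> gain / 2"
    proof -
      have "s * mass = gain / 2 * (mass / (mass + 1))" by (simp add: s_def)
      also have "\<dots> \<le> gain / 2 * 1"
        using mass_nonneg gain_pos by (intro mult_left_mono) auto
      finally show ?thesis by simp
    qed
    then have "gain / 2 \<le> gain - s * mass" by simp
    also have "\<dots> = (\<Sum>A\<in>I. gain / 2 ^ n - s * (mass / 2 ^ n))"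
      using I(2) by (simp add: right_diff_distrib)
    also have "\<dots> \<le> (\<Sum>A\<in>I. cone_form (l A) (e A) - s * L2_form (e A) (e A))"
    proof (rule sum_mono)
      fix A assume "A \<in> I"
      then show "gain / 2 ^ n - s * (mass / 2 ^ n) \<le> cone_form (l A) (e A) - s * L2_form (e A) (e A)"
        using k[of A] L2_early_mod[OF I(3), of A "k A"] by (simp add: l_def e_def)
    qed
    also note \<epsilon>(2)
    also have "(\<Sum>A\<in>I. \<Sum>B\<in>I. \<epsilon> A * \<epsilon> B * (cone_form (l A) (e B) - s * L2_form (e A) (e B)))
      = (\<Sum>A\<in>I. \<Sum>B\<in>I. \<epsilon> A * \<epsilon> B * cone_form (l A) (e B)) - s * (\<Sum>A\<in>I. \<Sum>B\<in>I. \<epsilon> A * \<epsilon> B * L2_form (e A) (e B))"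
      by (simp add: sum_subtractf right_diff_distrib sum_distrib_left mult_ac)
    also have "\<dots> = cone_form f g - s * L2_form g g"
      unfolding f_def g_def by (simp add: cone_form_sum[OF l e] L2_form_sum[OF e e])
    finally show ?thesis by simp
  qed
  ultimately show ?thesis using f g by blast
qed

end

lemma cone_form_eq_integral:
  assumes "f \<in> test_fns U" "g \<in> test_fns V"
  shows "cone_form f g = Re (LINT x|lborel. cone_multiplier f x * cnj (g x))"
  by (simp only: cone_form_def cone_multiplier_Parseval(1)[OF assms])

lemma cone_form_scale_right: "cone_form f (\<lambda>x. complex_of_real r * g x) = r * cone_form f g"
proof -
  have F: "fourier (\<lambda>x. complex_of_real r * g x) \<xi> = complex_of_real r * fourier g \<xi>" for \<xi>
    unfolding fourier_def by (simp only: mult.assoc integral_mult_right_zero)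
  have "(LINT \<xi>:forward_cone|lborel. fourier f \<xi> * cnj (complex_of_real r * fourier g \<xi>))
     = (LINT \<xi>:forward_cone|lborel. complex_of_real r * (fourier f \<xi> * cnj (fourier g \<xi>)))"
    unfolding set_lebesgue_integral_def by (rule Bochner_Integration.integral_cong) (simp_all add: mult_ac)
  then show ?thesis
    unfolding cone_form_def F by (simp only: set_integral_mult_right) simp
qed

definition concentrated :: "(real \<times> (real ^ 'n)) set \<Rightarrow> real \<Rightarrow> real \<Rightarrow> (real \<times> (real ^ 'n) \<Rightarrow> complex) \<Rightarrow>
    (real \<times> (real ^ 'n) \<Rightarrow> complex) \<Rightarrow> (real \<times> (real ^ 'n)) set \<Rightarrow> bool" where
  "concentrated B c \<delta> f g E \<longleftrightarrow> f \<in> test_fns B \<and> g \<in> test_fns B \<and>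
      (\<forall>x. norm (f x) \<le> 1) \<and> E \<in> sets borel \<and> E \<subseteq> B \<and> emeasure lborel E \<le> ennreal \<delta> \<and> (\<forall>x. x \<notin> E \<longrightarrow> g x = 0) \<and>
      energy g \<le> 1 \<and> c \<le> cone_form f g"

proposition ex_concentrated_test_functions:
  assumes card: "CARD('n::finite) \<ge> 2" and r: "r > 0"
  obtains c where "c > 0"
    "\<And>\<delta>. \<delta> > 0 \<Longrightarrow> \<exists>f g E. concentrated (ball (0 :: real \<times> (real ^ 'n)) r) c \<delta> f g E"
proof -
  obtain i1 i2 :: 'n where "i1 \<noteq> i2"
    using card card_le_Suc0_iff_eq[of "UNIV :: 'n set"] by fastforce
  define \<rho> where "\<rho> = r / 10"
  interpret planks \<rho> i1 i2
    by unfold_locales (use r \<open>i1 \<noteq> i2\<close> in \<open>auto simp: \<rho>_def\<close>)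
  have r10: "10 * \<rho> = r" by (simp add: \<rho>_def)
  define s where "s = gain / (2 * (mass + 1))"
  have s: "s > 0" using gain_pos mass_nonneg by (simp add: s_def)
  define c where "c = 2 * sqrt (gain / 2) * sqrt s"
  show ?thesis
  proof (rule that[of c])
    show "c > 0" using gain_pos s by (simp add: c_def)
    fix \<delta> :: real assume \<delta>: "\<delta> > 0"
    define M where "M = 3 * \<rho>\<^sup>2 * (10 * \<rho>) ^ (CARD('n) - 1)"
    obtain n where n: "n > 0" "M / real n \<le> \<delta>"
    proof -
      obtain m where "M / \<delta> < real m" using reals_Archimedean2 by blast
      then have "M < real (Suc m) * \<delta>" using \<delta> by (simp add: field_simps)
      then show ?thesis using that[of "Suc m"] by (simp add: field_simps)
    qed
    obtain f g where f: "f \<in> test_fns (ball 0 r)" and g: "g \<in> test_fns (ball 0 r)"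
      and f1: "\<And>x. norm (f x) \<le> 1" and gE: "{x. g x \<noteq> 0} \<subseteq> early_set n"
      and gain: "gain / 2 + s * L2_form g g \<le> cone_form f g"
      using ex_test_pair[of n] unfolding r10 s_def by blast
    define N where "N = sqrt (L2_form g g)"
    have L2: "L2_form g g = (LINT x|lborel. (norm (g x))\<^sup>2)" "integrable lborel (\<lambda>x. (norm (g x))\<^sup>2)"
      by (rule L2_form_self[OF g])+
    have L0: "L2_form g g \<ge> 0" unfolding L2(1) by (rule integral_nonneg_AE) simp
    have N2: "N\<^sup>2 = L2_form g g" using L0 by (simp add: N_def)
    have "L2_form g g \<noteq> 0"
    proof
      assume "L2_form g g = 0"
      then have "AE x in lborel. (norm (g x))\<^sup>2 = 0"
        unfolding L2(1) using integral_nonneg_eq_0_iff_AE[OF L2(2)] by simp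
      then have "AE x in lborel. cone_multiplier f x * cnj (g x) = 0" by (auto elim: eventually_mono)
      then have "(LINT x|lborel. cone_multiplier f x * cnj (g x)) = 0" by (rule integral_eq_zero_AE)
      then have "cone_form f g = 0" by (simp add: cone_form_eq_integral[OF f g])
      then show False using gain gain_pos s L0 by (smt (verit) mult_nonneg_nonneg half_gt_zero)
    qed
    then have N: "N > 0" using L0 by (simp add: N_def)
    let ?g = "\<lambda>x. complex_of_real (1 / N) * g x"
    have "c * N \<le> gain / 2 + s * N\<^sup>2"
    proof -
      have "0 \<le> (sqrt (gain / 2) - sqrt s * N)\<^sup>2" by simp
      also have "\<dots> = gain / 2 + s * N\<^sup>2 - c * N"
        using gain_pos s by (simp add: power2_diff power_mult_distrib c_def)
      finally show ?thesis by simp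
    qed
    then have "c * N \<le> cone_form f g" using gain by (simp add: N2)
    then have "c \<le> cone_form f ?g"
      unfolding cone_form_scale_right using N by (simp add: field_simps)
    moreover have "energy ?g \<le> 1"
    proof -
      have "(norm (?g x))\<^sup>2 = 1 / N\<^sup>2 * (norm (g x))\<^sup>2" for x
        using N by (simp add: norm_mult power_mult_distrib norm_divide power_divide)
      then have "energy ?g = ennreal (LINT x|lborel. 1 / N\<^sup>2 * (norm (g x))\<^sup>2)"
        using L2(2) by (simp only:) (rule nn_integral_eq_integral, auto)
      also have "(LINT x|lborel. 1 / N\<^sup>2 * (norm (g x))\<^sup>2) = 1"
        using N by (simp only: integral_mult_right_zero L2(1)[symmetric] N2[symmetric]) simp
      finally show ?thesis by simp
    qed
    moreover have "?g \<in> test_fns (ball 0 r)"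
      by (intro test_fn_mult(2) g smooth_const)
    moreover have "early_set n \<inter> ball 0 r \<in> sets borel"
      using early_set_open[of n] by (intro borel_open open_Int) auto
    moreover have "emeasure lborel (early_set n \<inter> ball 0 r) \<le> ennreal \<delta>"
    proof -
      have "emeasure lborel (early_set n \<inter> ball 0 r) \<le> emeasure lborel (early_set n)"
        using early_set_open[of n] by (intro emeasure_mono) auto
      also have "\<dots> \<le> ennreal (M / real n)" unfolding M_def by (rule emeasure_early_set[OF n(1)])
      also have "\<dots> \<le> ennreal \<delta>" by (rule ennreal_leI[OF n(2)])
      finally show ?thesis .
    qed
    moreover have "?g x = 0" if "x \<notin> early_set n \<inter> ball 0 r" for x
      using that gE test_fn_zero[OF g, of x] by auto
    ultimately show "\<exists>f g E. concentrated (ball (0 :: real \<times> (real ^ 'n)) r) c \<delta> f g E"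
      using f f1 unfolding concentrated_def
      by (intro exI[of _ f] exI[of _ ?g] exI[of _ "early_set n \<inter> ball 0 r"]) blast
  qed
qed

subsection \<open>The range of exponents\<close>

lemma cone_multiplier_bounded:
  fixes f :: "real \<times> (real ^ 'n) \<Rightarrow> complex"
  assumes p: "2 \<le> p" and q: "1 \<le> q" "q \<le> 2" and [measurable]: "B \<in> sets borel"
    and V: "emeasure lborel B \<le> ennreal V" "V \<ge> 0" and f: "f \<in> test_fns B"
  shows "Lp_norm q B (cone_multiplier f) \<le> ennreal ((1 + V)\<^sup>2) * Lp_norm p B f"
proof (rule ennreal_le_mult_if)
  show "(1 + V)\<^sup>2 > 0" using V by simp
  fix K :: real assume K: "K > 0" "Lp_norm p B f \<le> ennreal K"
  have [measurable]: "f \<in> borel_measurable borel" "cone_multiplier f \<in> borel_measurable borel"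
    using f by measurable
  have K': "(1 + V) * K > 0" using V K by simp
  have "Lp_norm 2 B f \<le> ennreal ((1 + V) * K)"
    by (rule Lp_norm_mono_exponent[OF _ p _ _ V K]) auto
  then have "(\<integral>\<^sup>+x\<in>B. ennreal ((norm (f x))\<^sup>2) \<partial>lborel) \<le> ennreal (((1 + V) * K)\<^sup>2)"
    using Lp_norm_2_le_iff[of "(1 + V) * K" B f] K' by simp
  also have "(\<integral>\<^sup>+x\<in>B. ennreal ((norm (f x))\<^sup>2) \<partial>lborel) = energy f"
    using test_fn_zero[OF f] by (intro nn_integral_cong) (auto simp: indicator_def)
  finally have "energy (cone_multiplier f) \<le> ennreal (((1 + V) * K)\<^sup>2)"
    using cone_multiplier_L2_le[OF f] by (rule order_trans[rotated])
  moreover have "(\<integral>\<^sup>+x\<in>B. ennreal ((norm (cone_multiplier f x))\<^sup>2) \<partial>lborel) \<le> energy (cone_multiplier f)"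
    by (intro nn_integral_mono) (auto simp: indicator_def)
  ultimately have "Lp_norm 2 B (cone_multiplier f) \<le> ennreal ((1 + V) * K)"
    using Lp_norm_2_le_iff[of "(1 + V) * K" B "cone_multiplier f"] K' by simp
  then have "Lp_norm q B (cone_multiplier f) \<le> ennreal ((1 + V) * ((1 + V) * K))"
    by (intro Lp_norm_mono_exponent[OF q(1) q(2) _ _ V K']) auto
  then show "Lp_norm q B (cone_multiplier f) \<le> ennreal ((1 + V)\<^sup>2 * K)"
    by (simp add: power2_eq_square mult.assoc)
qed

lemma emeasure_ball_le:
  obtains V where "emeasure lborel (ball (x :: 'a::euclidean_space) r) \<le> ennreal V" "V \<ge> 0"
  using that[of "measure lborel (ball x r)"] emeasure_lborel_ball_finite[of x r]
  by (auto simp: emeasure_eq_ennreal_measure)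

lemma Re_integral_le:
  assumes "(\<integral>\<^sup>+x. ennreal (norm (h x)) \<partial>M) \<le> ennreal b" "b \<ge> 0" and int: "integrable M h"
  shows "Re (LINT x|M. h x) \<le> b"
proof -
  have "ennreal (norm (LINT x|M. h x)) \<le> ennreal b"
    using integral_norm_bound_ennreal[OF int] assms(1) by (rule order_trans)
  then show ?thesis using assms(2) complex_Re_le_cmod order_trans by (auto simp: ennreal_le_iff)
qed

lemma cone_multiplier_bounded_imp_q_le_2:
  fixes C :: real
  assumes card: "CARD('n::finite) \<ge> 2" and r: "r > 0" and B: "B = ball (0 :: real \<times> (real ^ 'n)) r"
    and p: "1 \<le> p" and C: "C > 0"
    and bdd: "\<And>f. f \<in> test_fns B \<Longrightarrow> Lp_norm q B (cone_multiplier f) \<le> ennreal C * Lp_norm p B f"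
  shows "q \<le> 2"
proof (rule ccontr)
  assume "\<not> q \<le> 2"
  then have q: "2 < q" by simp
  obtain V where V: "emeasure lborel B \<le> ennreal V" "V \<ge> 0"
    unfolding B by (rule emeasure_ball_le)
  have [measurable]: "B \<in> sets borel" by (simp add: B)
  obtain c where c: "c > 0" "\<And>\<delta>. \<delta> > 0 \<Longrightarrow> \<exists>f g E. concentrated B c \<delta> f g E"
    unfolding B using ex_concentrated_test_functions[OF card r] by metis
  define K where "K = C * (1 + V)"
  have K: "K > 0" using C V by (simp add: K_def)
  define \<epsilon> where "\<epsilon> = c / (2 * K)"
  have \<epsilon>: "\<epsilon> > 0" using c K by (simp add: \<epsilon>_def)
  obtain \<delta> where \<delta>: "\<delta> > 0" "\<And>K E B (f :: real \<times> (real ^ 'n) \<Rightarrow> complex). \<lbrakk>K > 0; E \<subseteq> B; E \<in> sets borel; B \<in> sets borel;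
       f \<in> borel_measurable borel; emeasure lborel E \<le> ennreal \<delta>; Lp_norm q B f \<le> ennreal K\<rbrakk> \<Longrightarrow>
     Lp_norm 2 E f \<le> ennreal (\<epsilon> * K)"
    using Lp_norm_small_support[of 2 q \<epsilon>] q \<epsilon> by auto
  obtain f g E where f: "f \<in> test_fns B" and g: "g \<in> test_fns B"
    and f1: "\<And>x. norm (f x) \<le> 1" and E: "E \<in> sets borel" "E \<subseteq> B" "emeasure lborel E \<le> ennreal \<delta>"
    and gE: "\<And>x. x \<notin> E \<Longrightarrow> g x = 0" and g1: "energy g \<le> 1"
    and cfg: "c \<le> cone_form f g"
    using c(2)[OF \<delta>(1)] unfolding concentrated_def by blast
  have [measurable]: "f \<in> borel_measurable borel" "g \<in> borel_measurable borel" "cone_multiplier f \<in> borel_measurable borel" "E \<in> sets borel"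
    using f g E by measurable
  have "Lp_norm p B f \<le> ennreal (1 + V)"
    by (rule Lp_norm_bounded[OF p _ _ V f1]) auto
  then have "Lp_norm q B (cone_multiplier f) \<le> ennreal C * ennreal (1 + V)"
    by (intro order_trans[OF bdd[OF f]] mult_left_mono) auto
  also have "\<dots> = ennreal K" using C V by (simp add: K_def ennreal_mult)
  finally have Sq: "Lp_norm q B (cone_multiplier f) \<le> ennreal K" .
  have "Lp_norm 2 E (cone_multiplier f) \<le> ennreal (\<epsilon> * K)"
    by (rule \<delta>(2)[OF K E(2) E(1) _ _ E(3) Sq]; measurable)
  also have "\<epsilon> * K = c / 2" using K by (simp add: \<epsilon>_def)
  finally have S: "(\<integral>\<^sup>+x\<in>E. ennreal ((norm (cone_multiplier f x))\<^sup>2) \<partial>lborel) \<le> ennreal ((c / 2)\<^sup>2)"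
    using Lp_norm_2_le_iff[of "c / 2" E "cone_multiplier f"] c(1) by simp
  have "(\<integral>\<^sup>+x. ennreal (norm (cone_multiplier f x * cnj (g x))) \<partial>lborel)
     \<le> (\<integral>\<^sup>+x. ennreal (1 / c) * (ennreal ((norm (cone_multiplier f x))\<^sup>2) * indicator E x) + ennreal (c / 4) * ennreal ((norm (g x))\<^sup>2) \<partial>lborel)"
  proof (rule nn_integral_mono)
    fix x
    show "ennreal (norm (cone_multiplier f x * cnj (g x))) \<le> ennreal (1 / c) * (ennreal ((norm (cone_multiplier f x))\<^sup>2) * indicator E x) + ennreal (c / 4) * ennreal ((norm (g x))\<^sup>2)"
    proof (cases "x \<in> E")
      case True
      let ?a = "norm (cone_multiplier f x)" and ?b = "norm (g x)"
      have "0 \<le> (?a - c / 2 * ?b)\<^sup>2 / c" using c(1) by simp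
      also have "\<dots> = 1 / c * ?a\<^sup>2 + c / 4 * ?b\<^sup>2 - ?a * ?b"
        using c(1) by (simp add: power2_eq_square field_simps)
      finally have "ennreal (norm (cone_multiplier f x * cnj (g x))) \<le> ennreal (1 / c * ?a\<^sup>2 + c / 4 * ?b\<^sup>2)"
        by (intro ennreal_leI) (simp add: norm_mult)
      also have "\<dots> = ennreal (1 / c) * ennreal (?a\<^sup>2) + ennreal (c / 4) * ennreal (?b\<^sup>2)"
        using c(1) by (intro ennreal_lincomb) auto
      finally show ?thesis using True by simp
    qed (simp add: gE)
  qed
  also have "\<dots> = ennreal (1 / c) * (\<integral>\<^sup>+x\<in>E. ennreal ((norm (cone_multiplier f x))\<^sup>2) \<partial>lborel) + ennreal (c / 4) * energy g"
    by (simp add: nn_integral_add nn_integral_cmult)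
  also have "\<dots> \<le> ennreal (1 / c) * ennreal ((c / 2)\<^sup>2) + ennreal (c / 4) * ennreal 1"
    using S g1 by (intro add_mono mult_left_mono) auto
  also have "\<dots> = ennreal (1 / c * (c / 2)\<^sup>2 + c / 4 * 1)"
    using c(1) by (intro ennreal_lincomb[symmetric]) auto
  also have "1 / c * (c / 2)\<^sup>2 + c / 4 * 1 = c / 2"
    using c(1) by (simp add: power2_eq_square field_simps)
  finally have "cone_form f g \<le> c / 2"
    unfolding cone_form_eq_integral[OF f g]
    using c(1) by (intro Re_integral_le cone_multiplier_Parseval(2)[OF f g]) auto
  with cfg c(1) show False by simp
qed

lemma cone_multiplier_bounded_imp_2_le_p:
  fixes C :: real
  assumes card: "CARD('n::finite) \<ge> 2" and r: "r > 0" and B: "B = ball (0 :: real \<times> (real ^ 'n)) r"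
    and p: "1 \<le> p" and q: "1 \<le> q" and C: "C > 0"
    and bdd: "\<And>f. f \<in> test_fns B \<Longrightarrow> Lp_norm q B (cone_multiplier f) \<le> ennreal C * Lp_norm p B f"
  shows "2 \<le> p"
proof (rule ccontr)
  assume "\<not> 2 \<le> p"
  then have p2: "p < 2" by simp
  then have pinf: "p \<noteq> \<infinity>" by auto
  obtain V where V: "emeasure lborel B \<le> ennreal V" "V \<ge> 0"
    unfolding B by (rule emeasure_ball_le)
  have [measurable]: "B \<in> sets borel" by (simp add: B)
  obtain c where c: "c > 0" "\<And>\<delta>. \<delta> > 0 \<Longrightarrow> \<exists>f g E. concentrated B c \<delta> f g E"
    unfolding B using ex_concentrated_test_functions[OF card r] by metis
  define \<epsilon> where "\<epsilon> = c / (2 * (C * (1 + V)))"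
  have \<epsilon>: "\<epsilon> > 0" using c C V by (simp add: \<epsilon>_def)
  obtain \<delta> where \<delta>: "\<delta> > 0" "\<And>K E B (f :: real \<times> (real ^ 'n) \<Rightarrow> complex). \<lbrakk>K > 0; E \<subseteq> B; E \<in> sets borel; B \<in> sets borel;
       f \<in> borel_measurable borel; emeasure lborel E \<le> ennreal \<delta>; Lp_norm 2 B f \<le> ennreal K\<rbrakk> \<Longrightarrow>
     Lp_norm p E f \<le> ennreal (\<epsilon> * K)"
    using Lp_norm_small_support[OF p p2 \<epsilon>] by blast
  obtain f g E where f: "f \<in> test_fns B" and g: "g \<in> test_fns B"
    and f1: "\<And>x. norm (f x) \<le> 1" and E: "E \<in> sets borel" "E \<subseteq> B" "emeasure lborel E \<le> ennreal \<delta>"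
    and gE: "\<And>x. x \<notin> E \<Longrightarrow> g x = 0" and g1: "energy g \<le> 1"
    and cfg: "c \<le> cone_form f g"
    using c(2)[OF \<delta>(1)] unfolding concentrated_def by blast
  have [measurable]: "f \<in> borel_measurable borel" "g \<in> borel_measurable borel" "cone_multiplier g \<in> borel_measurable borel" "E \<in> sets borel"
    using f g E by measurable
  have "(\<integral>\<^sup>+x\<in>B. ennreal ((norm (g x))\<^sup>2) \<partial>lborel) \<le> energy g"
    by (intro nn_integral_mono) (auto simp: indicator_def)
  then have "Lp_norm 2 B g \<le> ennreal 1"
    using Lp_norm_2_le_iff[of 1 B g] g1 by simp
  note g2 = this
  have "Lp_norm p E g \<le> ennreal (\<epsilon> * 1)"
    by (rule \<delta>(2)[OF zero_less_one E(2) E(1) _ _ E(3) g2]; measurable)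
  then have "Lp_norm p E g \<le> ennreal \<epsilon>" by simp
  moreover have "(\<integral>\<^sup>+x\<in>E. ennreal (norm (g x) powr enn2real p) \<partial>lborel) = (\<integral>\<^sup>+x\<in>B. ennreal (norm (g x) powr enn2real p) \<partial>lborel)"
    using gE E(2) by (intro nn_integral_cong) (auto simp: indicator_def)
  ultimately have "Lp_norm p B g \<le> ennreal \<epsilon>"
    using Lp_norm_le_iff[OF p pinf less_imp_le[OF \<epsilon>], of E g] Lp_norm_le_iff[OF p pinf less_imp_le[OF \<epsilon>], of B g] by simp
  then have "Lp_norm q B (cone_multiplier g) \<le> ennreal C * ennreal \<epsilon>"
    by (intro order_trans[OF bdd[OF g]] mult_left_mono) auto
  also have "\<dots> = ennreal (C * \<epsilon>)" using C \<epsilon> by (simp add: ennreal_mult)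
  finally have "Lp_norm 1 B (cone_multiplier g) \<le> ennreal ((1 + V) * (C * \<epsilon>))"
    using C \<epsilon> by (intro Lp_norm_mono_exponent[OF _ q _ _ V]) auto
  also have "(1 + V) * (C * \<epsilon>) = c / 2"
  proof -
    define D where "D = C * (1 + V)"
    have "D > 0" using C V by (simp add: D_def)
    then have "D * \<epsilon> = c / 2" by (simp add: \<epsilon>_def D_def[symmetric])
    then show ?thesis by (simp only: D_def mult_ac)
  qed
  finally have S: "(\<integral>\<^sup>+x\<in>B. ennreal (norm (cone_multiplier g x)) \<partial>lborel) \<le> ennreal (c / 2)"
    using Lp_norm_1_le_iff[of "c / 2" B "cone_multiplier g"] c(1) by simp
  have "(\<integral>\<^sup>+x. ennreal (norm (cone_multiplier g x * cnj (f x))) \<partial>lborel) \<le> (\<integral>\<^sup>+x\<in>B. ennreal (norm (cone_multiplier g x)) \<partial>lborel)"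
  proof (rule nn_integral_mono)
    fix x
    have "norm (cone_multiplier g x * cnj (f x)) \<le> norm (cone_multiplier g x)"
      using f1[of x] by (simp add: norm_mult mult_left_le)
    then show "ennreal (norm (cone_multiplier g x * cnj (f x))) \<le> ennreal (norm (cone_multiplier g x)) * indicator B x"
      using test_fn_zero[OF f, of x] by (cases "x \<in> B") (auto intro: ennreal_leI)
  qed
  then have "cone_form g f \<le> c / 2"
    unfolding cone_form_eq_integral[OF g f]
    using S c(1) by (intro Re_integral_le cone_multiplier_Parseval(2)[OF g f]) auto
  with cfg c(1) show False by (simp add: cone_form_commute)
qed

theorem theorem5:
  fixes r\<^sub>0 :: real and p q :: ennreal and B :: "(real \<times> (real ^ 'n)) set"
  assumes "CARD('n) \<ge> 2"
    and "r\<^sub>0 > 0"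
    and "B = ball 0 r\<^sub>0"
    and "1 \<le> p" and "1 \<le> q"
  shows "(\<exists>C::real. C > 0 \<and>
            (\<forall>f \<in> smooth_compact_support B.
               Lp_norm q B (cone_multiplier f) \<le> ennreal C * Lp_norm p B f))
         \<longleftrightarrow> 1 \<le> q \<and> q \<le> 2 \<and> 2 \<le> p \<and> p \<le> \<infinity>"
proof
  assume "\<exists>C::real. C > 0 \<and> (\<forall>f \<in> smooth_compact_support B.
               Lp_norm q B (cone_multiplier f) \<le> ennreal C * Lp_norm p B f)"
  then obtain C :: real where C: "C > 0"
    "\<And>f. f \<in> smooth_compact_support B \<Longrightarrow> Lp_norm q B (cone_multiplier f) \<le> ennreal C * Lp_norm p B f"
    by blast
  have "q \<le> 2" by (rule cone_multiplier_bounded_imp_q_le_2[OF assms(1-4) C])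
  moreover have "2 \<le> p" by (rule cone_multiplier_bounded_imp_2_le_p[OF assms C])
  ultimately show "1 \<le> q \<and> q \<le> 2 \<and> 2 \<le> p \<and> p \<le> \<infinity>" using assms(5) by simp
next
  assume *: "1 \<le> q \<and> q \<le> 2 \<and> 2 \<le> p \<and> p \<le> \<infinity>"
  obtain V where V: "emeasure lborel B \<le> ennreal V" "V \<ge> 0"
    unfolding assms(3) by (rule emeasure_ball_le)
  have "B \<in> sets borel" by (simp add: assms(3))
  then have "\<forall>f \<in> smooth_compact_support B. Lp_norm q B (cone_multiplier f) \<le> ennreal ((1 + V)\<^sup>2) * Lp_norm p B f"
    using cone_multiplier_bounded[of p q B V] * V by blast
  moreover have "(1 + V)\<^sup>2 > 0" using V by simp
  ultimately show "\<exists>C::real. C > 0 \<and> (\<forall>f \<in> smooth_compact_support B.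
               Lp_norm q B (cone_multiplier f) \<le> ennreal C * Lp_norm p B f)" by blast
qed

end
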